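(* The boundary $\overline{\mathcal{F}}_{F_{21}}\setminus\mathcal{F}_{F_{21}}$ of the moduli space of cubic fourfolds with $F_{21}$-action consists of the following three parts: two irreducible curves and one point. One of the irreducible curves consists of singular cubic fourfolds with singularities of ADE type, and the other irreducible curve consists of cubic fourfolds of type $[1,0,t,-1]$ ($t\in\mathbb{C}$). The point is given by the cubic fourfold $[0,0,1,1]$.
   Context: Everything is over $\mathbb{C}$. $F_{21}$ is the nonabelian group of order $21$, realized in $\mathrm{SL}(6,\mathbb{C})$ as generated by $g_7=\mathrm{diag}(\zeta,\zeta^5,\zeta^4,\zeta^6,\zeta^2,\zeta^3)$, $\zeta=e^{2\pi i/7}$, and the permutation matrix $g_3:e_i\mapsto e_{i+2}$ (indices mod $6$). $\mathcal{V}_{F_{21}}$ is the space of $F_{21}$-invariant cubic forms; $[a,b,c,d]\in\mathbb{P}\mathcal{V}_{F_{21}}\cong\mathbb{P}^3$ denotes the cubic fourfold $a(x_1^2x_2+x_3^2x_4+x_5^2x_6)+b(x_2^2x_3+x_4^2x_5+x_6^2x_1)+cx_1x_3x_5+dx_2x_4x_6=0$. $\mathcal{F}_{F_{21}}=N_{\mathrm{PGL}(6,\mathbb{C})}(F_{21})\backslash\mathbb{P}\mathcal{V}_{F_{21}}^{sm}$, where $^{sm}$ denotes the locus of smooth cubic fourfolds, and $\overline{\mathcal{F}}_{F_{21}}$ is the GIT quotient of the semistable locus of $\mathbb{P}\mathcal{V}_{F_{21}}$ by the preimage of $N_{\mathrm{PGL}(6,\mathbb{C})}(F_{21})$ in $\mathrm{SL}(6,\mathbb{C})$.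 *)

theory Defs
  imports "HOL-Analysis.Analysis" "HOL-Algebra.Group_Action" "HOL-Algebra.Generated_Groups" "HOL-Library.Extended_Nat"
begin

section \<open>The group of order 21 and its normalizer in the projective linear group\<close>

text \<open>
  The index type \<open>6\<close> is the ring of integers modulo 6, so the coordinates
  \<open>x $ 1, \<dots>, x $ 6\<close> (with \<open>6 = 0\<close>) are cyclically indexed and \<open>i + 2\<close> below is taken modulo 6.
\<close>

definition GL6 :: "(complex^6^6) monoid" where
  "GL6 = \<lparr>carrier = {A. invertible A}, mult = (**), one = mat 1\<rparr>"

definition SL6 :: "(complex^6^6) monoid" where
  "SL6 = \<lparr>carrier = {A. det A = 1}, mult = (**), one = mat 1\<rparr>"

definition scalars6 :: "(complex^6^6) set" where
  "scalars6 = {mat c | c. c \<noteq> 0}"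

definition PGL6 :: "(complex^6^6) set monoid" where
  "PGL6 = GL6 Mod scalars6"

definition to_PGL6 :: "complex^6^6 \<Rightarrow> (complex^6^6) set" where
  "to_PGL6 A = scalars6 #>\<^bsub>GL6\<^esub> A"

definition \<zeta> :: complex where
  "\<zeta> = exp (2 * pi * \<i> / 7)"

definition g7 :: "complex^6^6" where
  "g7 = (\<chi> i j. if i = j then vector [\<zeta>, \<zeta>^5, \<zeta>^4, \<zeta>^6, \<zeta>^2, \<zeta>^3] $ i else 0)"

definition g3 :: "complex^6^6" where
  "g3 = (\<chi> i j. if i = j + 2 then 1 else 0)"

definition F21 :: "(complex^6^6) set" where
  "F21 = generate SL6 {g7, g3}"

definition N_F21 :: "(complex^6^6) set set" where
  "N_F21 = normalizer PGL6 (to_PGL6 ` F21)"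

definition N_SL_F21 :: "(complex^6^6) set" where
  "N_SL_F21 = {A \<in> carrier SL6. to_PGL6 A \<in> N_F21}"


section \<open>Cubic forms\<close>

text \<open>
  Forms on \<open>\<complex>\<^sup>6\<close> are represented by the polynomial functions they define, which loses nothing
  over an infinite field.
\<close>

type_synonym form6 = "complex^6 \<Rightarrow> complex"

definition cubic_forms :: "form6 set" where
  "cubic_forms = {f. \<exists>T. \<forall>x. f x = (\<Sum>i\<in>UNIV. \<Sum>j\<in>UNIV. \<Sum>k\<in>UNIV. T i j k * x $ i * x $ j * x $ k)}"

definition act :: "complex^6^6 \<Rightarrow> form6 \<Rightarrow> form6" where
  "act A f = (\<lambda>x. f (matrix_inv A *v x))"

definition V_F21 :: "form6 set" where
  "V_F21 = {f \<in> cubic_forms. \<forall>A\<in>F21. act A f = f}"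

definition cubic_abcd :: "complex \<Rightarrow> complex \<Rightarrow> complex \<Rightarrow> complex \<Rightarrow> form6" where
  "cubic_abcd a b c d = (\<lambda>x.
      a * ((x$1)\<^sup>2 * x$2 + (x$3)\<^sup>2 * x$4 + (x$5)\<^sup>2 * x$6)
    + b * ((x$2)\<^sup>2 * x$3 + (x$4)\<^sup>2 * x$5 + (x$6)\<^sup>2 * x$1)
    + c * (x$1 * x$3 * x$5) + d * (x$2 * x$4 * x$6))"

text \<open>Points of a projective space are one-dimensional subspaces, zero vector included.\<close>

definition line :: "form6 \<Rightarrow> form6 set" where
  "line f = {\<lambda>x. c * f x | c. True}"

definition proj :: "form6 set \<Rightarrow> form6 set set" where
  "proj V = {line f | f. f \<in> V \<and> f \<noteq> (\<lambda>x. 0)}"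

definition pt :: "complex \<Rightarrow> complex \<Rightarrow> complex \<Rightarrow> complex \<Rightarrow> form6 set" where
  "pt a b c d = line (cubic_abcd a b c d)"

text \<open>
  A class in \<open>PGL(6)\<close> is a coset \<open>C\<close> of the scalars; all its members map a line of forms to the
  same line up to rescaling of the elements, so the union is again a line.
\<close>

definition act_PGL :: "(complex^6^6) set \<Rightarrow> form6 set \<Rightarrow> form6 set" where
  "act_PGL C l = (\<Union>A\<in>C. act A ` l)"


section \<open>Smoothness and ADE singularities\<close>

text \<open>Singular points of the cubic fourfold, as points of the affine cone over it.\<close>

definition singular_points :: "form6 set \<Rightarrow> (complex^6) set" where
  "singular_points l = {p. p \<noteq> 0 \<and> (\<forall>f\<in>l. f p = 0 \<and> (f has_derivative (\<lambda>v. 0)) (at p))}"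

definition smooth_cubic :: "form6 set \<Rightarrow> bool" where
  "smooth_cubic l \<longleftrightarrow> singular_points l = {}"

definition complex_linear :: "(complex^'n \<Rightarrow> complex^'m) \<Rightarrow> bool" where
  "complex_linear D \<longleftrightarrow> (\<forall>v w. D (v + w) = D v + D w) \<and> (\<forall>c v. D (c *s v) = c *s D v)"

definition holo_map :: "(complex^'n) set \<Rightarrow> (complex^'n \<Rightarrow> complex^'m) \<Rightarrow> bool" where
  "holo_map U \<phi> \<longleftrightarrow> (\<forall>z\<in>U. \<exists>D. complex_linear D \<and> (\<phi> has_derivative D) (at z))"

definition holo_fun :: "(complex^'n) set \<Rightarrow> (complex^'n \<Rightarrow> complex) \<Rightarrow> bool" where
  "holo_fun U u \<longleftrightarrow> holo_map U (\<lambda>z. \<chi> i::1. u z)"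

text \<open>
  Normal forms of the four-dimensional hypersurface singularities
  \<open>A\<^sub>n\<close> (\<open>n \<ge> 1\<close>), \<open>D\<^sub>n\<close> (\<open>n \<ge> 4\<close>), \<open>E\<^sub>6\<close>, \<open>E\<^sub>7\<close>, \<open>E\<^sub>8\<close> at the origin of \<open>\<complex>\<^sup>5\<close>.
\<close>

definition ade_curve_polys :: "(complex \<Rightarrow> complex \<Rightarrow> complex) set" where
  "ade_curve_polys =
     {\<lambda>x y. x^(n + 1) + y\<^sup>2 | n. n \<ge> 1}
   \<union> {\<lambda>x y. x\<^sup>2 * y + y^(n - 1) | n. n \<ge> 4}
   \<union> {\<lambda>x y. x^3 + y^4, \<lambda>x y. x^3 + x * y^3, \<lambda>x y. x^3 + y^5}"

definition ade_normal_forms :: "(complex^5 \<Rightarrow> complex) set" where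
  "ade_normal_forms = {\<lambda>z. q (z$1) (z$2) + (z$3)\<^sup>2 + (z$4)\<^sup>2 + (z$5)\<^sup>2 | q. q \<in> ade_curve_polys}"

text \<open>
  The germ of \<open>f = 0\<close> in projective 5-space at the point represented by \<open>p\<close> is analytically
  isomorphic to the germ of an ADE normal form. The holomorphic map \<open>\<phi>\<close> into \<open>\<complex>\<^sup>6\<close> sends \<open>0\<close> to
  \<open>p\<close>, and the condition on its derivative says that \<open>\<phi>\<close> followed by the projection to projective
  space is a local biholomorphism at \<open>0\<close>. The pulled back equation may differ from the normal form
  by the unit \<open>u\<close>.
\<close>

definition ade_singularity :: "form6 \<Rightarrow> complex^6 \<Rightarrow> bool" where
  "ade_singularity f p \<longleftrightarrow> (\<exists>U \<phi> u h.
      open U \<and> 0 \<in> U \<and> holo_map U \<phi> \<and> \<phi> 0 = p \<and>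
      (\<exists>D. (\<phi> has_derivative D) (at 0) \<and> (\<forall>w. \<exists>v c. w = D v + c *s p)) \<and>
      holo_fun U u \<and> (\<forall>z\<in>U. u z \<noteq> 0) \<and>
      h \<in> ade_normal_forms \<and> (\<forall>z\<in>U. f (\<phi> z) = u z * h z))"

definition singular_of_ADE_type :: "form6 set \<Rightarrow> bool" where
  "singular_of_ADE_type l \<longleftrightarrow> singular_points l \<noteq> {} \<and>
     (\<forall>p\<in>singular_points l. \<exists>f\<in>l. ade_singularity f p)"


section \<open>GIT quotients\<close>

text \<open>
  Let a group \<open>G\<close> of matrices act on a finite-dimensional space \<open>V\<close> of forms. Only the values on
  \<open>V\<close> of the functions in \<open>poly_functions V\<close> matter.
\<close>

inductive_set poly_functions :: "form6 set \<Rightarrow> (form6 \<Rightarrow> complex) set"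
  for V :: "form6 set" where
  const: "(\<lambda>f. k) \<in> poly_functions V"
| linear: "\<lbrakk>\<forall>f\<in>V. \<forall>g\<in>V. L (\<lambda>x. f x + g x) = L f + L g; \<forall>f\<in>V. \<forall>k. L (\<lambda>x. k * f x) = k * L f\<rbrakk>
    \<Longrightarrow> L \<in> poly_functions V"
| add: "\<lbrakk>P \<in> poly_functions V; Q \<in> poly_functions V\<rbrakk> \<Longrightarrow> (\<lambda>f. P f + Q f) \<in> poly_functions V"
| mult: "\<lbrakk>P \<in> poly_functions V; Q \<in> poly_functions V\<rbrakk> \<Longrightarrow> (\<lambda>f. P f * Q f) \<in> poly_functions V"

definition homogeneous_invariants ::
    "(complex^6^6) set \<Rightarrow> form6 set \<Rightarrow> nat \<Rightarrow> (form6 \<Rightarrow> complex) set" where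
  "homogeneous_invariants G V n = {P \<in> poly_functions V.
      (\<forall>f\<in>V. \<forall>k. P (\<lambda>x. k * f x) = k^n * P f) \<and>
      (\<forall>A\<in>G. \<forall>f\<in>V. P (act A f) = P f)}"

text \<open>The degrees below are positive, so a homogeneous \<open>P\<close> vanishes at the zero vector of a line.\<close>

definition nonvanishing :: "(form6 \<Rightarrow> complex) \<Rightarrow> form6 set \<Rightarrow> bool" where
  "nonvanishing P l \<longleftrightarrow> (\<exists>f\<in>l. P f \<noteq> 0)"

definition semistable_locus :: "(complex^6^6) set \<Rightarrow> form6 set \<Rightarrow> form6 set set" where
  "semistable_locus G V = {l \<in> proj V. \<exists>n>0. \<exists>P\<in>homogeneous_invariants G V n. nonvanishing P l}"

text \<open>
  The GIT quotient is \<open>Proj\<close> of the graded ring of invariants, considered as a variety. Two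
  semistable points have the same image in it iff the same homogeneous invariants vanish at them
  (they define the same homogeneous prime ideal), and every closed point is such an image. So its
  points are represented by the fibres of the quotient map, and the sets where a homogeneous
  invariant of positive degree does not vanish form a base of the Zariski topology.
\<close>

definition git_equiv :: "(complex^6^6) set \<Rightarrow> form6 set \<Rightarrow> (form6 set \<times> form6 set) set" where
  "git_equiv G V = {(l, m). l \<in> semistable_locus G V \<and> m \<in> semistable_locus G V \<and>
     (\<forall>n>0. \<forall>P\<in>homogeneous_invariants G V n. nonvanishing P l \<longleftrightarrow> nonvanishing P m)}"

definition git_quotient :: "(complex^6^6) set \<Rightarrow> form6 set \<Rightarrow> form6 set set set" where
  "git_quotient G V = semistable_locus G V // git_equiv G V"

definition git_topology :: "(complex^6^6) set \<Rightarrow> form6 set \<Rightarrow> form6 set set topology" where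
  "git_topology G V = topology_generated_by
     {{x \<in> git_quotient G V. \<exists>l\<in>x. nonvanishing P l} | P n. n > 0 \<and> P \<in> homogeneous_invariants G V n}"


section \<open>Irreducible curves\<close>

definition irreducible_in :: "'a topology \<Rightarrow> 'a set \<Rightarrow> bool" where
  "irreducible_in X S \<longleftrightarrow> S \<subseteq> topspace X \<and> S \<noteq> {} \<and>
     (\<forall>A B. closedin X A \<and> closedin X B \<and> S \<subseteq> A \<union> B \<longrightarrow> S \<subseteq> A \<or> S \<subseteq> B)"

definition krull_dim :: "'a topology \<Rightarrow> enat" where
  "krull_dim X = Sup {enat n | n. \<exists>Z. (\<forall>i\<le>n. closedin X (Z i) \<and> irreducible_in X (Z i)) \<and>
     (\<forall>i<n. Z i \<subset> Z (Suc i))}"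

definition irreducible_curve_in :: "'a topology \<Rightarrow> 'a set \<Rightarrow> bool" where
  "irreducible_curve_in X S \<longleftrightarrow>
     (\<exists>U C. openin X U \<and> closedin X C \<and> S = U \<inter> C) \<and>
     irreducible_in X S \<and> krull_dim (subtopology X S) = 1"


section \<open>The moduli space and its compactification\<close>

definition smooth_locus :: "form6 set set" where
  "smooth_locus = {l \<in> proj V_F21. smooth_cubic l}"

definition moduli_F21 :: "form6 set set set" where
  "moduli_F21 = {(\<lambda>C. act_PGL C l) ` N_F21 | l. l \<in> smooth_locus}"

definition compactified_moduli_F21 :: "form6 set set set" where
  "compactified_moduli_F21 = git_quotient N_SL_F21 V_F21"

definition compactified_moduli_topology :: "form6 set set topology" where
  "compactified_moduli_topology = git_topology N_SL_F21 V_F21"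

text \<open>
  The image of a set of lines in the quotient: for an orbit of semistable points this is the fibre
  containing it, and \<open>git_point l\<close> is empty, hence not a point of the quotient, if \<open>l\<close> is not
  semistable.
\<close>

definition orbit_image :: "form6 set set \<Rightarrow> form6 set set" where
  "orbit_image Orb = git_equiv N_SL_F21 V_F21 `` Orb"

definition git_point :: "form6 set \<Rightarrow> form6 set set" where
  "git_point l = orbit_image {l}"

definition boundary_F21 :: "form6 set set set" where
  "boundary_F21 = compactified_moduli_F21 - orbit_image ` moduli_F21"

end

theory Submission
  imports Defs
begin

text \<open>
  The normalizer of \<open>F\<^sub>2\<^sub>1\<close> acts on the coefficients of the invariant cubics through
  \<open>(a, b, c, d) \<mapsto> (l\<^sup>2n a, \<epsilon> n\<^sup>2l b, l\<^sup>3 c, n\<^sup>3 d)\<close> with \<open>\<epsilon>\<^sup>3 = 1\<close> and through the swap \<open>(b, a, d, c)\<close>.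
  Hence \<open>v = c d\<close>, \<open>s = a\<^sup>3 d + b\<^sup>3 c\<close> and \<open>w = (a b)\<^sup>3\<close> are weighted homogeneous coordinates on the
  quotient, and the semistable points with \<open>w = 0\<close> form the orbits of \<open>[1,0,t,-1]\<close> and \<open>[0,0,1,1]\<close>.

  If \<open>a b \<noteq> 0\<close>, all coordinates of a singular point are nonzero, and a diagonal change of
  coordinates moves it to \<open>(1,1,1,1,1,1)\<close> and the cubic to \<open>[\<alpha>, \<beta>, -2\<alpha>-\<beta>, -2\<beta>-\<alpha>]\<close>. The splitting lemma
  shows that the singularity is \<open>A\<^sub>1\<close>, or \<open>A\<^sub>2\<close> if \<open>\<alpha> + \<beta> = 0\<close>. The cubics with \<open>w = 0\<close> are singular along
  curves, whereas ADE singularities are isolated by the open mapping theorem.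

  Both curves of the boundary are rationally parametrised, so invariants restrict to polynomials in
  the parameter and the proper closed subsets are finite.
\<close>

section \<open>Indices modulo 5 and 6\<close>

text \<open>Neither the normalizer nor its ring of invariants is computed in closed form. The
  normalizer is enclosed from two sides. Inverses of elements of \<open>N_SL_F21\<close> are
  monomial with restricted entries, which suffices to verify that a few explicit functions are
  invariant. Explicit diagonal matrices and a shift of the coordinates lie in the normalizer, which
  suffices to bring points to normal form and to destabilise. The strata of the quotient are cut out
  by \<open>inv_w2\<close>, \<open>inv_disc\<close> and \<open>inv_s\<close>, so they are locally
  closed by construction.

  The analytic part meets an asymmetry. To exhibit an ADE singularity, a chart has to be built, and
  the inverse function theorem wants continuous derivatives; these are carried along in
  \<open>holo_germ\<close>. To refute one, a chart is given that is only complex differentiable at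
  every point, with nothing said about continuity of its derivative; the open mapping theorem used
  there asks for a continuous map with a surjective derivative at a single point.\<close>

lemma exhaust_6: fixes x :: 6 shows "x = 1 \<or> x = 2 \<or> x = 3 \<or> x = 4 \<or> x = 5 \<or> x = 6"
proof (induct x)
  case (of_int z)
  then have "z = 0 \<or> z = 1 \<or> z = 2 \<or> z = 3 \<or> z = 4 \<or> z = 5" by fastforce
  then show ?case by auto
qed

lemma exhaust_5: fixes x :: 5 shows "x = 1 \<or> x = 2 \<or> x = 3 \<or> x = 4 \<or> x = 5"
proof (induct x)
  case (of_int z)
  then have "z = 0 \<or> z = 1 \<or> z = 2 \<or> z = 3 \<or> z = 4" by fastforce
  then show ?case by auto
qed

lemma UNIV_6: "UNIV = {1, 2, 3, 4, 5, 6::6}" using exhaust_6 by auto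
lemma forall_6: "(\<forall>i::6. P i) \<longleftrightarrow> P 1 \<and> P 2 \<and> P 3 \<and> P 4 \<and> P 5 \<and> P 6"
  by (metis exhaust_6)

lemma sum_6: "sum f (UNIV::6 set) = f 1 + f 2 + f 3 + f 4 + f 5 + f 6"
  unfolding UNIV_6 by (simp add: ac_simps)
lemma vector_6: "(vector [a,b,c,d,e,f] :: 'a::zero^6) $ 1 = a"
 "(vector [a,b,c,d,e,f] :: 'a::zero^6) $ 2 = b" "(vector [a,b,c,d,e,f] :: 'a::zero^6) $ 3 = c"
 "(vector [a,b,c,d,e,f] :: 'a::zero^6) $ 4 = d" "(vector [a,b,c,d,e,f] :: 'a::zero^6) $ 5 = e"
 "(vector [a,b,c,d,e,f] :: 'a::zero^6) $ 6 = f"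
  by (simp_all add: vector_def)

lemma numerals_mod_6: "(7::6) = 1" "(8::6) = 2" "(9::6) = 3" "(10::6) = 4" "(11::6) = 5" "(12::6) = 0"
  "(6::6) = 0"
  by simp_all

text \<open>The simplifier rewrites the index \<open>6\<close> to \<open>0\<close>.\<close>

lemma vector_6_0: "(vector [a,b,c,d,e,f] :: 'a::zero^6) $ 0 = f"
  using vector_6(6)[of a b c d e f] unfolding numerals_mod_6 .

lemma prod_6: "prod f (UNIV::6 set) = f 1 * f 2 * f 3 * f 4 * f 5 * (f 6 :: 'a::comm_monoid_mult)"
  unfolding UNIV_6 by (simp add: ac_simps)

lemma forall_5: "(\<forall>i::5. P i) \<longleftrightarrow> P 1 \<and> P 2 \<and> P 3 \<and> P 4 \<and> P 5"
  by (metis exhaust_5)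

lemma vector_5: "(vector [a,b,c,d,e] :: 'a::zero^5) $ 1 = a"
 "(vector [a,b,c,d,e] :: 'a::zero^5) $ 2 = b" "(vector [a,b,c,d,e] :: 'a::zero^5) $ 3 = c"
 "(vector [a,b,c,d,e] :: 'a::zero^5) $ 4 = d" "(vector [a,b,c,d,e] :: 'a::zero^5) $ 5 = e"
  by (simp_all add: vector_def)

section \<open>Germs of holomorphic functions and charts\<close>

lemma complex_linear_imp_bounded_linear:
  assumes "complex_linear D" shows "bounded_linear D"
proof -
  have "D (r *\<^sub>R x) = r *\<^sub>R D x" for r x
  proof -
    have *: "r *\<^sub>R y = complex_of_real r *s y" for y :: "complex^'c"
      by (simp add: vec_eq_iff scaleR_conv_of_real[where 'a = complex])
    show ?thesis using assms by (simp only: * complex_linear_def)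
  qed
  then show ?thesis using assms
    by (auto simp: complex_linear_def linear_iff simp flip: linear_conv_bounded_linear)
qed

lemma has_derivative_vec:
  fixes f :: "'a::real_normed_vector \<Rightarrow> complex^'n"
  assumes "\<And>i. ((\<lambda>z. f z $ i) has_derivative (\<lambda>v. D v $ i)) (at z)"
  shows "(f has_derivative D) (at z)"
  unfolding has_derivative_componentwise_within[of f]
proof
  fix b :: "complex^'n" assume "b \<in> Basis"
  then obtain i c where b: "b = axis i c" by (auto simp: Basis_vec_def)
  show "((\<lambda>x. f x \<bullet> b) has_derivative (\<lambda>x. D x \<bullet> b)) (at z)"
    using has_derivative_inner_left[OF assms[of i], of c] by (simp add: b inner_axis)
qed

text \<open>The complex coefficients \<open>d j\<close> make the real derivative complex linear.
  Their continuity near 0 turns tuples of such germs into C^1 maps, to which the inverse function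
  theorem applies.\<close>

definition holo_germ :: "(complex^'n \<Rightarrow> complex) \<Rightarrow> bool" where
  "holo_germ u \<longleftrightarrow> (\<exists>W d. open W \<and> 0 \<in> W \<and> (\<forall>j. continuous_on W (d j)) \<and>
     (\<forall>z\<in>W. (u has_derivative (\<lambda>v. \<Sum>j\<in>UNIV. d j z * v $ j)) (at z)))"

lemma holo_germI:
  assumes "open W" "0 \<in> W" "\<And>j. continuous_on W (d j)"
    "\<And>z. z \<in> W \<Longrightarrow> (u has_derivative (\<lambda>v. \<Sum>j\<in>UNIV. d j z * v $ j)) (at z)"
  shows "holo_germ u"
  using assms unfolding holo_germ_def by blast

lemma holo_germE:
  assumes "holo_germ u"
  obtains W d where "open W" "0 \<in> W" "\<And>j. continuous_on W (d j)"
    "\<And>z. z \<in> W \<Longrightarrow> (u has_derivative (\<lambda>v. \<Sum>j\<in>UNIV. d j z * v $ j)) (at z)"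
  using assms unfolding holo_germ_def by blast

lemma holo_germ_const: "holo_germ (\<lambda>z. k)"
  by (rule holo_germI[where W = UNIV and d = "\<lambda>j z. 0"]) auto

lemma holo_germ_coord: "holo_germ (\<lambda>z::complex^'n. z $ i)"
proof (rule holo_germI[where W = UNIV and d = "\<lambda>j z. if j = i then 1 else 0"])
  fix z :: "complex^'n"
  have "(\<lambda>v::complex^'n. \<Sum>j\<in>UNIV. (if j = i then 1 else 0) * v $ j) = (\<lambda>v. v $ i)"
    by (simp add: if_distrib[where f = "\<lambda>x. x * _"] cong: if_cong)
  then show "((\<lambda>z. z $ i) has_derivative (\<lambda>v. \<Sum>j\<in>UNIV. (if j = i then 1 else 0) * v $ j)) (at z)"
    by (simp add: bounded_linear_imp_has_derivative bounded_linear_vec_nth)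
qed auto

lemma holo_germ_add:
  assumes "holo_germ u" "holo_germ v" shows "holo_germ (\<lambda>z. u z + v z)"
proof -
  obtain W d where W: "open W" "0 \<in> W" "\<And>j. continuous_on W (d j)"
    "\<And>z. z \<in> W \<Longrightarrow> (u has_derivative (\<lambda>v. \<Sum>j\<in>UNIV. d j z * v $ j)) (at z)"
    by (rule holo_germE[OF assms(1)]) (rule that)
  obtain W' d' where W': "open W'" "0 \<in> W'" "\<And>j. continuous_on W' (d' j)"
    "\<And>z. z \<in> W' \<Longrightarrow> (v has_derivative (\<lambda>v. \<Sum>j\<in>UNIV. d' j z * v $ j)) (at z)"
    by (rule holo_germE[OF assms(2)]) (rule that)
  show ?thesis
  proof (rule holo_germI[where W = "W \<inter> W'" and d = "\<lambda>j z. d j z + d' j z"])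
    fix z assume "z \<in> W \<inter> W'"
    then show "((\<lambda>z. u z + v z) has_derivative (\<lambda>v. \<Sum>j\<in>UNIV. (d j z + d' j z) * v $ j)) (at z)"
      using has_derivative_add[OF W(4) W'(4), of z] by (simp add: algebra_simps sum.distrib)
  qed (use W W' in \<open>auto intro!: continuous_intros intro: continuous_on_subset\<close>)
qed

lemma has_derivative_imp_continuous_on:
  assumes "\<And>z. z \<in> W \<Longrightarrow> (u has_derivative D z) (at z)" shows "continuous_on W u"
  using assms by (meson continuous_at_imp_continuous_on has_derivative_continuous)

lemma holo_germ_mult:
  assumes "holo_germ u" "holo_germ v" shows "holo_germ (\<lambda>z. u z * v z)"
proof -
  obtain W d where W: "open W" "0 \<in> W" "\<And>j. continuous_on W (d j)"
    "\<And>z. z \<in> W \<Longrightarrow> (u has_derivative (\<lambda>v. \<Sum>j\<in>UNIV. d j z * v $ j)) (at z)"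
    by (rule holo_germE[OF assms(1)]) (rule that)
  obtain W' d' where W': "open W'" "0 \<in> W'" "\<And>j. continuous_on W' (d' j)"
    "\<And>z. z \<in> W' \<Longrightarrow> (v has_derivative (\<lambda>v. \<Sum>j\<in>UNIV. d' j z * v $ j)) (at z)"
    by (rule holo_germE[OF assms(2)]) (rule that)
  have cont: "continuous_on W u" "continuous_on W' v"
    by (rule has_derivative_imp_continuous_on[OF W(4)], assumption)
      (rule has_derivative_imp_continuous_on[OF W'(4)])
  show ?thesis
  proof (rule holo_germI[where W = "W \<inter> W'" and d = "\<lambda>j z. u z * d' j z + d j z * v z"])
    fix z assume "z \<in> W \<inter> W'"
    then show "((\<lambda>z. u z * v z) has_derivative (\<lambda>w. \<Sum>j\<in>UNIV. (u z * d' j z + d j z * v z) * w $ j)) (at z)"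
      using has_derivative_mult[OF W(4) W'(4), of z]
      by (simp add: algebra_simps sum.distrib sum_distrib_left)
  qed (use W W' cont in \<open>auto intro!: continuous_intros intro: continuous_on_subset\<close>)
qed

lemma holo_germ_compose:
  assumes "holo_germ u" "open S" "u 0 \<in> S" "continuous_on S g'"
    and g: "\<And>w. w \<in> S \<Longrightarrow> (g has_field_derivative g' w) (at w)"
  shows "holo_germ (\<lambda>z. g (u z))"
proof -
  obtain W d where W: "open W" "0 \<in> W" "\<And>j. continuous_on W (d j)"
    "\<And>z. z \<in> W \<Longrightarrow> (u has_derivative (\<lambda>v. \<Sum>j\<in>UNIV. d j z * v $ j)) (at z)"
    by (rule holo_germE[OF assms(1)]) (rule that)
  have cont: "continuous_on W u"
    by (rule has_derivative_imp_continuous_on[OF W(4)])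
  let ?W = "W \<inter> u -` S"
  show ?thesis
  proof (rule holo_germI[where W = ?W and d = "\<lambda>j z. g' (u z) * d j z"])
    show "open ?W" unfolding Int_commute[of W] using continuous_on_open_vimage[OF W(1)] cont assms(2)
      by blast
    show "continuous_on ?W (\<lambda>z. g' (u z) * d j z)" for j
      by (intro continuous_intros continuous_on_compose2[OF assms(4)])
        (auto intro: continuous_on_subset[OF W(3)] continuous_on_subset[OF cont])
    fix z assume z: "z \<in> ?W"
    have "(g has_derivative (\<lambda>w. g' (u z) * w)) (at (u z))"
      using g z by (simp add: has_field_derivative_def)
    from has_derivative_compose[OF W(4) this] z
    show "((\<lambda>z. g (u z)) has_derivative (\<lambda>v. \<Sum>j\<in>UNIV. (g' (u z) * d j z) * v $ j)) (at z)"
      by (simp add: sum_distrib_left mult.assoc)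
  qed (use W assms(3) in auto)
qed

lemma holo_germ_inverse:
  assumes "holo_germ u" "u 0 \<noteq> 0" shows "holo_germ (\<lambda>z. inverse (u z))"
proof (rule holo_germ_compose[where g = inverse and u = u and S = "- {0}" and g' = "\<lambda>w. - inverse (w ^ 2)"])
  show "(inverse has_field_derivative - inverse (w ^ 2)) (at w)" if "w \<in> - {0}" for w :: complex
    using that DERIV_inverse[of w UNIV] by (simp add: numeral_2_eq_2)
qed (use assms in \<open>auto intro!: continuous_intros\<close>)

text \<open>The value 1 at the origin keeps \<open>u\<close> off the branch cut on a neighbourhood,
  so the principal root is holomorphic there.\<close>

lemma holo_germ_csqrt:
  assumes "holo_germ u" "u 0 = 1" shows "holo_germ (\<lambda>z. csqrt (u z))"
proof (rule holo_germ_compose[where g = csqrt and u = u and S = "- \<real>\<^sub>\<le>\<^sub>0"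
  and g' = "\<lambda>w. inverse (2 * csqrt w)"])
  show "(csqrt has_field_derivative inverse (2 * csqrt w)) (at w)" if "w \<in> - \<real>\<^sub>\<le>\<^sub>0" for w
    using that has_field_derivative_csqrt by auto
  show "continuous_on (- \<real>\<^sub>\<le>\<^sub>0) (\<lambda>w. inverse (2 * csqrt w))"
    by (intro continuous_intros continuous_on_csqrt) auto
qed (use assms in auto)

lemma holo_germ_continuous:
  assumes "holo_germ u" shows "isCont u 0"
proof -
  obtain W d where "0 \<in> W"
    and "\<And>z. z \<in> W \<Longrightarrow> (u has_derivative (\<lambda>v. \<Sum>j\<in>UNIV. d j z * v $ j)) (at z)"
    by (rule holo_germE[OF assms]) (rule that)
  then show ?thesis using has_derivative_continuous[of u] by metis
qed

lemmas holo_germ_intros = holo_germ_const holo_germ_coord holo_germ_add holo_germ_mult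

text \<open>An equation for \<open>f\<close> in coordinates \<open>\<psi>\<close> becomes a chart of the required kind by inverting \<open>\<psi>\<close>.\<close>

lemma ade_singularity_from_coordinates:
  fixes \<psi> :: "complex^5 \<Rightarrow> complex^5"
  assumes holo: "\<And>i. holo_germ (\<lambda>z. \<psi> z $ i)" and "\<psi> 0 = 0"
    and D0: "(\<psi> has_derivative D0) (at 0)" "\<And>v. D0 v = 0 \<Longrightarrow> v = 0"
    and E: "complex_linear E" "\<And>w. \<exists>v c. w = E v + c *s p"
    and h: "h \<in> ade_normal_forms" and "\<kappa> \<noteq> 0"
    and eq: "\<forall>\<^sub>F z in nhds 0. f (p + E z) = \<kappa> * h (\<psi> z)"
  shows "ade_singularity f p"
proof -
  define chart where "chart = (\<lambda>i W d. open W \<and> 0 \<in> W \<and> (\<forall>j. continuous_on W (d j)) \<and>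
     (\<forall>z\<in>W. ((\<lambda>z. \<psi> z $ i) has_derivative (\<lambda>v. \<Sum>j\<in>UNIV. d j z * v $ j)) (at z)))"
  have "\<exists>W d. chart i W d" for i
    using holo[of i] unfolding holo_germ_def chart_def .
  then obtain W d where Wd: "\<And>i. chart i (W i) (d i)" by metis
  have W: "\<And>i. open (W i)" "\<And>i. 0 \<in> W i" "\<And>i j. continuous_on (W i) (d i j)"
    "\<And>i z. z \<in> W i \<Longrightarrow> ((\<lambda>z. \<psi> z $ i) has_derivative (\<lambda>v. \<Sum>j\<in>UNIV. d i j z * v $ j)) (at z)"
    using Wd by (simp_all add: chart_def)
  obtain N where N: "open N" "0 \<in> N" "\<And>z. z \<in> N \<Longrightarrow> f (p + E z) = \<kappa> * h (\<psi> z)"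
    using eq unfolding eventually_nhds by auto
  define U where "U = N \<inter> (\<Inter>i. W i)"
  have U: "open U" "0 \<in> U" using N W unfolding U_def by (auto intro!: open_INT)
  define J where "J = (\<lambda>z v::complex^5. (\<chi> i. \<Sum>j\<in>UNIV. d i j z * v $ j) :: complex^5)"
  have J_lin: "complex_linear (J z)" for z
    unfolding complex_linear_def J_def
    by (auto simp: vec_eq_iff algebra_simps sum.distrib sum_distrib_left)
  have Jb: "blinfun_apply (Blinfun (J z)) = J z" for z
    using J_lin by (intro bounded_linear_Blinfun_apply complex_linear_imp_bounded_linear)
  have der: "(\<psi> has_derivative J z) (at z)" if "z \<in> U" for z
    using W(4) that unfolding U_def J_def by (intro has_derivative_vec) simp
  have contJ: "continuous_on U (\<lambda>z. Blinfun (J z))"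
  proof (rule continuous_on_blinfun_componentwise)
    fix b :: "complex^5"
    have "continuous_on U (d i j)" for i j
      by (rule continuous_on_subset[OF W(3)[of i j]]) (auto simp: U_def)
    then show "continuous_on U (\<lambda>z. blinfun_apply (Blinfun (J z)) b)"
      unfolding Jb unfolding J_def by (intro continuous_intros)
  qed
  have der': "(\<psi> has_derivative blinfun_apply (Blinfun (J z))) (at z)" if "z \<in> U" for z
    using der[OF that] by (simp add: Jb)
  have D0J: "D0 = J 0" using has_derivative_unique[OF D0(1) der[OF U(2)]] .
  have "inj (J 0)"
    using D0(2) complex_linear_imp_bounded_linear[OF J_lin[of 0]]
    unfolding D0J by (simp add: linear_injective_0 bounded_linear.linear)
  then obtain I where I: "linear I" "I \<circ> J 0 = id"
    using complex_linear_imp_bounded_linear[OF J_lin[of 0]]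
    by (meson bounded_linear.linear linear_injective_left_inverse)
  have Ib: "blinfun_apply (Blinfun I) = I"
    using I(1) by (simp add: bounded_linear_Blinfun_apply linear_conv_bounded_linear)
  have invI: "Blinfun I o\<^sub>L Blinfun (J 0) = id_blinfun"
    by (rule blinfun_eqI) (use I(2) in \<open>simp add: Ib Jb fun_eq_iff\<close>)
  obtain U' V g g' where g: "open U'" "U' \<subseteq> U" "0 \<in> U'" "open V" "\<psi> 0 \<in> V" "homeomorphism U' V \<psi> g"
    "\<And>y. y \<in> V \<Longrightarrow> (g has_derivative (g' y)) (at y)"
    "\<And>y. y \<in> V \<Longrightarrow> g' y = inv_into UNIV (blinfun_apply (Blinfun (J (g y))))"
    "\<And>y. y \<in> V \<Longrightarrow> bij (blinfun_apply (Blinfun (J (g y))))"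
    by (rule inverse_function_theorem[OF U(1) der' contJ U(2) invI]) (assumption | rule that)+
  have g0: "g 0 = 0" using g(3,6) \<open>\<psi> 0 = 0\<close> by (metis homeomorphism_def)
  \<comment> \<open>The inverse function theorem is real and yields a real derivative of
    \<open>g\<close>; as the inverse of a complex linear bijection it is complex linear.\<close>
  have g'_lin: "complex_linear (g' y)" if "y \<in> V" for y
  proof -
    have bij: "bij (J (g y))" using g(9)[OF that] Jb by simp
    have eq: "g' y = inv_into UNIV (J (g y))" using g(8)[OF that] Jb by simp
    have s: "J (g y) (g' y w) = w" for w
      using bij unfolding eq by (simp add: bij_is_surj surj_f_inv_f)
    have i: "J (g y) a = J (g y) b \<Longrightarrow> a = b" for a b using bij by (meson bij_def injD)
    have "g' y (v + w) = g' y v + g' y w" for v w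
      by (rule i) (use J_lin[of "g y"] in \<open>simp add: complex_linear_def s\<close>)
    moreover have "g' y (c *s v) = c *s g' y v" for c v
      by (rule i) (use J_lin[of "g y"] in \<open>simp add: complex_linear_def s\<close>)
    ultimately show ?thesis by (simp add: complex_linear_def)
  qed
  define \<phi> where "\<phi> = (\<lambda>z. p + E (g z))"
  have \<phi>der: "(\<phi> has_derivative (\<lambda>v. E (g' z v))) (at z)" if "z \<in> V" for z
  proof -
    have "((\<lambda>z. E (g z)) has_derivative (\<lambda>v. E (g' z v))) (at z)"
      using g(7)[OF that] complex_linear_imp_bounded_linear[OF E(1)]
      by (rule bounded_linear.has_derivative[rotated])
    from has_derivative_add[OF has_derivative_const this] show ?thesis
      by (simp add: \<phi>_def)
  qed
  show ?thesis unfolding ade_singularity_def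
  proof (intro exI conjI)
    show "open V" by fact
    show "0 \<in> V" using g(5) \<open>\<psi> 0 = 0\<close> by simp
    show "holo_map V \<phi>" unfolding holo_map_def
    proof (intro ballI exI conjI)
      fix z assume "z \<in> V"
      then show "(\<phi> has_derivative (\<lambda>v. E (g' z v))) (at z)" by (rule \<phi>der)
      show "complex_linear (\<lambda>v. E (g' z v))"
        using g'_lin[OF \<open>z \<in> V\<close>] E(1) by (simp add: complex_linear_def)
    qed
    have "E 0 = 0" using complex_linear_imp_bounded_linear[OF E(1)]
      by (simp add: linear_0 bounded_linear.linear)
    then show "\<phi> 0 = p" by (simp add: \<phi>_def g0)
    show "(\<phi> has_derivative (\<lambda>v. E (g' 0 v))) (at 0)" using \<phi>der \<open>0 \<in> V\<close> .
    show "\<forall>w. \<exists>v c. w = E (g' 0 v) + c *s p"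
    proof
      fix w
      obtain v c where "w = E v + c *s p" using E(2) by blast
      moreover have "g' 0 (J 0 v) = v"
        using g(8,9)[OF \<open>0 \<in> V\<close>] by (simp add: g0 Jb bij_is_inj)
      ultimately show "\<exists>v c. w = E (g' 0 v) + c *s p" by metis
    qed
    show "holo_fun V (\<lambda>z. \<kappa>)" unfolding holo_fun_def holo_map_def complex_linear_def
      by (intro ballI exI[where x = "\<lambda>v. 0"]) auto
    show "\<forall>z\<in>V. \<kappa> \<noteq> 0" using \<open>\<kappa> \<noteq> 0\<close> by simp
    show "h \<in> ade_normal_forms" by fact
    show "\<forall>z\<in>V. f (\<phi> z) = \<kappa> * h z"
    proof
      fix z assume z: "z \<in> V"
      then have "g z \<in> U'" "\<psi> (g z) = z" using g(6) by (auto simp: homeomorphism_def)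
      moreover have "g z \<in> N" using \<open>g z \<in> U'\<close> g(2) by (auto simp: U_def)
      ultimately show "f (\<phi> z) = \<kappa> * h z" using N(3) by (simp add: \<phi>_def)
    qed
  qed
qed

section \<open>The splitting lemma\<close>

lemma holo_germ_times_coord:
  assumes "holo_germ l"
  shows "((\<lambda>z. l z * z $ j) has_derivative (\<lambda>v. l 0 * v $ j)) (at 0)"
proof -
  obtain D where "(l has_derivative D) (at 0)"
    using assms unfolding holo_germ_def by blast
  from has_derivative_mult[OF this bounded_linear_imp_has_derivative[OF bounded_linear_vec_nth[of j]]]
  show ?thesis by simp
qed

lemma holo_germ_minus:
  assumes "holo_germ u" "holo_germ v" shows "holo_germ (\<lambda>z. u z - v z)"
  using holo_germ_add[OF assms(1) holo_germ_mult[OF holo_germ_const[of "-1"] assms(2)]] by simp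

lemma holo_germ_divide:
  assumes "holo_germ u" "holo_germ v" "v 0 \<noteq> 0" shows "holo_germ (\<lambda>z. u z / v z)"
  unfolding divide_inverse using assms by (intro holo_germ_mult holo_germ_inverse)

lemma holo_germ_power:
  assumes "holo_germ u" shows "holo_germ (\<lambda>z. u z ^ n)"
  by (induction n) (use assms in \<open>auto intro: holo_germ_intros\<close>)

lemma holo_germ_eventually_nonzero:
  assumes "holo_germ u" "u 0 \<noteq> 0" shows "\<forall>\<^sub>F z in nhds 0. u z \<noteq> 0"
proof -
  have "(u \<longlongrightarrow> u 0) (nhds 0)"
    using holo_germ_continuous[OF assms(1)] by (simp add: isCont_def tendsto_at_iff_tendsto_nhds)
  then show ?thesis using assms(2) by (rule tendsto_imp_eventually_ne)
qed

definition linear_in_2345 :: "(complex^5 \<Rightarrow> complex) \<Rightarrow> bool" where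
  "linear_in_2345 l \<longleftrightarrow> (\<exists>c. \<forall>z. l z = (\<Sum>i\<in>{2,3,4,5}. c i * z $ i))"

text \<open>The coefficients may involve all five coordinates but vanish at 0. Such a remainder
  perturbs the Gram matrix of z2^2 + ... + z5^2 by a matrix that is zero at the origin, and since
  each term is quadratic in z2, ..., z5, the coordinate z1 splits off without completing a
  square.\<close>

definition higher_order_quadratic_in_2345 :: "(complex^5 \<Rightarrow> complex) \<Rightarrow> bool" where
  "higher_order_quadratic_in_2345 R \<longleftrightarrow> (\<exists>S. (\<forall>i j. holo_germ (S i j) \<and> S i j 0 = 0) \<and>
     (\<forall>z. R z = (\<Sum>i\<in>{2,3,4,5}. \<Sum>j\<in>{2,3,4,5}. S i j z * z $ i * z $ j)))"

lemma linear_in_2345_holo_germ: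
  assumes "linear_in_2345 l" shows "holo_germ l" "l 0 = 0"
proof -
  obtain c where c: "\<And>z. l z = (\<Sum>i\<in>{2,3,4,5}. c i * z $ i)"
    using assms unfolding linear_in_2345_def by blast
  have "l = (\<lambda>z. c 2 * z$2 + (c 3 * z$3 + (c 4 * z$4 + c 5 * z$5)))"
    using c by (auto simp: fun_eq_iff)
  then show "holo_germ l" by (auto intro!: holo_germ_intros)
  show "l 0 = 0" using c by simp
qed

lemma higher_order_quadratic_add:
  assumes "higher_order_quadratic_in_2345 R" "higher_order_quadratic_in_2345 R'"
  shows "higher_order_quadratic_in_2345 (\<lambda>z. R z + R' z)"
proof -
  obtain S where S: "\<And>i j. holo_germ (S i j)" "\<And>i j. S i j 0 = 0"
     "\<And>z. R z = (\<Sum>i\<in>{2,3,4,5}. \<Sum>j\<in>{2,3,4,5}. S i j z * z $ i * z $ j)"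
    using assms(1) unfolding higher_order_quadratic_in_2345_def by blast
  obtain S' where S': "\<And>i j. holo_germ (S' i j)" "\<And>i j. S' i j 0 = 0"
     "\<And>z. R' z = (\<Sum>i\<in>{2,3,4,5}. \<Sum>j\<in>{2,3,4,5}. S' i j z * z $ i * z $ j)"
    using assms(2) unfolding higher_order_quadratic_in_2345_def by blast
  show ?thesis unfolding higher_order_quadratic_in_2345_def
    by (rule exI[where x = "\<lambda>i j z. S i j z + S' i j z"])
      (use S S' in \<open>auto intro: holo_germ_add simp: sum.distrib distrib_right simp del: sum.insert\<close>)
qed

lemma higher_order_quadratic_mult:
  assumes "holo_germ u" "u 0 = 0" "linear_in_2345 l" "linear_in_2345 l'"
  shows "higher_order_quadratic_in_2345 (\<lambda>z. u z * l z * l' z)"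
proof -
  obtain c where c: "\<And>z. l z = (\<Sum>i\<in>{2,3,4,5}. c i * z $ i)"
    using assms(3) unfolding linear_in_2345_def by blast
  obtain c' where c': "\<And>z. l' z = (\<Sum>i\<in>{2,3,4,5}. c' i * z $ i)"
    using assms(4) unfolding linear_in_2345_def by blast
  show ?thesis unfolding higher_order_quadratic_in_2345_def
    by (rule exI[where x = "\<lambda>i j z. u z * c i * c' j"])
      (use assms(1,2) in \<open>auto intro!: holo_germ_intros
        simp: c c' sum_distrib_left sum_distrib_right mult_ac simp del: sum.insert\<close>)
qed

text \<open>
  The holomorphic splitting lemma in the shape needed here. The quadratic form with variable
  coefficients is turned into a sum of squares by its Cholesky decomposition, whose entries are
  holomorphic near the identity matrix.
\<close>

lemma ade_singularity_A_from_splitting: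
  assumes E: "complex_linear E" "\<And>w. \<exists>v c. w = E v + c *s p"
    and "n \<ge> 1" "\<kappa> \<noteq> 0" and g: "holo_germ g" "g 0 = 1"
    and R: "higher_order_quadratic_in_2345 R"
    and f: "\<And>z. f (p + E z) =
      \<kappa> * ((z$1 * g z)^(n + 1) + (z$2)\<^sup>2 + (z$3)\<^sup>2 + (z$4)\<^sup>2 + (z$5)\<^sup>2 + R z)"
  shows "ade_singularity f p"
proof -
  obtain S where S: "\<And>i j. holo_germ (S i j)" "\<And>i j. S i j 0 = 0"
     "\<And>z. R z = (\<Sum>i\<in>{2,3,4,5}. \<Sum>j\<in>{2,3,4,5}. S i j z * z $ i * z $ j)"
    using R unfolding higher_order_quadratic_in_2345_def by blast
  \<comment> \<open>Symmetric matrix of z2^2 + ... + z5^2 + R; it is the identity at 0 because all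
    \<open>S i j\<close> vanish there.\<close>
  define s where "s = (\<lambda>i j z. (if i = j then 1 else 0) + (S i j z + S j i z) * (1/2))"
  have s: "holo_germ (s i j)" "s i j 0 = (if i = j then 1 else 0)" for i j
  proof -
    show "holo_germ (s i j)" unfolding s_def by (intro holo_germ_intros S(1))
    show "s i j 0 = (if i = j then 1 else 0)" by (simp add: s_def S(2))
  qed
  define l22 where "l22 = (\<lambda>z. csqrt (s 2 2 z))"
  define l23 where "l23 = (\<lambda>z. s 2 3 z / l22 z)"
  define l24 where "l24 = (\<lambda>z. s 2 4 z / l22 z)"
  define l25 where "l25 = (\<lambda>z. s 2 5 z / l22 z)"
  define l33 where "l33 = (\<lambda>z. csqrt (s 3 3 z - l23 z ^ 2))"
  define l34 where "l34 = (\<lambda>z. (s 3 4 z - l23 z * l24 z) / l33 z)"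
  define l35 where "l35 = (\<lambda>z. (s 3 5 z - l23 z * l25 z) / l33 z)"
  define l44 where "l44 = (\<lambda>z. csqrt (s 4 4 z - l24 z ^ 2 - l34 z ^ 2))"
  define l45 where "l45 = (\<lambda>z. (s 4 5 z - l24 z * l25 z - l34 z * l35 z) / l44 z)"
  define l55 where "l55 = (\<lambda>z. csqrt (s 5 5 z - l25 z ^ 2 - l35 z ^ 2 - l45 z ^ 2))"
  note germ = holo_germ_minus holo_germ_mult holo_germ_divide holo_germ_power holo_germ_csqrt s
  have h22: "holo_germ l22" "l22 0 = 1" unfolding l22_def by (auto intro!: germ simp: s)
  have h23: "holo_germ l23" "l23 0 = 0" unfolding l23_def by (auto intro!: germ simp: s h22)
  have h24: "holo_germ l24" "l24 0 = 0" unfolding l24_def by (auto intro!: germ simp: s h22)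
  have h25: "holo_germ l25" "l25 0 = 0" unfolding l25_def by (auto intro!: germ simp: s h22)
  have h33: "holo_germ l33" "l33 0 = 1" unfolding l33_def by (auto intro!: germ simp: s h23)
  have h34: "holo_germ l34" "l34 0 = 0" unfolding l34_def by (auto intro!: germ simp: s h23 h24 h33)
  have h35: "holo_germ l35" "l35 0 = 0" unfolding l35_def by (auto intro!: germ simp: s h23 h25 h33)
  have h44: "holo_germ l44" "l44 0 = 1" unfolding l44_def by (auto intro!: germ simp: s h24 h34)
  have h45: "holo_germ l45" "l45 0 = 0" unfolding l45_def
    by (auto intro!: germ simp: s h24 h25 h34 h35 h44)
  have h55: "holo_germ l55" "l55 0 = 1" unfolding l55_def by (auto intro!: germ simp: s h25 h35 h45)
  define \<psi> :: "complex^5 \<Rightarrow> complex^5" where "\<psi> = (\<lambda>z. vector [g z * z$1,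
      l22 z * z$2 + l23 z * z$3 + l24 z * z$4 + l25 z * z$5,
      l33 z * z$3 + l34 z * z$4 + l35 z * z$5, l44 z * z$4 + l45 z * z$5, l55 z * z$5])"
  define h :: "complex^5 \<Rightarrow> complex" where
    "h = (\<lambda>z. (z$1)^(n + 1) + (z$2)\<^sup>2 + (z$3)\<^sup>2 + (z$4)\<^sup>2 + (z$5)\<^sup>2)"
  note hs = h22 h23 h24 h25 h33 h34 h35 h44 h45 h55
  show ?thesis
  proof (rule ade_singularity_from_coordinates[OF _ _ _ _ E, where \<psi> = \<psi> and h = h])
    have "\<forall>i. holo_germ (\<lambda>z. \<psi> z $ i)"
      unfolding forall_5 \<psi>_def vector_5 by (auto intro!: holo_germ_intros g hs)
    then show "holo_germ (\<lambda>z. \<psi> z $ i)" for i by blast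
    have "\<forall>i. \<psi> 0 $ i = 0" unfolding forall_5 \<psi>_def vector_5 by simp
    then show "\<psi> 0 = 0" by (simp add: vec_eq_iff)
    note T = holo_germ_times_coord and A = has_derivative_add
    \<comment> \<open>At the origin the triangular factor is the identity matrix and
      \<open>g\<close> is 1, so \<psi> is tangent to the identity. Derivatives of the coefficients
      do not contribute, each being multiplied by a coordinate that vanishes at 0.\<close>
    have "\<forall>i. ((\<lambda>z. \<psi> z $ i) has_derivative (\<lambda>v. v $ i)) (at 0)"
      unfolding forall_5 \<psi>_def vector_5
      using T[OF g(1), of 1] A[OF A[OF A[OF T[OF h22(1), of 2] T[OF h23(1), of 3]] T[OF h24(1), of 4]]
          T[OF h25(1), of 5]] A[OF A[OF T[OF h33(1), of 3] T[OF h34(1), of 4]] T[OF h35(1), of 5]]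
        A[OF T[OF h44(1), of 4] T[OF h45(1), of 5]] T[OF h55(1), of 5]
      by (simp add: hs g)
    then show "(\<psi> has_derivative (\<lambda>v. v)) (at 0)" by (intro has_derivative_vec) blast
    show "h \<in> ade_normal_forms"
    proof -
      have "(\<lambda>x y. x^(n + 1) + y\<^sup>2) \<in> ade_curve_polys"
        using \<open>n \<ge> 1\<close> unfolding ade_curve_polys_def by blast
      then show ?thesis unfolding ade_normal_forms_def h_def
        by (auto intro!: exI[where x = "\<lambda>x y. x^(n + 1) + y\<^sup>2"])
    qed
    show "\<kappa> \<noteq> 0" by fact
    have "\<forall>\<^sub>F z in nhds 0. l22 z \<noteq> 0 \<and> l33 z \<noteq> 0 \<and> l44 z \<noteq> 0"
      by (intro eventually_conj holo_germ_eventually_nonzero) (auto simp: hs)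
    then show "\<forall>\<^sub>F z in nhds 0. f (p + E z) = \<kappa> * h (\<psi> z)"
    proof eventually_elim
      case (elim z)
      have "s 2 2 z = l22 z ^ 2" "s 2 3 z = l22 z * l23 z" "s 2 4 z = l22 z * l24 z"
        "s 2 5 z = l22 z * l25 z" "s 3 3 z = l33 z ^ 2 + l23 z ^ 2"
        "s 3 4 z = l33 z * l34 z + l23 z * l24 z" "s 3 5 z = l33 z * l35 z + l23 z * l25 z"
        "s 4 4 z = l44 z ^ 2 + l34 z ^ 2 + l24 z ^ 2"
        "s 4 5 z = l44 z * l45 z + l34 z * l35 z + l24 z * l25 z"
        "s 5 5 z = l55 z ^ 2 + l45 z ^ 2 + l35 z ^ 2 + l25 z ^ 2"
        using elim by (simp_all add: l22_def l23_def l24_def l25_def l33_def l34_def l35_def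
            l44_def l45_def l55_def)
      note chol = this
      have "(z$2)\<^sup>2 + (z$3)\<^sup>2 + (z$4)\<^sup>2 + (z$5)\<^sup>2 + R z =
          s 2 2 z * (z$2)\<^sup>2 + s 3 3 z * (z$3)\<^sup>2 + s 4 4 z * (z$4)\<^sup>2 + s 5 5 z * (z$5)\<^sup>2
        + 2 * s 2 3 z * z$2 * z$3 + 2 * s 2 4 z * z$2 * z$4 + 2 * s 2 5 z * z$2 * z$5
        + 2 * s 3 4 z * z$3 * z$4 + 2 * s 3 5 z * z$3 * z$5 + 2 * s 4 5 z * z$4 * z$5"
        unfolding S(3) s_def by (simp add: algebra_simps power2_eq_square)
      also have "\<dots> = (\<psi> z $ 2)\<^sup>2 + (\<psi> z $ 3)\<^sup>2 + (\<psi> z $ 4)\<^sup>2 + (\<psi> z $ 5)\<^sup>2"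
        unfolding chol \<psi>_def vector_5 by (simp add: algebra_simps power2_eq_square)
      finally have "(z$1 * g z)^(n + 1) + (z$2)\<^sup>2 + (z$3)\<^sup>2 + (z$4)\<^sup>2 + (z$5)\<^sup>2 + R z = h (\<psi> z)"
        unfolding h_def by (simp add: \<psi>_def vector_5 algebra_simps)
      then show ?case unfolding f by simp
    qed
  qed
qed

section \<open>Singularities of type A\<close>

text \<open>
  The coordinates \<open>x\<close> and \<open>y\<close> are those on the eigenspaces of \<open>g3\<close> for the two nontrivial cube
  roots of unity, so invariance under \<open>g3\<close> leaves only the monomials on the right.
\<close>

lemma cubic_expansion_at_ones:
  fixes w :: complex
  assumes w: "w * w = - 1 - w"
  shows "cubic_abcd \<alpha> \<beta> (- (2*\<alpha> + \<beta>)) (- (2*\<beta> + \<alpha>))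
      (vector [1 + t + x1 + y1, 1 + x2 + y2, 1 + t + w*x1 + (-1-w)*y1, 1 + w*x2 + (-1-w)*y2,
        1 + t + (-1-w)*x1 + w*y1, 1 + (-1-w)*x2 + w*y2]) =
    t * t * (- 3 * (\<alpha> + \<beta>) - (2*\<alpha> + \<beta>) * t)
    + 3 * (4*\<alpha> + \<beta>) * x1 * y1 + 6 * (\<alpha> + \<beta> * (-1-w)) * x2 * y1
    + 6 * (\<alpha> + \<beta> * w) * x1 * y2 + 3 * (4*\<beta> + \<alpha>) * x2 * y2
    + 6 * \<alpha> * t * x1 * y2 + 6 * \<alpha> * t * x2 * y1 + 6 * \<beta> * t * x2 * y2 + 3 * (2*\<alpha> + \<beta>) * t * x1 * y1
    - (2*\<alpha> + \<beta>) * x1 * x1 * x1 + 3 * \<alpha> * x1 * x1 * x2 + 3 * \<beta> * w * x1 * x2 * x2 - (2*\<beta> + \<alpha>) * x2 * x2 * x2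
    - (2*\<alpha> + \<beta>) * y1 * y1 * y1 + 3 * \<alpha> * y1 * y1 * y2 + 3 * \<beta> * (-1-w) * y1 * y2 * y2 - (2*\<beta> + \<alpha>) * y2 *
        y2 * y2"
proof -
  have w': "w * (w * r) = - r - w * r" for r
    using arg_cong[OF w, of "\<lambda>s. s * r"] by (simp add: algebra_simps)
  show ?thesis
    unfolding cubic_abcd_def vector_6 power2_eq_square
    by (simp add: algebra_simps w w')
qed

lemma linear_in_2345_intros:
  shows "i \<in> {2,3,4,5} \<Longrightarrow> linear_in_2345 (\<lambda>z. z $ i)"
    and "linear_in_2345 l \<Longrightarrow> linear_in_2345 (\<lambda>z. k * l z)"
    and "linear_in_2345 l \<Longrightarrow> linear_in_2345 l' \<Longrightarrow> linear_in_2345 (\<lambda>z. l z + l' z)"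
proof -
  show "linear_in_2345 (\<lambda>z. z $ i)" if "i \<in> {2,3,4,5}"
    unfolding linear_in_2345_def
    by (rule exI[where x = "\<lambda>j. if j = i then 1 else 0"]) (use that in auto)
  show "linear_in_2345 (\<lambda>z. k * l z)" if l: "linear_in_2345 l"
  proof -
    obtain c where c: "\<And>z. l z = (\<Sum>i\<in>{2,3,4,5}. c i * z $ i)"
      using l unfolding linear_in_2345_def by blast
    show ?thesis unfolding linear_in_2345_def c
      by (rule exI[where x = "\<lambda>j. k * c j"]) (simp add: algebra_simps)
  qed
  show "linear_in_2345 (\<lambda>z. l z + l' z)" if l: "linear_in_2345 l" "linear_in_2345 l'"
  proof -
    obtain c c' where c: "\<And>z. l z = (\<Sum>i\<in>{2,3,4,5}. c i * z $ i)"
      "\<And>z. l' z = (\<Sum>i\<in>{2,3,4,5}. c' i * z $ i)"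
      using l unfolding linear_in_2345_def by blast
    show ?thesis unfolding linear_in_2345_def c
      by (rule exI[where x = "\<lambda>j. c j + c' j"]) (simp add: algebra_simps)
  qed
qed

lemma exists_cube_root_of_unity: "\<exists>w::complex. w * w = - 1 - w"
proof
  have "csqrt (-3) * csqrt (-3) = -3" using power2_csqrt[of "-3"] by (simp only: power2_eq_square)
  then show "(csqrt (-3) - 1) / 2 * ((csqrt (-3) - 1) / 2) = - 1 - (csqrt (-3) - 1) / 2"
    by (simp add: field_simps)
qed

text \<open>The left side is the cubic restricted to the direction fixed by \<open>g3\<close>. If
  \<alpha> + \<beta> is nonzero, the linear factor is a unit up to a constant and its square root is
  absorbed into the coordinate, giving exponent 2. If \<alpha> + \<beta> = 0, only -\<alpha> z1^3
  remains, giving exponent 3. The normalisation of \<open>g\<close> at 0 moves the constant into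
  \<kappa>, to be shared with the other squares.\<close>

lemma kernel_direction_normal_form:
  fixes \<alpha> \<beta> :: complex
  assumes "\<alpha> \<noteq> 0"
  obtains \<kappa> n g where "\<kappa> \<noteq> 0" "n \<ge> 1" "holo_germ (g :: complex^5 \<Rightarrow> complex)" "g 0 = 1"
    "\<And>z. z$1 * z$1 * (- 3 * (\<alpha> + \<beta>) - (2*\<alpha> + \<beta>) * z$1) = \<kappa> * (z$1 * g z)^(n + 1)"
proof (cases "\<alpha> + \<beta> = 0")
  case True
  show ?thesis
  proof (rule that[where \<kappa> = "-\<alpha>" and n = 2 and g = "\<lambda>z. 1"])
    have \<beta>: "\<beta> = - \<alpha>" using True by (simp add: add_eq_0_iff)
    show "z$1 * z$1 * (- 3 * (\<alpha> + \<beta>) - (2*\<alpha> + \<beta>) * z$1) = - \<alpha> * (z$1 * 1)^(2 + 1)" for z :: "complex^5"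
      unfolding \<beta> by (simp add: power3_eq_cube)
  qed (use assms in \<open>auto intro: holo_germ_const\<close>)
next
  case False
  define g where "g = (\<lambda>z::complex^5. csqrt (1 + (2*\<alpha> + \<beta>) / (3 * (\<alpha> + \<beta>)) * z$1))"
  show ?thesis
  proof (rule that[where \<kappa> = "-3 * (\<alpha> + \<beta>)" and n = 1 and g = g])
    show "holo_germ g" unfolding g_def by (intro holo_germ_csqrt holo_germ_intros) simp
    show "g 0 = 1" by (simp add: g_def)
    fix z :: "complex^5"
    have "g z * g z = 1 + (2*\<alpha> + \<beta>) / (3 * (\<alpha> + \<beta>)) * z$1"
      unfolding g_def by (simp flip: power2_eq_square)
    moreover have "(z$1 * g z)^(1 + 1) = z$1 * z$1 * (g z * g z)"
      by (simp add: power2_eq_square)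
    ultimately have "(z$1 * g z)^(1 + 1) = z$1 * z$1 * (1 + (2*\<alpha> + \<beta>) / (3 * (\<alpha> + \<beta>)) * z$1)"
      by simp
    also have "-3 * (\<alpha> + \<beta>) * \<dots> = z$1 * z$1 * (- 3 * (\<alpha> + \<beta>) - (2*\<alpha> + \<beta>) * z$1)"
    proof -
      have ne: "3 * (\<alpha> + \<beta>) \<noteq> 0" by (intro no_zero_divisors False) simp
      define q where "q = (2*\<alpha> + \<beta>) / (3 * (\<alpha> + \<beta>))"
      have "2*\<alpha> + \<beta> = q * (3 * (\<alpha> + \<beta>))"
        by (simp only: q_def times_divide_eq_left nonzero_mult_div_cancel_right[OF ne])
      then show ?thesis unfolding q_def[symmetric] by (simp add: algebra_simps)
    qed
    finally show "z$1 * z$1 * (- 3 * (\<alpha> + \<beta>) - (2*\<alpha> + \<beta>) * z$1) = -3 * (\<alpha> + \<beta>) * (z$1 * g z)^(1 + 1)"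
      by (rule sym)
  qed (use False in auto)
qed

text \<open>Dividing the coordinates by those of \<open>p\<close> leads to the cubic of
  \<open>cubic_expansion_at_ones\<close>. There every monomial that is not a pure power of t has
  degree at least two in the other four coordinates. The quadratic form in these four pairs (x1, x2)
  with (y1, y2) and is nondegenerate because \<alpha> \<beta> is nonzero, so the type is decided by
  the powers of t alone.\<close>

lemma ade_singularity_all_coordinates_nonzero:
  fixes p :: "complex^6"
  assumes p: "\<And>i. p $ i \<noteq> 0" and "\<alpha> \<noteq> 0" "\<beta> \<noteq> 0"
    and A: "a * (p$1)\<^sup>2 * p$2 = \<alpha>" "a * (p$3)\<^sup>2 * p$4 = \<alpha>" "a * (p$5)\<^sup>2 * p$6 = \<alpha>"
    and B: "b * (p$2)\<^sup>2 * p$3 = \<beta>" "b * (p$4)\<^sup>2 * p$5 = \<beta>" "b * (p$6)\<^sup>2 * p$1 = \<beta>"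
    and CD: "c * (p$1 * p$3 * p$5) = - (2*\<alpha> + \<beta>)" "d * (p$2 * p$4 * p$6) = - (2*\<beta> + \<alpha>)"
  shows "ade_singularity (cubic_abcd a b c d) p"
proof -
  obtain w :: complex where w: "w * w = - 1 - w" using exists_cube_root_of_unity by blast
  have w': "w * (w * r) = - r - w * r" for r
    using arg_cong[OF w, of "\<lambda>s. s * r"] by (simp add: algebra_simps)
  obtain \<kappa> n g where \<kappa>: "\<kappa> \<noteq> 0" "n \<ge> 1" "holo_germ (g :: complex^5 \<Rightarrow> complex)" "g 0 = 1"
    "\<And>z. z$1 * z$1 * (- 3 * (\<alpha> + \<beta>) - (2*\<alpha> + \<beta>) * z$1) = \<kappa> * (z$1 * g z)^(n + 1)"
    using kernel_direction_normal_form[OF \<open>\<alpha> \<noteq> 0\<close>, of \<beta>] by blast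
  define m11 where "m11 = 3 * (4*\<alpha> + \<beta>)"
  define m12 where "m12 = 6 * (\<alpha> + \<beta> * (-1-w))"
  define m21 where "m21 = 6 * (\<alpha> + \<beta> * w)"
  define m22 where "m22 = 3 * (4*\<beta> + \<alpha>)"
  \<comment> \<open>Since w is a primitive cube root of unity, m12 m21 = 36 (\<alpha>^2 - \<alpha>
    \<beta> + \<beta>^2), and the pure squares cancel against those of m11 m22 = 9 (4 \<alpha>^2 +
    17 \<alpha> \<beta> + 4 \<beta>^2).\<close>
  have "m11 * m22 - m12 * m21 = 189 * \<alpha> * \<beta>"
    unfolding m11_def m12_def m21_def m22_def by (simp add: algebra_simps w w')
  then have \<Delta>: "m11 * m22 - m12 * m21 \<noteq> 0" using \<open>\<alpha> \<noteq> 0\<close> \<open>\<beta> \<noteq> 0\<close> by simp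
  \<comment> \<open>X1 U1 = z2^2 + z3^2 and X2 U2 = z4^2 + z5^2. \<open>Y1\<close> and
    \<open>Y2\<close> solve, by Cramer's rule, the linear system that turns the pairing into
    \<kappa> (X1 U1 + X2 U2), so that the squares carry the same factor \<kappa> as the power of
    z1.\<close>
  define U1 where "U1 = (\<lambda>z::complex^5. z$2 + (-\<i>) * z$3)"
  define U2 where "U2 = (\<lambda>z::complex^5. z$4 + (-\<i>) * z$5)"
  define X1 where "X1 = (\<lambda>z::complex^5. z$2 + \<i> * z$3)"
  define X2 where "X2 = (\<lambda>z::complex^5. z$4 + \<i> * z$5)"
  define \<mu> where "\<mu> = \<kappa> / (m11 * m22 - m12 * m21)"
  define Y1 where "Y1 = (\<lambda>z. (\<mu> * m22) * U1 z + (- \<mu> * m21) * U2 z)"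
  define Y2 where "Y2 = (\<lambda>z. (- \<mu> * m12) * U1 z + (\<mu> * m11) * U2 z)"
  have lin: "linear_in_2345 X1" "linear_in_2345 X2" "linear_in_2345 Y1" "linear_in_2345 Y2"
    unfolding X1_def X2_def Y1_def Y2_def U1_def U2_def by (intro linear_in_2345_intros; simp)+
  have "\<mu> * (m11 * m22 - m12 * m21) = \<kappa>" using \<Delta> by (simp add: \<mu>_def)
  moreover have "m11 * Y1 z + m21 * Y2 z = \<mu> * (m11 * m22 - m12 * m21) * U1 z"
    "m12 * Y1 z + m22 * Y2 z = \<mu> * (m11 * m22 - m12 * m21) * U2 z" for z
    unfolding Y1_def Y2_def by (simp_all add: algebra_simps)
  ultimately have solve: "m11 * Y1 z + m21 * Y2 z = \<kappa> * U1 z"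
    "m12 * Y1 z + m22 * Y2 z = \<kappa> * U2 z" for z
    by simp_all
  have "3 * (4*\<alpha> + \<beta>) * X1 z * Y1 z + 6 * (\<alpha> + \<beta> * (-1-w)) * X2 z * Y1 z
    + 6 * (\<alpha> + \<beta> * w) * X1 z * Y2 z + 3 * (4*\<beta> + \<alpha>) * X2 z * Y2 z
    = X1 z * (m11 * Y1 z + m21 * Y2 z) + X2 z * (m12 * Y1 z + m22 * Y2 z)" for z
    unfolding m11_def m12_def m21_def m22_def by (simp add: algebra_simps)
  also have "\<dots> z = \<kappa> * ((z$2)\<^sup>2 + (z$3)\<^sup>2 + (z$4)\<^sup>2 + (z$5)\<^sup>2)" for z
    unfolding solve by (simp add: X1_def X2_def U1_def U2_def algebra_simps power2_eq_square)
  finally have quad: "3 * (4*\<alpha> + \<beta>) * X1 z * Y1 z + 6 * (\<alpha> + \<beta> * (-1-w)) * X2 z * Y1 z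
    + 6 * (\<alpha> + \<beta> * w) * X1 z * Y2 z + 3 * (4*\<beta> + \<alpha>) * X2 z * Y2 z
    = \<kappa> * ((z$2)\<^sup>2 + (z$3)\<^sup>2 + (z$4)\<^sup>2 + (z$5)\<^sup>2)" for z .
  define R where "R = (\<lambda>z. 6 * \<alpha> / \<kappa> * z$1 * X1 z * Y2 z + 6 * \<alpha> / \<kappa> * z$1 * X2 z * Y1 z
    + 6 * \<beta> / \<kappa> * z$1 * X2 z * Y2 z + 3 * (2*\<alpha> + \<beta>) / \<kappa> * z$1 * X1 z * Y1 z
    + - (2*\<alpha> + \<beta>) / \<kappa> * X1 z * X1 z * X1 z + 3 * \<alpha> / \<kappa> * X1 z * X1 z * X2 z
    + 3 * \<beta> * w / \<kappa> * X1 z * X2 z * X2 z + - (2*\<beta> + \<alpha>) / \<kappa> * X2 z * X2 z * X2 z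
    + - (2*\<alpha> + \<beta>) / \<kappa> * Y1 z * Y1 z * Y1 z + 3 * \<alpha> / \<kappa> * Y1 z * Y1 z * Y2 z
    + 3 * \<beta> * (-1-w) / \<kappa> * Y1 z * Y2 z * Y2 z + - (2*\<beta> + \<alpha>) / \<kappa> * Y2 z * Y2 z * Y2 z)"
  have R: "higher_order_quadratic_in_2345 R"
    unfolding R_def
    by (intro higher_order_quadratic_add higher_order_quadratic_mult holo_germ_mult lin
        holo_germ_const holo_germ_coord linear_in_2345_holo_germ(1))
      (simp_all add: linear_in_2345_holo_germ(2) lin)
  have "\<kappa> * R z = 6 * \<alpha> * z$1 * X1 z * Y2 z + 6 * \<alpha> * z$1 * X2 z * Y1 z + 6 * \<beta> * z$1 * X2 z * Y2 z
    + 3 * (2*\<alpha> + \<beta>) * z$1 * X1 z * Y1 z - (2*\<alpha> + \<beta>) * X1 z * X1 z * X1 z + 3 * \<alpha> * X1 z * X1 z * X2 z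
    + 3 * \<beta> * w * X1 z * X2 z * X2 z - (2*\<beta> + \<alpha>) * X2 z * X2 z * X2 z
    - (2*\<alpha> + \<beta>) * Y1 z * Y1 z * Y1 z + 3 * \<alpha> * Y1 z * Y1 z * Y2 z
    + 3 * \<beta> * (-1-w) * Y1 z * Y2 z * Y2 z - (2*\<beta> + \<alpha>) * Y2 z * Y2 z * Y2 z" for z
    using \<kappa>(1) unfolding R_def by (simp add: field_simps)
  note Req = this
  \<comment> \<open>Displacements from (1,1,1,1,1,1): z1 moves the odd coordinates only, and the
    even entries have sum zero. The direction of \<open>p\<close> itself is left out in this way, so
    the image of \<open>E\<close> is transverse to the line through \<open>p\<close>.\<close>
  define e :: "complex^5 \<Rightarrow> complex^6" where "e = (\<lambda>z. vector
    [z$1 + X1 z + Y1 z, X2 z + Y2 z, z$1 + w * X1 z + (-1-w) * Y1 z, w * X2 z + (-1-w) * Y2 z,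
     z$1 + (-1-w) * X1 z + w * Y1 z, (-1-w) * X2 z + w * Y2 z])"
  define E where "E = (\<lambda>z. \<chi> i. p $ i * e z $ i)"
  show ?thesis
  proof (rule ade_singularity_A_from_splitting[OF _ _ \<kappa>(2,1,3,4) R])
    have add: "X1 (v + z) = X1 v + X1 z" "X2 (v + z) = X2 v + X2 z" "Y1 (v + z) = Y1 v + Y1 z"
      "Y2 (v + z) = Y2 v + Y2 z" for v z
      by (simp_all add: X1_def X2_def Y1_def Y2_def U1_def U2_def algebra_simps)
    have scale: "X1 (k *s z) = k * X1 z" "X2 (k *s z) = k * X2 z" "Y1 (k *s z) = k * Y1 z"
      "Y2 (k *s z) = k * Y2 z" for k z
      by (simp_all add: X1_def X2_def Y1_def Y2_def U1_def U2_def algebra_simps)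
    show "complex_linear E" unfolding complex_linear_def E_def e_def
      by (simp add: vec_eq_iff forall_6 vector_6 add scale algebra_simps)
    show "\<exists>v c. x = E v + c *s p" for x
    proof -
      define y where "y = (\<lambda>i. x $ i / p $ i)"
      \<comment> \<open>The even entries of \<open>e\<close> sum to zero, so the multiple of
        \<open>p\<close> is the mean of the even quotients. The remaining unknowns come from Fourier
        inversion over the cube roots of unity.\<close>
      define k where "k = (y 2 + y 4 + y 6) / 3"
      define t where "t = (y 1 + y 3 + y 5) / 3 - k"
      define x1 where "x1 = (y 1 + (-1-w) * y 3 + w * y 5) / 3"
      define y1 where "y1 = (y 1 + w * y 3 + (-1-w) * y 5) / 3"
      define x2 where "x2 = (y 2 + (-1-w) * y 4 + w * y 6) / 3"
      define y2 where "y2 = (y 2 + w * y 4 + (-1-w) * y 6) / 3"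
      define u1 where "u1 = (m11 * y1 + m21 * y2) / \<kappa>"
      define u2 where "u2 = (m12 * y1 + m22 * y2) / \<kappa>"
      define v :: "complex^5" where
        "v = vector [t, (x1 + u1) / 2, (x1 - u1) / (2 * \<i>), (x2 + u2) / 2, (x2 - u2) / (2 * \<i>)]"
      have X: "v $ 1 = t" "X1 v = x1" "X2 v = x2" "U1 v = u1" "U2 v = u2"
        by (auto simp: X1_def X2_def U1_def U2_def v_def vector_5 field_simps)
      have "Y1 v = \<mu> * (m22 * u1 - m21 * u2)" unfolding Y1_def X by (simp add: algebra_simps)
      also have "\<dots> = \<mu> / \<kappa> * ((m11 * m22 - m12 * m21) * y1)"
        unfolding u1_def u2_def using \<kappa>(1) by (simp add: field_simps)
      also have "\<dots> = y1" using \<kappa>(1) \<Delta> by (simp add: \<mu>_def)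
      finally have Y1: "Y1 v = y1" .
      have "Y2 v = \<mu> * (m11 * u2 - m12 * u1)" unfolding Y2_def X by (simp add: algebra_simps)
      also have "\<dots> = \<mu> / \<kappa> * ((m11 * m22 - m12 * m21) * y2)"
        unfolding u1_def u2_def using \<kappa>(1) by (simp add: field_simps)
      also have "\<dots> = y2" using \<kappa>(1) \<Delta> by (simp add: \<mu>_def)
      finally have Y2: "Y2 v = y2" .
      have "\<forall>i. e v $ i = y i - k"
        unfolding forall_6 e_def vector_6 X Y1 Y2 x1_def x2_def y1_def y2_def t_def k_def
        by (simp add: field_simps w w')
      then have "x = E v + k *s p"
        using p by (auto simp: vec_eq_iff E_def y_def field_simps)
      then show ?thesis by blast
    qed
    show "cubic_abcd a b c d (p + E z) =
      \<kappa> * ((z$1 * g z)^(n + 1) + (z$2)\<^sup>2 + (z$3)\<^sup>2 + (z$4)\<^sup>2 + (z$5)\<^sup>2 + R z)" for z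
    proof -
      define y where "y = (\<lambda>i. 1 + e z $ i)"
      have comp: "(p + E z) $ i = p $ i * y i" for i by (simp add: E_def y_def algebra_simps)
      have "cubic_abcd a b c d (p + E z) =
         cubic_abcd \<alpha> \<beta> (- (2*\<alpha> + \<beta>)) (- (2*\<beta> + \<alpha>)) (\<chi> i. y i)"
      proof -
        have "cubic_abcd a b c d (p + E z) =
           (a * (p$1)\<^sup>2 * p$2) * ((y 1)\<^sup>2 * y 2)
         + (a * (p$3)\<^sup>2 * p$4) * ((y 3)\<^sup>2 * y 4)
         + (a * (p$5)\<^sup>2 * p$6) * ((y 5)\<^sup>2 * y 6)
         + (b * (p$2)\<^sup>2 * p$3) * ((y 2)\<^sup>2 * y 3)
         + (b * (p$4)\<^sup>2 * p$5) * ((y 4)\<^sup>2 * y 5)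
         + (b * (p$6)\<^sup>2 * p$1) * ((y 6)\<^sup>2 * y 1)
         + (c * (p$1 * p$3 * p$5)) * (y 1 * y 3 * y 5)
         + (d * (p$2 * p$4 * p$6)) * (y 2 * y 4 * y 6)"
          unfolding cubic_abcd_def comp power_mult_distrib by (simp add: distrib_left mult_ac add_ac)
        also have "\<dots> = cubic_abcd \<alpha> \<beta> (- (2*\<alpha> + \<beta>)) (- (2*\<beta> + \<alpha>)) (\<chi> i. y i)"
          unfolding A B CD cubic_abcd_def vec_lambda_beta by (simp add: distrib_left mult_ac add_ac)
        finally show ?thesis .
      qed
      also have "(\<chi> i. y i) = vector [1 + z$1 + X1 z + Y1 z, 1 + X2 z + Y2 z,
          1 + z$1 + w * X1 z + (-1-w) * Y1 z, 1 + w * X2 z + (-1-w) * Y2 z,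
          1 + z$1 + (-1-w) * X1 z + w * Y1 z, 1 + (-1-w) * X2 z + w * Y2 z]"
        unfolding vec_eq_iff forall_6 vec_lambda_beta y_def e_def vector_6 by (simp add: add.assoc)
      also note cubic_expansion_at_ones[OF w, of \<alpha> \<beta> "z$1" "X1 z" "Y1 z" "X2 z" "Y2 z"]
      also have "z$1 * z$1 * (- 3 * (\<alpha> + \<beta>) - (2*\<alpha> + \<beta>) * z$1)
    + 3 * (4*\<alpha> + \<beta>) * X1 z * Y1 z + 6 * (\<alpha> + \<beta> * (-1-w)) * X2 z * Y1 z
    + 6 * (\<alpha> + \<beta> * w) * X1 z * Y2 z + 3 * (4*\<beta> + \<alpha>) * X2 z * Y2 z
    + 6 * \<alpha> * z$1 * X1 z * Y2 z + 6 * \<alpha> * z$1 * X2 z * Y1 z + 6 * \<beta> * z$1 * X2 z * Y2 z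
    + 3 * (2*\<alpha> + \<beta>) * z$1 * X1 z * Y1 z - (2*\<alpha> + \<beta>) * X1 z * X1 z * X1 z + 3 * \<alpha> * X1 z * X1 z * X2 z
    + 3 * \<beta> * w * X1 z * X2 z * X2 z - (2*\<beta> + \<alpha>) * X2 z * X2 z * X2 z
    - (2*\<alpha> + \<beta>) * Y1 z * Y1 z * Y1 z + 3 * \<alpha> * Y1 z * Y1 z * Y2 z
    + 3 * \<beta> * (-1-w) * Y1 z * Y2 z * Y2 z - (2*\<beta> + \<alpha>) * Y2 z * Y2 z * Y2 z
    = z$1 * z$1 * (- 3 * (\<alpha> + \<beta>) - (2*\<alpha> + \<beta>) * z$1)
      + (3 * (4*\<alpha> + \<beta>) * X1 z * Y1 z + 6 * (\<alpha> + \<beta> * (-1-w)) * X2 z * Y1 z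
    + 6 * (\<alpha> + \<beta> * w) * X1 z * Y2 z + 3 * (4*\<beta> + \<alpha>) * X2 z * Y2 z) + \<kappa> * R z"
        unfolding Req by simp
      finally show ?thesis unfolding \<kappa>(5) quad by (simp add: distrib_left add_ac)
    qed
  qed
qed

section \<open>ADE singularities are isolated\<close>

lemma has_derivative_coord: "((\<lambda>x::complex^'n. x $ i) has_derivative (\<lambda>v. v $ i)) F"
  by (rule bounded_linear_imp_has_derivative[OF bounded_linear_vec_nth])

lemma ade_curve_polys_partials:
  assumes "q \<in> ade_curve_polys"
  obtains qx qy where
    "\<And>z::complex^5. ((\<lambda>z. q (z$1) (z$2)) has_derivative
        (\<lambda>v. qx (z$1) (z$2) * v$1 + qy (z$1) (z$2) * v$2)) (at z)"
    "\<And>x y. qx x y = 0 \<Longrightarrow> qy x y = 0 \<Longrightarrow> x = 0 \<and> y = 0"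
proof -
  consider n where "n \<ge> 1" "q = (\<lambda>x y. x^(n + 1) + y\<^sup>2)"
    | n where "n \<ge> 4" "q = (\<lambda>x y. x\<^sup>2 * y + y^(n - 1))"
    | "q = (\<lambda>x y. x^3 + y^4)" | "q = (\<lambda>x y. x^3 + x * y^3)" | "q = (\<lambda>x y. x^3 + y^5)"
    using assms unfolding ade_curve_polys_def by blast
  then show ?thesis
  proof cases
    case 1
    show ?thesis
    proof (rule that[where qx = "\<lambda>x y. of_nat (n + 1) * x^n" and qy = "\<lambda>x y. 2 * y"])
      show "of_nat (n + 1) * x^n = 0 \<Longrightarrow> 2 * y = 0 \<Longrightarrow> x = 0 \<and> y = 0" for x y :: complex
        using of_nat_neq_0[of n, where 'a = complex] by auto
    qed (auto simp: 1 intro!: derivative_eq_intros has_derivative_coord simp del: of_nat_Suc power_Suc)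
  next
    case 2
    \<comment> \<open>The exponent has to be positive: if x is nonzero, then y = 0, and y^k has to
      vanish for the second partial derivative to force x = 0.\<close>
    then obtain k where k: "n - 1 = k + 1" "k \<ge> 2" by (intro that[of "n - 2"]) auto
    have q: "q = (\<lambda>x y. x\<^sup>2 * y + y^(k + 1))" using 2(2) k(1) by simp
    show ?thesis
    proof (rule that[where qx = "\<lambda>x y. 2 * x * y" and qy = "\<lambda>x y. x^2 + of_nat (k + 1) * y^k"])
      show "2 * x * y = 0 \<Longrightarrow> x^2 + of_nat (k + 1) * y^k = 0 \<Longrightarrow> x = 0 \<and> y = 0"
        for x y :: complex
        using k(2) of_nat_neq_0[of k, where 'a = complex] by (cases "x = 0") (auto simp: power_0_left)
    qed (auto simp: q algebra_simps intro!: derivative_eq_intros has_derivative_coord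
        simp del: of_nat_Suc power_Suc)
  next
    case 3
    show ?thesis
      by (rule that[where qx = "\<lambda>x y. 3 * x^2" and qy = "\<lambda>x y. 4 * y^3"])
        (auto simp: 3 intro!: derivative_eq_intros has_derivative_coord)
  next
    case 4
    show ?thesis
      by (rule that[where qx = "\<lambda>x y. 3 * x^2 + y^3" and qy = "\<lambda>x y. 3 * x * y^2"])
        (auto simp: 4 algebra_simps intro!: derivative_eq_intros has_derivative_coord)
  next
    case 5
    show ?thesis
      by (rule that[where qx = "\<lambda>x y. 3 * x^2" and qy = "\<lambda>x y. 5 * y^4"])
        (auto simp: 5 intro!: derivative_eq_intros has_derivative_coord)
  qed
qed

lemma ade_normal_forms_isolated:
  assumes "h \<in> ade_normal_forms"
  obtains Dh where "\<And>z. (h has_derivative Dh z) (at z)" "\<And>z. (\<And>v. Dh z v = 0) \<Longrightarrow> z = 0"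
proof -
  obtain q where q: "q \<in> ade_curve_polys"
    and h: "h = (\<lambda>z. q (z$1) (z$2) + (z$3)\<^sup>2 + (z$4)\<^sup>2 + (z$5)\<^sup>2)"
    using assms unfolding ade_normal_forms_def by blast
  obtain qx qy where dq: "\<And>z::complex^5. ((\<lambda>z. q (z$1) (z$2)) has_derivative
        (\<lambda>v. qx (z$1) (z$2) * v$1 + qy (z$1) (z$2) * v$2)) (at z)"
    and iso: "\<And>x y. qx x y = 0 \<Longrightarrow> qy x y = 0 \<Longrightarrow> x = 0 \<and> y = 0"
    using ade_curve_polys_partials[OF q] by blast
  show ?thesis
  proof (rule that)
    fix z :: "complex^5"
    show "(h has_derivative (\<lambda>v. qx (z$1) (z$2) * v$1 + qy (z$1) (z$2) * v$2
        + 2 * z$3 * v$3 + 2 * z$4 * v$4 + 2 * z$5 * v$5)) (at z)"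
      unfolding h by (auto intro!: derivative_eq_intros has_derivative_coord dq)
    assume 0: "\<And>v::complex^5. qx (z$1) (z$2) * v$1 + qy (z$1) (z$2) * v$2
        + 2 * z$3 * v$3 + 2 * z$4 * v$4 + 2 * z$5 * v$5 = 0"
    from 0[of "axis 1 1"] 0[of "axis 2 1"] have "z$1 = 0" "z$2 = 0"
      using iso[of "z$1" "z$2"] by (auto simp: axis_def)
    moreover from 0[of "axis 3 1"] 0[of "axis 4 1"] 0[of "axis 5 1"]
    have "z$3 = 0" "z$4 = 0" "z$5 = 0" by (auto simp: axis_def)
    ultimately show "z = 0" by (simp add: vec_eq_iff forall_5)
  qed
qed

text \<open>Near \<open>p\<close> every point of the cone is a scalar multiple of a chart value
  \<phi>(z). If it is singular, homogeneity makes f singular at \<phi>(z), so unit times normal form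
  has a critical zero at z, which can only be the origin. The conclusion is up to scalars since f
  lives on the affine cone.\<close>

lemma ade_singularity_isolated:
  assumes hom: "\<And>k x. f (k *s x) = k^3 * f x" and ade: "ade_singularity f p"
  obtains \<epsilon> where "\<epsilon> > 0"
    "\<And>q. dist q p < \<epsilon> \<Longrightarrow> f q = 0 \<Longrightarrow> (f has_derivative (\<lambda>v. 0)) (at q) \<Longrightarrow> \<exists>c. q = c *s p"
proof -
  obtain U \<phi> u h D where U: "open U" "0 \<in> U" and \<phi>: "holo_map U \<phi>" "\<phi> 0 = p"
    and D: "(\<phi> has_derivative D) (at 0)" "\<And>w. \<exists>v c. w = D v + c *s p"
    and u: "holo_fun U u" "\<And>z. z \<in> U \<Longrightarrow> u z \<noteq> 0" and h: "h \<in> ade_normal_forms"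
    and eq: "\<And>z. z \<in> U \<Longrightarrow> f (\<phi> z) = u z * h z"
    using ade unfolding ade_singularity_def by blast
  obtain Dh where Dh: "\<And>z. (h has_derivative Dh z) (at z)" "\<And>z. (\<And>v. Dh z v = 0) \<Longrightarrow> z = 0"
    using ade_normal_forms_isolated[OF h] by blast
  \<comment> \<open>The scaling direction is added to the chart, so that the derivative at 0 is
    onto. Excluding -1 in \<open>T\<close> keeps the scaling factor invertible.\<close>
  define \<Phi> where "\<Phi> = (\<lambda>y::(complex^5) \<times> complex. (1 + snd y) *s \<phi> (fst y))"
  define T where "T = U \<times> (- {-1 :: complex})"
  have T: "open T" "0 \<in> T" using U by (auto simp: T_def zero_prod_def intro!: open_Times)
  have \<Phi>_der: "\<exists>F. (\<Phi> has_derivative F) (at y)" if "y \<in> T" for y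
  proof -
    obtain F where F: "(\<phi> has_derivative F) (at (fst y))"
      using \<phi>(1) \<open>y \<in> T\<close> unfolding holo_map_def T_def by (metis mem_Times_iff)
    have "((\<lambda>y. \<phi> (fst y)) has_derivative (\<lambda>v. F (fst v))) (at y)"
      using has_derivative_compose[OF has_derivative_fst[OF has_derivative_ident] F] .
    then have "((\<lambda>y. \<phi> (fst y) $ i) has_derivative (\<lambda>v. F (fst v) $ i)) (at y)" for i
      by (rule bounded_linear.has_derivative[OF bounded_linear_vec_nth])
    then have "((\<lambda>y. \<Phi> y $ i) has_derivative (\<lambda>v. ((1 + snd y) *s F (fst v) + snd v *s \<phi> (fst y)) $ i))
        (at y)" for i
      unfolding \<Phi>_def vector_smult_component
      by (auto intro!: derivative_eq_intros has_derivative_coord simp: algebra_simps)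
    note der = has_derivative_vec[OF this]
    show ?thesis by (rule exI, rule der)
  qed
  have \<Phi>0: "(\<Phi> has_derivative (\<lambda>v. D (fst v) + snd v *s p)) (at 0)"
  proof (rule has_derivative_vec)
    fix i
    have "((\<lambda>y::(complex^5) \<times> complex. \<phi> (fst y)) has_derivative (\<lambda>v. D (fst v))) (at 0)"
      by (rule has_derivative_compose[OF has_derivative_fst[OF has_derivative_ident]]) (simp add: D)
    then have *: "((\<lambda>y::(complex^5) \<times> complex. \<phi> (fst y) $ i) has_derivative (\<lambda>v. D (fst v) $ i)) (at 0)"
      by (rule bounded_linear.has_derivative[OF bounded_linear_vec_nth])
    show "((\<lambda>y. \<Phi> y $ i) has_derivative (\<lambda>v. (D (fst v) + snd v *s p) $ i)) (at 0)"
      unfolding \<Phi>_def vector_smult_component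
      by (rule derivative_eq_intros * | simp add: \<phi>)+
  qed
  have lin: "linear (\<lambda>v. D (fst v) + snd v *s p)"
    using \<Phi>0 has_derivative_bounded_linear bounded_linear.linear by blast
  have "surj (\<lambda>v. D (fst v) + snd v *s p)"
  proof -
    have "\<exists>v. w = D (fst v) + snd v *s p" for w
      using D(2)[of w] by (metis fst_conv snd_conv)
    then show ?thesis by (simp add: surj_def)
  qed
  then obtain G where G: "linear G" "(\<lambda>v. D (fst v) + snd v *s p) \<circ> G = id"
    using linear_surjective_right_inverse[OF lin] by blast
  have cont: "continuous_on T \<Phi>"
    using \<Phi>_der by (intro continuous_at_imp_continuous_on) (metis has_derivative_continuous)
  have "\<Phi> 0 \<in> interior (\<Phi> ` T)"
    by (rule sussmann_open_mapping[OF T(1) _ T(2) \<Phi>0 _ G(2) subset_refl])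
      (use G T cont in \<open>auto simp: interior_open linear_conv_bounded_linear\<close>)
  then obtain \<epsilon> where \<epsilon>: "\<epsilon> > 0" "ball p \<epsilon> \<subseteq> \<Phi> ` T"
    unfolding mem_interior by (auto simp: \<Phi>_def \<phi>)
  show ?thesis
  proof (rule that[OF \<epsilon>(1)])
    fix q assume q: "dist q p < \<epsilon>" "f q = 0" "(f has_derivative (\<lambda>v. 0)) (at q)"
    then have "q \<in> ball p \<epsilon>" by (simp add: dist_commute)
    then obtain y where "y \<in> T" "q = \<Phi> y" using \<epsilon>(2) by blast
    then obtain z c where zc: "z \<in> U" "c \<noteq> -1" "q = (1 + c) *s \<phi> z"
      by (intro that[of "fst y" "snd y"]) (auto simp: \<Phi>_def T_def)
    define k where "k = 1 + c"
    have k: "k \<noteq> 0" "q = k *s \<phi> z" using zc unfolding k_def by (auto simp: add_eq_0_iff)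
    have "h z = 0" using q(2) u(2)[OF zc(1)] k eq[OF zc(1)] by (simp add: hom)
    obtain F where F: "(\<phi> has_derivative F) (at z)" using \<phi>(1) zc(1) unfolding holo_map_def by blast
    have "((\<lambda>y. k *s \<phi> y) has_derivative (\<lambda>v. k *s F v)) (at z)"
      by (rule bounded_linear.has_derivative[OF _ F], rule complex_linear_imp_bounded_linear)
        (auto simp: complex_linear_def vec_eq_iff algebra_simps)
    then have "((\<lambda>y. f (k *s \<phi> y)) has_derivative (\<lambda>v. 0)) (at z)"
      by (rule has_derivative_compose) (use q(3) k in simp)
    from has_derivative_mult_right[OF this, of "inverse (k^3)"]
    have "((\<lambda>y. f (\<phi> y)) has_derivative (\<lambda>v. 0)) (at z)" using k(1) by (simp add: hom flip: mult.assoc)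
    then have 1: "((\<lambda>y. u y * h y) has_derivative (\<lambda>v. 0)) (at z)"
      by (rule has_derivative_transform_within_open[OF _ U(1) zc(1)]) (simp add: eq)
    obtain Du where "((\<lambda>z. (\<chi> i::1. u z)) has_derivative Du) (at z)"
      using u(1) zc(1) unfolding holo_fun_def holo_map_def by blast
    from bounded_linear.has_derivative[OF bounded_linear_vec_nth this, of 1]
    have "(u has_derivative (\<lambda>v. Du v $ 1)) (at z)" by simp
    \<comment> \<open>At a zero of h the product rule leaves u times the derivative of h, and u is a
      unit.\<close>
    from has_derivative_unique[OF has_derivative_mult[OF this Dh(1)] 1] u(2)[OF zc(1)]
    have "Dh z v = 0" for v using \<open>h z = 0\<close> by (simp add: fun_eq_iff)
    then have "z = 0" by (rule Dh(2))
    then show "\<exists>c. q = c *s p" using k(2) \<phi>(2) by blast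
  qed
qed

section \<open>Singular points of the invariant cubics\<close>

definition cubic_gradient :: "complex \<Rightarrow> complex \<Rightarrow> complex \<Rightarrow> complex \<Rightarrow> complex^6 \<Rightarrow> complex^6" where
  "cubic_gradient a b c d x = vector
    [2 * a * x$1 * x$2 + b * (x$6)\<^sup>2 + c * x$3 * x$5, 2 * b * x$2 * x$3 + a * (x$1)\<^sup>2 + d * x$4 * x$6,
     2 * a * x$3 * x$4 + b * (x$2)\<^sup>2 + c * x$1 * x$5, 2 * b * x$4 * x$5 + a * (x$3)\<^sup>2 + d * x$2 * x$6,
     2 * a * x$5 * x$6 + b * (x$4)\<^sup>2 + c * x$1 * x$3, 2 * b * x$6 * x$1 + a * (x$5)\<^sup>2 + d * x$2 * x$4]"

lemma cubic_abcd_has_derivative: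
  "(cubic_abcd a b c d has_derivative (\<lambda>v. \<Sum>i\<in>UNIV. cubic_gradient a b c d x $ i * v $ i)) (at x)"
  unfolding cubic_abcd_def cubic_gradient_def sum_6 vector_6
  by (auto intro!: derivative_eq_intros has_derivative_coord simp: fun_eq_iff)
    (simp add: algebra_simps power2_eq_square)

lemma cubic_abcd_scale: "cubic_abcd a b c d (k *s x) = k^3 * cubic_abcd a b c d x"
  by (simp add: cubic_abcd_def algebra_simps power2_eq_square power3_eq_cube)

lemma cubic_abcd_mult: "k * cubic_abcd a b c d x = cubic_abcd (k * a) (k * b) (k * c) (k * d) x"
  by (simp add: cubic_abcd_def algebra_simps)

lemma euler_cubic_abcd: "3 * cubic_abcd a b c d x = (\<Sum>i\<in>UNIV. cubic_gradient a b c d x $ i * x $ i)"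
  unfolding cubic_abcd_def cubic_gradient_def sum_6 vector_6
  by (simp add: algebra_simps power2_eq_square)

lemma singular_points_pt:
  "p \<in> singular_points (pt a b c d) \<longleftrightarrow> p \<noteq> 0 \<and> cubic_gradient a b c d p = 0"
proof
  assume p: "p \<in> singular_points (pt a b c d)"
  have "cubic_abcd a b c d \<in> pt a b c d" unfolding pt_def line_def
    by (auto intro!: exI[where x = 1])
  with p have "p \<noteq> 0" "(cubic_abcd a b c d has_derivative (\<lambda>v. 0)) (at p)"
    unfolding singular_points_def by auto
  from has_derivative_unique[OF this(2) cubic_abcd_has_derivative]
  have "(\<Sum>i\<in>UNIV. cubic_gradient a b c d p $ i * v $ i) = 0" for v by metis
  from this[of "axis _ 1"] have "cubic_gradient a b c d p $ j = 0" for j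
    by (simp add: axis_def if_distrib cong: if_cong)
  then show "p \<noteq> 0 \<and> cubic_gradient a b c d p = 0" using \<open>p \<noteq> 0\<close> by (simp add: vec_eq_iff)
next
  assume p: "p \<noteq> 0 \<and> cubic_gradient a b c d p = 0"
  have 1: "(cubic_abcd a b c d has_derivative (\<lambda>v. 0)) (at p)"
    using cubic_abcd_has_derivative[of a b c d p] p by simp
  have 2: "cubic_abcd a b c d p = 0" using euler_cubic_abcd[of a b c d p] p by simp
  have "((\<lambda>x. k * cubic_abcd a b c d x) has_derivative (\<lambda>v. 0)) (at p)" for k
    using has_derivative_mult_right[OF 1, of k] by simp
  then show "p \<in> singular_points (pt a b c d)"
    using p 2 by (auto simp: singular_points_def pt_def line_def)
qed

text \<open>The gradient at the i-th coordinate point reads off the coefficients of x_i^2 x_j. Only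
  one such monomial occurs, with coefficient a for odd i and b for even i.\<close>

lemma singular_if_ab_zero:
  assumes "a * b = 0" shows "singular_points (pt a b c d) \<noteq> {}"
proof (cases "a = 0")
  case True
  then have "axis 1 1 \<in> singular_points (pt a b c d)"
    unfolding singular_points_pt
    by (simp add: cubic_gradient_def vec_eq_iff forall_6 vector_6 axis_def)
  then show ?thesis by blast
next
  case False
  then have "axis 2 1 \<in> singular_points (pt a b c d)" using assms
    unfolding singular_points_pt
    by (simp add: cubic_gradient_def vec_eq_iff forall_6 vector_6 axis_def)
  then show ?thesis by blast
qed

text \<open>Multiplying the partial derivatives by the coordinates gives linear equations in the six monomials.\<close>

lemma singular_point_coordinates:
  assumes "a \<noteq> 0" "b \<noteq> 0" and sing: "p \<in> singular_points (pt a b c d)"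
  obtains \<alpha> \<beta> where "\<And>i. p $ i \<noteq> 0" "\<alpha> \<noteq> 0" "\<beta> \<noteq> 0"
    "a * (p$1)\<^sup>2 * p$2 = \<alpha>" "a * (p$3)\<^sup>2 * p$4 = \<alpha>" "a * (p$5)\<^sup>2 * p$6 = \<alpha>"
    "b * (p$2)\<^sup>2 * p$3 = \<beta>" "b * (p$4)\<^sup>2 * p$5 = \<beta>" "b * (p$6)\<^sup>2 * p$1 = \<beta>"
    "c * (p$1 * p$3 * p$5) = - (2*\<alpha> + \<beta>)" "d * (p$2 * p$4 * p$6) = - (2*\<beta> + \<alpha>)"
proof -
  have p0: "p \<noteq> 0" and "cubic_gradient a b c d p = 0"
    using sing unfolding singular_points_pt by auto
  then have g: "\<forall>i. cubic_gradient a b c d p $ i = 0" by simp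
  have G: "2 * a * p$1 * p$2 + b * (p$6)\<^sup>2 + c * p$3 * p$5 = 0"
    "2 * b * p$2 * p$3 + a * (p$1)\<^sup>2 + d * p$4 * p$6 = 0"
    "2 * a * p$3 * p$4 + b * (p$2)\<^sup>2 + c * p$1 * p$5 = 0"
    "2 * b * p$4 * p$5 + a * (p$3)\<^sup>2 + d * p$2 * p$6 = 0"
    "2 * a * p$5 * p$6 + b * (p$4)\<^sup>2 + c * p$1 * p$3 = 0"
    "2 * b * p$6 * p$1 + a * (p$5)\<^sup>2 + d * p$2 * p$4 = 0"
    using g unfolding forall_6 cubic_gradient_def vector_6 by blast+
  define A where "A = (\<lambda>i. p $ i * p $ i * p $ (i + 1))"
  define C where "C = c * (p$1 * p$3 * p$5)"
  define D where "D = d * (p$2 * p$4 * p$6)"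
  have E: "2 * (a * A 1) + b * A 6 + C = 0" "2 * (b * A 2) + a * A 1 + D = 0"
    "2 * (a * A 3) + b * A 2 + C = 0" "2 * (b * A 4) + a * A 3 + D = 0"
    "2 * (a * A 5) + b * A 4 + C = 0" "2 * (b * A 6) + a * A 5 + D = 0"
    using arg_cong[OF G(1), of "\<lambda>s. s * p$1"] arg_cong[OF G(2), of "\<lambda>s. s * p$2"]
      arg_cong[OF G(3), of "\<lambda>s. s * p$3"] arg_cong[OF G(4), of "\<lambda>s. s * p$4"]
      arg_cong[OF G(5), of "\<lambda>s. s * p$5"] arg_cong[OF G(6), of "\<lambda>s. s * p$6"]
    by (simp_all add: A_def C_def D_def numerals_mod_6(1) algebra_simps power2_eq_square)
  \<comment> \<open>Let d1, d2, d3 be the cyclic differences of a A 1, a A 3, a A 5. Eliminating the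
    terms with b gives 4 d1 = d3, 4 d2 = d1 and 4 d3 = d2, whence 64 d1 = d1; so 63 = 4^3 - 1. The
    terms with b are treated alike.\<close>
  have "63 * (a * A 1 - a * A 3) = 0" "63 * (a * A 3 - a * A 5) = 0"
    "63 * (b * A 2 - b * A 4) = 0" "63 * (b * A 4 - b * A 6) = 0"
    using E by algebra+
  then have AA: "A 3 = A 1" "A 5 = A 1" "A 4 = A 2" "A 6 = A 2" using assms by simp_all
  have nz: "A 1 \<noteq> 0 \<and> A 2 \<noteq> 0"
  proof (rule ccontr)
    assume "\<not> (A 1 \<noteq> 0 \<and> A 2 \<noteq> 0)"
    then have "p$1 = 0 \<or> p$2 = 0 \<or> p$3 = 0" by (auto simp: A_def)
    then have A0: "A 1 = 0" "A 2 = 0" using AA by (auto simp: A_def)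
    \<comment> \<open>Neighbouring coordinates have product zero. In the partial derivative by
      x_(i+1) the square of x_i has coefficient a or b, and each of the other two terms contains a
      neighbour of x_i. If x_i were nonzero, both would vanish and leave x_i^2 = 0.\<close>
    have "p$1 = 0 \<or> p$2 = 0" "p$2 = 0 \<or> p$3 = 0" "p$3 = 0 \<or> p$4 = 0" "p$4 = 0 \<or> p$5 = 0"
      "p$5 = 0 \<or> p$6 = 0" "p$6 = 0 \<or> p$1 = 0"
      using A0 AA by (auto simp: A_def numerals_mod_6(1))
    note prods = this
    have "p$1 = 0" using prods G(2) assms by auto
    moreover have "p$2 = 0" using prods G(3) assms by auto
    moreover have "p$3 = 0" using prods G(4) assms by auto
    moreover have "p$4 = 0" using prods G(5) assms by auto
    moreover have "p$5 = 0" using prods G(6) assms by auto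
    moreover have "p$6 = 0" using prods G(1) assms by auto
    ultimately show False using p0 by (simp add: vec_eq_iff forall_6)
  qed
  show ?thesis
  proof (rule that[of "a * A 1" "b * A 2"])
    have "\<forall>i. p $ i \<noteq> 0" using nz AA unfolding forall_6 by (auto simp: A_def)
    then show "p $ i \<noteq> 0" for i by blast
    show "a * A 1 \<noteq> 0" "b * A 2 \<noteq> 0" using nz assms by auto
    show "a * (p$1)\<^sup>2 * p$2 = a * A 1" "b * (p$2)\<^sup>2 * p$3 = b * A 2"
      by (simp_all add: A_def power2_eq_square)
    have "A 3 = (p$3)\<^sup>2 * p$4" "A 5 = (p$5)\<^sup>2 * p$6" "A 4 = (p$4)\<^sup>2 * p$5" "A 6 = (p$6)\<^sup>2 * p$1"
      by (simp_all add: A_def power2_eq_square numerals_mod_6(1))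
    then show "a * (p$3)\<^sup>2 * p$4 = a * A 1" "a * (p$5)\<^sup>2 * p$6 = a * A 1"
      "b * (p$4)\<^sup>2 * p$5 = b * A 2" "b * (p$6)\<^sup>2 * p$1 = b * A 2"
      using AA by (metis mult.assoc)+
    show "c * (p$1 * p$3 * p$5) = - (2 * (a * A 1) + b * A 2)"
      using E(1) unfolding AA C_def by algebra
    show "d * (p$2 * p$4 * p$6) = - (2 * (b * A 2) + a * A 1)"
      using E(2) unfolding AA D_def by algebra
  qed
qed

text \<open>
  The singular points are translates of \<open>(1, m, \<epsilon>, \<epsilon> m, \<epsilon>\<^sup>2, \<epsilon>\<^sup>2 m)\<close>, where \<open>\<epsilon>\<^sup>3 = 1\<close> and \<open>m\<close> solves two
  quadratic equations. The discriminant is the product over \<open>\<epsilon>\<close> of the resultants of these equations.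
\<close>

definition disc :: "complex \<Rightarrow> complex \<Rightarrow> complex \<Rightarrow> complex \<Rightarrow> complex" where
  "disc a b c d = (let v = c * d; s = a^3 * d + b^3 * c; w = (a * b)^3 in
     27 * w^2 + 216 * v^2 * (v * w) + 54 * (4 * s + v^2) * (v * w) - (4 * s + v^2)^3)"

text \<open>The family consists of the cubics that are singular at (1,1,1,1,1,1).\<close>

lemma disc_zero_on_family: "disc \<alpha> \<beta> (- (2*\<alpha> + \<beta>)) (- (2*\<beta> + \<alpha>)) = 0"
  unfolding disc_def Let_def by algebra

text \<open>Scaling the coordinates by those of a singular point leads into the family above and
  multiplies v, s, w by P, P^2, P^3, where P is the product of the coordinates. As
  \<open>disc\<close> is weighted homogeneous of degree 6 in them, its vanishing carries
  over.\<close>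

lemma disc_zero_if_singular:
  assumes "a \<noteq> 0" "b \<noteq> 0" and "singular_points (pt a b c d) \<noteq> {}"
  shows "disc a b c d = 0"
proof -
  obtain p where "p \<in> singular_points (pt a b c d)" using assms by blast
  from singular_point_coordinates[OF assms(1,2) this] obtain \<alpha> \<beta> where
    p: "\<And>i. p $ i \<noteq> 0" and
    e: "a * (p$1)\<^sup>2 * p$2 = \<alpha>" "a * (p$3)\<^sup>2 * p$4 = \<alpha>" "a * (p$5)\<^sup>2 * p$6 = \<alpha>"
    "b * (p$2)\<^sup>2 * p$3 = \<beta>" "b * (p$4)\<^sup>2 * p$5 = \<beta>" "b * (p$6)\<^sup>2 * p$1 = \<beta>"
    "c * (p$1 * p$3 * p$5) = - (2*\<alpha> + \<beta>)" "d * (p$2 * p$4 * p$6) = - (2*\<beta> + \<alpha>)"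
    by metis
  define P where "P = p$1 * p$2 * p$3 * p$4 * p$5 * p$6"
  define C where "C = - (2*\<alpha> + \<beta>)"
  define D where "D = - (2*\<beta> + \<alpha>)"
  have "\<alpha>^3 = (a * (p$1)\<^sup>2 * p$2) * (a * (p$3)\<^sup>2 * p$4) * (a * (p$5)\<^sup>2 * p$6)"
    unfolding e by (simp add: power3_eq_cube)
  then have a3: "\<alpha>^3 = a^3 * ((p$1 * p$3 * p$5)^2 * (p$2 * p$4 * p$6))"
    by (simp add: power3_eq_cube power2_eq_square mult_ac)
  have "\<beta>^3 = (b * (p$2)\<^sup>2 * p$3) * (b * (p$4)\<^sup>2 * p$5) * (b * (p$6)\<^sup>2 * p$1)"
    unfolding e by (simp add: power3_eq_cube)
  then have b3: "\<beta>^3 = b^3 * ((p$2 * p$4 * p$6)^2 * (p$1 * p$3 * p$5))"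
    by (simp add: power3_eq_cube power2_eq_square mult_ac)
  have v: "C * D = P * (c * d)"
    unfolding C_def D_def e(7,8)[symmetric] P_def by (simp add: mult_ac)
  have s: "\<alpha>^3 * D + \<beta>^3 * C = P^2 * (a^3 * d + b^3 * c)"
    unfolding a3 b3 unfolding C_def D_def e(7,8)[symmetric] P_def
    by (simp add: power2_eq_square algebra_simps)
  have w: "(\<alpha> * \<beta>)^3 = P^3 * (a * b)^3"
    unfolding power_mult_distrib a3 b3 P_def by (simp add: power3_eq_cube power2_eq_square mult_ac)
  have "disc \<alpha> \<beta> C D = P^6 * disc a b c d"
    unfolding disc_def Let_def v s w by algebra
  moreover have "P^6 \<noteq> 0" using p by (simp add: P_def)
  moreover have "disc \<alpha> \<beta> C D = 0" unfolding C_def D_def by (rule disc_zero_on_family)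
  ultimately show ?thesis by simp
qed

text \<open>With \<alpha> = a m and \<beta> = \<epsilon> b m^2 the conclusion reads c = -(2 \<alpha>
  + \<beta>) and d m^3 = -(2 \<beta> + \<alpha>), the conditions for a singular point with
  parameters \<epsilon> and m. After division by m in the second one, up to the factor m again, both
  are quadratics in m, and a vanishing resultant supplies a common root.\<close>

lemma disc_zero_imp_parameters:
  assumes "a \<noteq> 0" "b \<noteq> 0" and disc: "disc a b c d = 0"
  obtains \<epsilon> m where "\<epsilon>^3 = 1" "m \<noteq> 0"
    "c = - (2 * (a * m) + \<epsilon> * b * m^2)" "d * m^3 = - (2 * (\<epsilon> * b * m^2) + a * m)"
proof -
  obtain w :: complex where w: "w * w = - 1 - w" using exists_cube_root_of_unity by blast
  define A where "A = - (4 * (a^3 * d + b^3 * c) + (c * d)^2)"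
  \<comment> \<open>For \<epsilon>^3 = 1 this is minus the resultant of (\<epsilon> b) m^2 + 2 a m +
    c and d m^2 + 2 (\<epsilon> b) m + a.\<close>
  define R where "R = (\<lambda>\<epsilon>. A + 6 * (c * d) * (\<epsilon> * (a * b)) + 3 * (\<epsilon> * (a * b))^2)"
  have "R 1 * R w * R (- 1 - w) = disc a b c d"
    using w unfolding R_def A_def disc_def Let_def by algebra
  then have "\<exists>\<epsilon>\<in>{1, w, - 1 - w}. R \<epsilon> = 0" using disc by auto
  moreover have "w^3 = 1" "(- 1 - w)^3 = 1" using w by algebra+
  ultimately obtain \<epsilon> where \<epsilon>: "\<epsilon>^3 = 1" "R \<epsilon> = 0" by (metis (no_types) insertE singletonD power_one)
  define b' where "b' = \<epsilon> * b"
  have b': "b'^3 = b^3" "b' \<noteq> 0" using \<epsilon>(1) assms(2) by (auto simp: b'_def power_mult_distrib)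
  have R: "A + 6 * (c * d) * (a * b') + 3 * (a * b')^2 = 0"
    using \<epsilon>(2) by (simp add: R_def b'_def mult_ac)
  \<comment> \<open>The roots of the first quadratic are (-a + q) / b' and (-a - q) / b'. The
    identity below multiplies the values of the second quadratic at both roots, each scaled by b'^2;
    the product is the resultant up to the factor b'^2.\<close>
  define q where "q = csqrt (a^2 - b' * c)"
  have q: "q * q = a^2 - b' * c" unfolding q_def using power2_csqrt by (simp add: power2_eq_square)
  have "(d * (- a + q)^2 + 2 * b'^2 * (- a + q) + a * b'^2) * (d * (- a + -q)^2 + 2 * b'^2 * (- a + -q) +
    a * b'^2)
     = - (b'^2) * (A + 6 * (c * d) * (a * b') + 3 * (a * b')^2)"
    using q b'(1) unfolding A_def by algebra
  then have "\<exists>r\<in>{q, -q}. d * (- a + r)^2 + 2 * b'^2 * (- a + r) + a * b'^2 = 0"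
    unfolding R by (simp only: mult_zero_right mult_eq_0_iff) blast
  then obtain r where r: "d * (- a + r)^2 + 2 * b'^2 * (- a + r) + a * b'^2 = 0" "r * r = a^2 - b' * c"
    using q by auto
  define m where "m = (- a + r) / b'"
  have m: "- a + r = b' * m" using b' by (simp add: m_def)
  have "b'^2 * (d * m^2 + 2 * b' * m + a) = 0" using r(1) unfolding m by algebra
  then have 1: "d * m^2 + 2 * b' * m + a = 0" using b' by simp
  have "b' * (b' * m^2 + 2 * a * m + c) = 0" using r(2) m by algebra
  then have 2: "b' * m^2 + 2 * a * m + c = 0" using b' by simp
  show ?thesis
  proof (rule that[OF \<epsilon>(1)])
    show "m \<noteq> 0" using 1 assms(1) by auto
    show "c = - (2 * (a * m) + \<epsilon> * b * m^2)" using 2 unfolding b'_def by algebra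
    show "d * m^3 = - (2 * (\<epsilon> * b * m^2) + a * m)" using 1 unfolding b'_def by algebra
  qed
qed

lemma singular_if_disc_zero:
  assumes "a \<noteq> 0" "b \<noteq> 0" and "disc a b c d = 0"
  shows "singular_points (pt a b c d) \<noteq> {}"
proof -
  obtain \<epsilon> m where \<epsilon>: "\<epsilon>^3 = 1" and m: "m \<noteq> 0" and
    c: "c = - (2 * (a * m) + \<epsilon> * b * m^2)" and d: "d * m^3 = - (2 * (\<epsilon> * b * m^2) + a * m)"
    using disc_zero_imp_parameters[OF assms] by blast
  have \<epsilon>': "\<epsilon> \<noteq> 0" using \<epsilon> by auto
  have "m * (d * m^2) = m * (- (2 * (\<epsilon> * b * m) + a))" using d by algebra
  then have d': "d * m^2 = - (2 * (\<epsilon> * b * m) + a)" by (rule mult_left_cancel[OF m, THEN iffD1])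
  have "vector [1, m, \<epsilon>, \<epsilon> * m, \<epsilon>^2, \<epsilon>^2 * m] \<in> singular_points (pt a b c d)"
    unfolding singular_points_pt
  proof
    show "vector [1, m, \<epsilon>, \<epsilon> * m, \<epsilon>^2, \<epsilon>^2 * m] \<noteq> (0::complex^6)"
      by (auto simp: vec_eq_iff vector_6 intro!: exI[where x = 1])
    show "cubic_gradient a b c d (vector [1, m, \<epsilon>, \<epsilon> * m, \<epsilon>^2, \<epsilon>^2 * m]) = 0"
      unfolding vec_eq_iff forall_6 cubic_gradient_def vector_6 zero_index
    proof (intro conjI)
      show "2 * a * 1 * m + b * (\<epsilon>\<^sup>2 * m)\<^sup>2 + c * \<epsilon> * \<epsilon>\<^sup>2 = 0" using \<epsilon> c by algebra
      show "2 * b * m * \<epsilon> + a * 1\<^sup>2 + d * (\<epsilon> * m) * (\<epsilon>\<^sup>2 * m) = 0" unfolding power_one mult_1_right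
        using \<epsilon> d' by algebra
      show "2 * a * \<epsilon> * (\<epsilon> * m) + b * m\<^sup>2 + c * 1 * \<epsilon>\<^sup>2 = 0" using \<epsilon> c by algebra
      show "2 * b * (\<epsilon> * m) * \<epsilon>\<^sup>2 + a * \<epsilon>\<^sup>2 + d * m * (\<epsilon>\<^sup>2 * m) = 0" unfolding power_one mult_1_right
        using \<epsilon> d' by algebra
      show "2 * a * \<epsilon>\<^sup>2 * (\<epsilon>\<^sup>2 * m) + b * (\<epsilon> * m)\<^sup>2 + c * 1 * \<epsilon> = 0" using \<epsilon> c by algebra
      show "2 * b * (\<epsilon>\<^sup>2 * m) * 1 + a * (\<epsilon>\<^sup>2)\<^sup>2 + d * m * (\<epsilon> * m) = 0" unfolding power_one mult_1_right
        using \<epsilon> d' by algebra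
    qed
  qed
  then show ?thesis by blast
qed

section \<open>The type of the singularities\<close>

lemma pt_memE:
  assumes "f \<in> pt a b c d" obtains k where "f = cubic_abcd (k * a) (k * b) (k * c) (k * d)"
  using assms unfolding pt_def line_def by (auto simp: cubic_abcd_mult)

lemma ADE_if_singular:
  assumes "a \<noteq> 0" "b \<noteq> 0" and "singular_points (pt a b c d) \<noteq> {}"
  shows "singular_of_ADE_type (pt a b c d)"
proof -
  have "cubic_abcd a b c d \<in> pt a b c d" unfolding pt_def line_def
    by (auto intro!: exI[where x = 1])
  moreover have "ade_singularity (cubic_abcd a b c d) p" if "p \<in> singular_points (pt a b c d)" for p
    by (rule singular_point_coordinates[OF assms(1,2) that])
      (rule ade_singularity_all_coordinates_nonzero)
  ultimately show ?thesis unfolding singular_of_ADE_type_def using assms(3) by blast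
qed

text \<open>By the last assumption no other point of the curve is projectively equal to \<gamma>(0).
  Points of small parameter are then singular points arbitrarily close to \<gamma>(0), against
  \<open>ade_singularity_isolated\<close>.\<close>

lemma not_ADE_along_curve:
  fixes \<gamma> :: "complex \<Rightarrow> complex^6"
  assumes "\<And>y. \<gamma> y \<in> singular_points (pt a b c d)" "isCont \<gamma> 0"
    "\<And>y k. y \<noteq> 0 \<Longrightarrow> \<gamma> y \<noteq> k *s \<gamma> 0"
  shows "\<not> singular_of_ADE_type (pt a b c d)"
proof
  assume "singular_of_ADE_type (pt a b c d)"
  then obtain f where f: "f \<in> pt a b c d" "ade_singularity f (\<gamma> 0)"
    using assms(1) unfolding singular_of_ADE_type_def by blast
  have "f (k *s x) = k^3 * f x" for k x
    using f(1) by (rule pt_memE) (simp add: cubic_abcd_scale)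
  from ade_singularity_isolated[OF this f(2)] obtain \<epsilon> where \<epsilon>: "\<epsilon> > 0"
    "\<And>q. dist q (\<gamma> 0) < \<epsilon> \<Longrightarrow> f q = 0 \<Longrightarrow> (f has_derivative (\<lambda>v. 0)) (at q) \<Longrightarrow> \<exists>c. q = c *s \<gamma> 0"
    by metis
  obtain \<delta> where \<delta>: "\<delta> > 0" "\<And>y. dist y 0 < \<delta> \<Longrightarrow> dist (\<gamma> y) (\<gamma> 0) < \<epsilon>"
    using assms(2) \<epsilon>(1) unfolding continuous_at_eps_delta by blast
  define y where "y = complex_of_real (\<delta> / 2)"
  have y: "y \<noteq> 0" "dist y 0 < \<delta>" using \<delta>(1) by (auto simp: y_def)
  have "f (\<gamma> y) = 0" "(f has_derivative (\<lambda>v. 0)) (at (\<gamma> y))"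
    using assms(1)[of y] f(1) unfolding singular_points_def by auto
  with \<epsilon>(2)[OF \<delta>(2)[OF y(2)]] assms(3)[OF y(1)] show False by blast
qed

lemma isCont_vector_6:
  fixes f1 :: "complex \<Rightarrow> complex"
  assumes "isCont f1 x" "isCont f2 x" "isCont f3 x" "isCont f4 x" "isCont f5 x" "isCont f6 x"
  shows "isCont (\<lambda>y. vector [f1 y, f2 y, f3 y, f4 y, f5 y, f6 y] :: complex^6) x"
proof -
  have "\<forall>i. isCont (\<lambda>y. (vector [f1 y, f2 y, f3 y, f4 y, f5 y, f6 y] :: complex^6) $ i) x"
    unfolding forall_6 vector_6 using assms by blast
  then show ?thesis unfolding isCont_def by (auto intro: vec_tendstoI)
qed

text \<open>On the plane x1 = x4 = x5 = 0 all partial derivatives vanish except the one by x4, which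
  is x3^2 - x2 x6. The curve runs along this conic.\<close>

lemma not_ADE_b_zero: "\<not> singular_of_ADE_type (pt 1 0 t (-1))"
proof (rule not_ADE_along_curve[where \<gamma> = "\<lambda>y. vector [0, 1, y, 0, 0, y\<^sup>2]"])
  show "vector [0, 1, y, 0, 0, y\<^sup>2] \<in> singular_points (pt 1 0 t (-1))" for y
    unfolding singular_points_pt
    by (auto simp: cubic_gradient_def vec_eq_iff forall_6 vector_6 intro!: exI[where x = 2])
  show "isCont (\<lambda>y. vector [0, 1, y, 0, 0, y\<^sup>2] :: complex^6) 0"
    by (intro isCont_vector_6 continuous_intros)
  show "vector [0, 1, y, 0, 0, y\<^sup>2] \<noteq> k *s (vector [0, 1, 0, 0, 0, 0\<^sup>2] :: complex^6)" if "y \<noteq> 0" for y k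
    using that by (auto simp: vec_eq_iff vector_6 intro!: exI[where x = 3])
qed

text \<open>Each partial derivative is a product of two different coordinates of equal parity, so
  the line joining the first two coordinate points is singular.\<close>

lemma not_ADE_a_b_zero: "\<not> singular_of_ADE_type (pt 0 0 1 1)"
proof (rule not_ADE_along_curve[where \<gamma> = "\<lambda>y. vector [1, y, 0, 0, 0, 0]"])
  show "vector [1, y, 0, 0, 0, 0] \<in> singular_points (pt 0 0 1 1)" for y
    unfolding singular_points_pt
    by (auto simp: cubic_gradient_def vec_eq_iff forall_6 vector_6 intro!: exI[where x = 1])
  show "isCont (\<lambda>y. vector [1, y, 0, 0, 0, 0] :: complex^6) 0" by (intro isCont_vector_6 continuous_intros)
  show "vector [1, y, 0, 0, 0, 0] \<noteq> k *s (vector [1, 0, 0, 0, 0, 0] :: complex^6)" if "y \<noteq> 0" for y k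
    using that by (auto simp: vec_eq_iff vector_6 intro!: exI[where x = 2])
qed

section \<open>Matrices modulo scalars\<close>

lemma matrix_inv_unique:
  fixes A :: "'a::semiring_1^'n^'n"
  assumes "A ** B = mat 1" "B ** A = mat 1" shows "matrix_inv A = B"
proof -
  have inv: "matrix_inv A ** A = mat 1"
    unfolding matrix_inv_def by (rule someI2[of _ B]) (simp_all add: assms)
  have "matrix_inv A = (matrix_inv A ** A) ** B"
    by (simp add: assms(1) flip: matrix_mul_assoc)
  then show ?thesis by (simp add: inv)
qed

lemma matrix_inv_cancel:
  fixes A :: "'a::semiring_1^'n^'n"
  assumes "invertible A" shows "A ** matrix_inv A = mat 1" "matrix_inv A ** A = mat 1"
proof -
  obtain B where "A ** B = mat 1" "B ** A = mat 1" using assms unfolding invertible_def by blast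
  with matrix_inv_unique[OF this] show "A ** matrix_inv A = mat 1" "matrix_inv A ** A = mat 1"
    by simp_all
qed

lemma invertible_matrix_inv: "invertible A \<Longrightarrow> invertible (matrix_inv (A :: complex^'n^'n))"
  using matrix_inv_cancel[of A] unfolding invertible_def by blast

lemma mat_mult_commute: "mat c ** (A :: complex^'n^'n) = A ** mat c"
  by (simp add: matrix_matrix_mult_def mat_def vec_eq_iff mult.commute if_distrib
      if_distribR cong: if_cong)

lemma mat_mult_nth: "(mat c ** A) $ i $ j = c * (A :: complex^'n^'n) $ i $ j"
  by (simp add: matrix_matrix_mult_def mat_def if_distrib[where f = "\<lambda>x. x * _"] cong: if_cong)

lemma mat_mult_mat: "mat c ** mat d = (mat (c * d) :: complex^'n^'n)"
  by (simp add: vec_eq_iff mat_mult_nth) (simp add: mat_def)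

lemma det_mat: "det (mat c :: complex^6^6) = c ^ 6"
  by (subst det_diagonal) (auto simp: mat_def)

lemma invertible_mat: "c \<noteq> 0 \<Longrightarrow> invertible (mat c :: complex^'n^'n)"
  unfolding invertible_def by (rule exI[where x = "mat (inverse c)"]) (simp add: mat_mult_mat)

lemma GL6_simps: "A \<in> carrier GL6 \<longleftrightarrow> invertible A" "A \<otimes>\<^bsub>GL6\<^esub> B = A ** B"
  "\<one>\<^bsub>GL6\<^esub> = mat 1"
  by (simp_all add: GL6_def)

lemma group_GL6: "group GL6"
proof (rule groupI, unfold GL6_simps)
  show "\<exists>y\<in>carrier GL6. y ** x = mat 1" if "invertible x" for x
    using invertible_matrix_inv[OF that] matrix_inv_cancel(2)[OF that] GL6_simps(1) by blast
  show "invertible (x ** y)" if "invertible x" "invertible y" for x y :: "complex^6^6"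
    using that by (rule invertible_mult)
  show "invertible (mat 1 :: complex^6^6)" by (rule invertible_mat) simp
  show "x ** y ** z = x ** (y ** z)" for x y z :: "complex^6^6" by (rule matrix_mul_assoc[symmetric])
  show "mat 1 ** x = x" for x :: "complex^6^6" by (rule matrix_mul_lid)
qed

lemma inv_GL6: "invertible A \<Longrightarrow> inv\<^bsub>GL6\<^esub> A = matrix_inv A"
  by (rule group.inv_equality[OF group_GL6])
    (simp_all only: GL6_simps matrix_inv_cancel invertible_matrix_inv)

lemma SL6_simps: "A \<in> carrier SL6 \<longleftrightarrow> det A = 1" "A \<otimes>\<^bsub>SL6\<^esub> B = A ** B"
  "\<one>\<^bsub>SL6\<^esub> = mat 1"
  by (simp_all add: SL6_def)

lemma det_matrix_inv:
  fixes A :: "complex^'n^'n"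
  assumes "det A = 1" shows "invertible A" "det (matrix_inv A) = 1"
proof -
  show inv: "invertible A" using assms by (simp add: invertible_det_nz)
  show "det (matrix_inv A) = 1"
    using arg_cong[OF matrix_inv_cancel(2)[OF inv], of det] assms by (simp add: det_mul)
qed

lemma group_SL6: "group SL6"
proof (rule groupI, unfold SL6_simps)
  show "\<exists>y\<in>carrier SL6. y ** x = mat 1" if "det x = 1" for x
    using det_matrix_inv[OF that] matrix_inv_cancel(2)[of x] SL6_simps(1) by blast
  show "x ** y ** z = x ** (y ** z)" for x y z :: "complex^6^6" by (rule matrix_mul_assoc[symmetric])
qed (simp_all add: det_mul)

lemma normal_scalars6: "scalars6 \<lhd> GL6"
proof (rule group.normal_invI[OF group_GL6])
  show "subgroup scalars6 GL6"
  proof (rule group.subgroupI[OF group_GL6])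
    show "scalars6 \<subseteq> carrier GL6" by (auto simp: scalars6_def GL6_simps invertible_mat)
    show "scalars6 \<noteq> {}" by (auto simp: scalars6_def intro: exI[where x = 1])
    show "inv\<^bsub>GL6\<^esub> a \<in> scalars6" if a: "a \<in> scalars6" for a
    proof -
      obtain c where c: "c \<noteq> 0" "a = mat c" using a unfolding scalars6_def by blast
      have "inv\<^bsub>GL6\<^esub> a = mat (inverse c)"
        unfolding c(2) inv_GL6[OF invertible_mat[OF c(1)]]
        by (rule matrix_inv_unique) (simp_all add: mat_mult_mat c)
      then show ?thesis using c by (auto simp: scalars6_def)
    qed
    show "a \<otimes>\<^bsub>GL6\<^esub> b \<in> scalars6" if "a \<in> scalars6" "b \<in> scalars6" for a b
      using that by (auto simp: scalars6_def GL6_simps mat_mult_mat)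
  qed
  show "x \<otimes>\<^bsub>GL6\<^esub> h \<otimes>\<^bsub>GL6\<^esub> inv\<^bsub>GL6\<^esub> x \<in> scalars6" if xh: "x \<in> carrier GL6" "h \<in> scalars6" for x h
  proof -
    have x: "invertible x" using xh(1) by (simp add: GL6_simps)
    obtain c where c: "c \<noteq> 0" "h = mat c" using xh(2) unfolding scalars6_def by blast
    have "x ** mat c ** matrix_inv x = mat c"
      unfolding mat_mult_commute[of c x, symmetric]
      by (simp add: matrix_inv_cancel[OF x] flip: matrix_mul_assoc)
    then show ?thesis using c(1) unfolding GL6_simps inv_GL6[OF x] c(2) scalars6_def by blast
  qed
qed

lemma group_PGL6: "group PGL6"
  unfolding PGL6_def by (rule normal.factorgroup_is_group[OF normal_scalars6])

lemma to_PGL6_hom: "to_PGL6 \<in> hom GL6 PGL6"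
proof -
  have "to_PGL6 = (\<lambda>a. scalars6 #>\<^bsub>GL6\<^esub> a)" by (simp add: fun_eq_iff to_PGL6_def)
  then show ?thesis
    using normal.r_coset_hom_Mod[OF normal_scalars6] by (simp only: PGL6_def)
qed

lemma carrier_PGL6: "C \<in> carrier PGL6 \<longleftrightarrow> (\<exists>A. invertible A \<and> C = to_PGL6 A)"
  unfolding PGL6_def FactGroup_def RCOSETS_def to_PGL6_def partial_object.simps UN_iff singleton_iff
  by (metis GL6_simps(1))

lemma to_PGL6_eq_image: "to_PGL6 A = {mat c ** A | c. c \<noteq> 0}"
  unfolding to_PGL6_def r_coset_def GL6_simps scalars6_def by blast

lemma to_PGL6_mult:
  assumes "invertible A" "invertible B"
  shows "to_PGL6 A \<otimes>\<^bsub>PGL6\<^esub> to_PGL6 B = to_PGL6 (A ** B)"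
  using hom_mult[OF to_PGL6_hom, of A B] assms unfolding GL6_simps by simp

lemma to_PGL6_inv:
  assumes "invertible A" shows "inv\<^bsub>PGL6\<^esub> (to_PGL6 A) = to_PGL6 (matrix_inv A)"
proof -
  have "group_hom GL6 PGL6 to_PGL6"
    by (intro group_hom.intro group_hom_axioms.intro group_GL6 group_PGL6 to_PGL6_hom)
  from group_hom.hom_inv[OF this, of A] show ?thesis
    unfolding inv_GL6[OF assms] GL6_simps using assms by simp
qed

lemma to_PGL6_eqD:
  assumes "to_PGL6 A = to_PGL6 B" obtains c where "c \<noteq> 0" "A = mat c ** B"
proof -
  have "mat 1 ** A \<in> to_PGL6 A"
    unfolding to_PGL6_eq_image by (rule CollectI, rule exI[of _ 1]) simp
  then have "A \<in> to_PGL6 B" unfolding assms by simp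
  then obtain c where "c \<noteq> 0" "A = mat c ** B" unfolding to_PGL6_eq_image by blast
  then show ?thesis by (rule that)
qed

lemma to_PGL6_scale:
  assumes "c \<noteq> 0" shows "to_PGL6 (mat c ** A) = to_PGL6 A"
proof (rule Set.set_eqI)
  fix X
  have 1: "mat k ** (mat c ** A) = mat (k * c) ** A" for k
    by (simp add: matrix_mul_assoc mat_mult_mat)
  have 2: "mat k ** A = mat (k / c) ** (mat c ** A)" for k
    using assms by (simp add: matrix_mul_assoc mat_mult_mat)
  show "X \<in> to_PGL6 (mat c ** A) \<longleftrightarrow> X \<in> to_PGL6 A"
  proof
    assume "X \<in> to_PGL6 (mat c ** A)"
    then obtain k where "k \<noteq> 0" "X = mat (k * c) ** A" unfolding to_PGL6_eq_image 1 by blast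
    then show "X \<in> to_PGL6 A" using assms unfolding to_PGL6_eq_image
      by (intro CollectI exI[of _ "k * c"]) simp
  next
    assume "X \<in> to_PGL6 A"
    then obtain k where "k \<noteq> 0" "X = mat (k / c) ** (mat c ** A)"
      unfolding to_PGL6_eq_image using 2 by blast
    then show "X \<in> to_PGL6 (mat c ** A)" using assms unfolding to_PGL6_eq_image
      by (intro CollectI exI[of _ "k / c"]) simp
  qed
qed

section \<open>Monomial matrices\<close>

definition monomial_matrix :: "(6 \<Rightarrow> complex) \<Rightarrow> 6 \<Rightarrow> complex^6^6" where
  "monomial_matrix d e = (\<chi> k l. if l = k + e then d k else 0)"

lemma monomial_matrix_mult_nth:
  "(monomial_matrix d e ** A) $ k $ l = d k * A $ (k + e) $ l"
  unfolding monomial_matrix_def matrix_matrix_mult_def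
  by (simp add: if_distrib[where f = "\<lambda>x. x * _"] cong: if_cong)

lemma monomial_matrix_mult:
  "monomial_matrix d e ** monomial_matrix d' e' = monomial_matrix (\<lambda>k. d k * d' (k + e)) (e + e')"
  unfolding vec_eq_iff monomial_matrix_mult_nth by (simp add: monomial_matrix_def add.assoc)

lemma monomial_matrix_vec: "(monomial_matrix d e *v x) $ k = d k * x $ (k + e)"
  unfolding monomial_matrix_def matrix_vector_mult_def
  by (simp add: if_distrib[where f = "\<lambda>x. x * _"] cong: if_cong)

lemma mat_monomial: "mat c = monomial_matrix (\<lambda>k. c) 0"
  unfolding monomial_matrix_def mat_def vec_eq_iff by auto

lemma monomial_matrix_inverse:
  assumes "\<And>k. d k \<noteq> 0"
  shows "invertible (monomial_matrix d e)"
    "matrix_inv (monomial_matrix d e) = monomial_matrix (\<lambda>k. inverse (d (k - e))) (- e)"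
proof -
  have 1: "monomial_matrix d e ** monomial_matrix (\<lambda>k. inverse (d (k - e))) (- e) = mat 1"
    "monomial_matrix (\<lambda>k. inverse (d (k - e))) (- e) ** monomial_matrix d e = mat 1"
    using assms by (simp_all add: monomial_matrix_mult mat_monomial)
  then show "invertible (monomial_matrix d e)" unfolding invertible_def by blast
  from 1 show "matrix_inv (monomial_matrix d e) = monomial_matrix (\<lambda>k. inverse (d (k - e))) (- e)"
    by (rule matrix_inv_unique)
qed

text \<open>Squaring removes the sign of the shift, so one formula serves even and odd
  \<open>e\<close>.\<close>

lemma det_monomial_square: "(det (monomial_matrix d e))^2 = (\<Prod>k\<in>UNIV. d k)^2"
proof -
  have p: "(\<lambda>k. k + e) permutes (UNIV :: 6 set)"
    by (rule bij_imp_permutes) (auto simp: bij_def inj_def surj_def intro: exI[of _ "_ - e"])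
  have "monomial_matrix d e = (\<chi> k. (monomial_matrix (\<lambda>k. d (k - e)) 0) $ (k + e))"
    unfolding monomial_matrix_def vec_eq_iff by auto
  then have "det (monomial_matrix d e) =
      of_int (sign (\<lambda>k. k + e)) * det (monomial_matrix (\<lambda>k. d (k - e)) 0)"
    using det_permute_rows[OF p] by metis
  also have "det (monomial_matrix (\<lambda>k. d (k - e)) 0) = (\<Prod>k\<in>UNIV. d (k - e))"
    by (subst det_diagonal) (auto simp: monomial_matrix_def)
  also have "\<dots> = (\<Prod>k\<in>UNIV. d k)"
    by (rule prod.reindex_bij_witness[where i = "\<lambda>k. k + e" and j = "\<lambda>k. k - e"]) auto
  finally show ?thesis by (simp add: power_mult_distrib sign_def)
qed

lemma exists_power_6_root: "z \<noteq> 0 \<Longrightarrow> \<exists>k::complex. k \<noteq> 0 \<and> k ^ 6 = z"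
proof -
  assume "z \<noteq> 0"
  then have "exp (Ln z / 6) ^ 6 = z" by (simp flip: exp_of_nat_mult)
  then show ?thesis by (metis exp_not_eq_zero)
qed

section \<open>The group of order 21\<close>

text \<open>These are the powers 5^(k-1) modulo 7, and 5 is a primitive root. A shift of the index
  thus multiplies all weights by a constant, which is why the shifts normalise the group generated
  by \<open>g7\<close>.\<close>

definition wt :: "6 \<Rightarrow> nat" where "wt k = (vector [1, 5, 4, 6, 2, 3] :: nat^6) $ k"

lemma wt_simps: "wt 1 = 1" "wt 2 = 5" "wt 3 = 4" "wt 4 = 6" "wt 5 = 2" "wt 6 = 3" "wt 0 = 3"
proof -
  have "(6::6) = 0" by simp
  then show "wt 1 = 1" "wt 2 = 5" "wt 3 = 4" "wt 4 = 6" "wt 5 = 2" "wt 6 = 3" "wt 0 = 3"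
    unfolding wt_def using vector_6[of 1 5 4 6 2 "3::nat"] by metis+
qed

lemma zeta_power_7: "\<zeta> ^ 7 = 1"
  unfolding \<zeta>_def using exp_two_pi_i by (simp add: mult_ac flip: exp_of_nat_mult)

lemma zeta_power_mod: "\<zeta> ^ n = \<zeta> ^ (n mod 7)"
proof -
  have "\<zeta> ^ n = \<zeta> ^ (7 * (n div 7) + n mod 7)" by simp
  then show ?thesis by (simp only: power_add power_mult zeta_power_7 power_one mult_1)
qed

lemma zeta_power_eq_1_iff: "\<zeta> ^ n = 1 \<longleftrightarrow> n mod 7 = 0"
proof
  assume "\<zeta> ^ n = 1"
  then have "exp (of_nat n * (2 * pi * \<i> / 7)) = 1" unfolding \<zeta>_def by (simp flip: exp_of_nat_mult)
  then obtain k :: int where "Im (of_nat n * (2 * pi * \<i> / 7)) = of_int (2 * k) * pi"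
    unfolding exp_eq_1 by blast
  then have "real n = 7 * of_int k" by (simp add: field_simps)
  then have "int n = 7 * k" by linarith
  then show "n mod 7 = 0" by presburger
next
  assume "n mod 7 = 0" then show "\<zeta> ^ n = 1" using zeta_power_mod[of n] by simp
qed

lemma zeta_power_eq_iff: "\<zeta> ^ m = \<zeta> ^ n \<longleftrightarrow> m mod 7 = n mod 7"
proof
  assume eq: "\<zeta> ^ m = \<zeta> ^ n"
  have "\<zeta> ^ (m + 6 * n) = \<zeta> ^ n * \<zeta> ^ (6 * n)" by (simp add: power_add eq)
  also have "\<dots> = \<zeta> ^ (7 * n)" by (simp flip: power_add)
  also have "\<dots> = 1" by (simp add: zeta_power_eq_1_iff)
  finally have "(m + 6 * n) mod 7 = 0" by (simp add: zeta_power_eq_1_iff)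
  then obtain q where "m + 6 * n = 7 * q" by auto
  then have "m + 7 * n = n + 7 * q" by simp
  then show "m mod 7 = n mod 7" unfolding nat_mod_eq_iff by blast
next
  assume "m mod 7 = n mod 7" then show "\<zeta> ^ m = \<zeta> ^ n" using zeta_power_mod by metis
qed

lemma wt_shift_mod: "wt (k + 1) mod 7 = (5 * wt k) mod 7" "wt (k + 2) mod 7 = (4 * wt k) mod 7"
  "wt (k + 4) mod 7 = (2 * wt k) mod 7" "wt (k + 5) mod 7 = (3 * wt k) mod 7"
proof -
  have "\<forall>k. wt (k + 1) mod 7 = (5 * wt k) mod 7 \<and> wt (k + 2) mod 7 = (4 * wt k) mod 7 \<and>
    wt (k + 4) mod 7 = (2 * wt k) mod 7 \<and> wt (k + 5) mod 7 = (3 * wt k) mod 7"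
    unfolding forall_6 by (simp add: numerals_mod_6 wt_simps)
  then show "wt (k + 1) mod 7 = (5 * wt k) mod 7" "wt (k + 2) mod 7 = (4 * wt k) mod 7"
    "wt (k + 4) mod 7 = (2 * wt k) mod 7" "wt (k + 5) mod 7 = (3 * wt k) mod 7" by blast+
qed

lemma zeta_power_cong: "m mod 7 = n mod 7 \<Longrightarrow> \<zeta> ^ (i * m) = \<zeta> ^ (i * n)"
  unfolding zeta_power_eq_iff by (rule mod_mult_cong) auto

text \<open>The product of g7^i with the shift by s. The shifts by 0, 4 and 2 are the powers of
  \<open>g3\<close>, so this is the normal form of a group element in
  \<open>F21_form\<close>.\<close>

definition F21_elt :: "nat \<Rightarrow> 6 \<Rightarrow> complex^6^6" where
  "F21_elt i s = monomial_matrix (\<lambda>k. \<zeta> ^ (i * wt k)) s"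

lemma g7_monomial: "g7 = F21_elt 1 0"
proof -
  have "\<forall>k. (vector [\<zeta>, \<zeta>^5, \<zeta>^4, \<zeta>^6, \<zeta>^2, \<zeta>^3] :: complex^6) $ k = \<zeta> ^ wt k"
    unfolding forall_6 vector_6 wt_simps by simp
  then show ?thesis unfolding g7_def F21_elt_def monomial_matrix_def by (auto simp: vec_eq_iff)
qed

lemma g3_monomial: "g3 = F21_elt 0 4"
proof -
  have "i = j + 2 \<longleftrightarrow> j = i + 4" for i j :: 6
  proof
    assume "j = i + 4"
    then have "j + 2 = i + 6" by (simp add: add.assoc)
    then show "i = j + 2" by simp
  next
    assume "i = j + 2"
    then have "i + 4 = j + 6" by (simp add: add.assoc)
    then show "j = i + 4" by simp
  qed
  then show ?thesis unfolding g3_def F21_elt_def monomial_matrix_def by (simp add: vec_eq_iff)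
qed

lemma F21_elt_mult_0: "F21_elt i 0 ** F21_elt j 0 = F21_elt (i + j) 0"
  unfolding F21_elt_def monomial_matrix_mult by (simp add: distrib_right power_add)

lemma F21_elt_mult:
  assumes "s \<in> {0, 2, 4}" shows "\<exists>m. F21_elt i s ** F21_elt j s' = F21_elt m (s + s')"
proof -
  have "\<exists>r. \<forall>k. wt (k + s) mod 7 = (r * wt k) mod 7"
  proof -
    consider "s = 0" | "s = 2" | "s = 4" using assms by blast
    then show ?thesis
    proof cases
      case 1 then show ?thesis by (intro exI[of _ 1]) simp
    next
      case 2 then show ?thesis by (intro exI[of _ 4]) (simp only: wt_shift_mod simp_thms)
    next
      case 3 then show ?thesis by (intro exI[of _ 2]) (simp only: wt_shift_mod simp_thms)
    qed
  qed
  then obtain r where r: "\<And>k. wt (k + s) mod 7 = (r * wt k) mod 7" by blast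
  have "F21_elt i s ** F21_elt j s' = F21_elt (i + j * r) (s + s')"
    unfolding F21_elt_def monomial_matrix_mult zeta_power_cong[OF r]
    by (simp add: distrib_right power_add mult.assoc)
  then show ?thesis by blast
qed

lemma g3_cubed: "g3 ** g3 ** g3 = mat 1"
  unfolding g3_monomial F21_elt_def monomial_matrix_mult mat_monomial by (simp add: numerals_mod_6)

lemma det_g7: "det g7 = 1"
proof -
  have "det g7 = (\<Prod>k\<in>UNIV. g7 $ k $ k)"
    by (rule det_diagonal) (simp add: g7_def)
  also have "\<dots> = (\<Prod>k\<in>UNIV. \<zeta> ^ wt k)"
    unfolding g7_monomial F21_elt_def monomial_matrix_def by simp
  also have "\<dots> = \<zeta> ^ 21" unfolding prod_6 wt_simps by algebra
  also have "\<dots> = 1" by (simp add: zeta_power_eq_1_iff)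
  finally show ?thesis .
qed

lemma det_g3: "det g3 = 1"
proof -
  have "det g3 * det g3 * det g3 = 1"
    using arg_cong[OF g3_cubed, of det] by (simp add: det_mul)
  moreover have "(det g3)^2 = 1"
    unfolding g3_monomial F21_elt_def det_monomial_square by simp
  ultimately show ?thesis by (simp add: power2_eq_square)
qed

lemma inv_SL6: "det A = 1 \<Longrightarrow> inv\<^bsub>SL6\<^esub> A = matrix_inv A"
  by (rule group.inv_equality[OF group_SL6])
    (simp_all only: SL6_simps matrix_inv_cancel det_matrix_inv)

lemma subgroup_F21: "subgroup F21 SL6"
  unfolding F21_def
  by (rule group.generate_is_subgroup[OF group_SL6]) (simp add: SL6_simps det_g7 det_g3)

lemma det_F21: "g \<in> F21 \<Longrightarrow> det g = 1"
  using subgroup.subset[OF subgroup_F21] SL6_simps(1) by blast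

lemma F21_gen: "g7 \<in> F21" "g3 \<in> F21"
  unfolding F21_def by (auto intro: generate.incl)

lemma F21_mult: "g \<in> F21 \<Longrightarrow> h \<in> F21 \<Longrightarrow> g ** h \<in> F21"
  using subgroup.m_closed[OF subgroup_F21, of g h] unfolding SL6_simps .

lemma F21_matrix_inv: "g \<in> F21 \<Longrightarrow> matrix_inv g \<in> F21"
  using subgroup.m_inv_closed[OF subgroup_F21, of g] by (simp only: inv_SL6 det_F21)

lemma F21_one: "mat 1 \<in> F21"
  using subgroup.one_closed[OF subgroup_F21] unfolding SL6_simps .

lemma F21_induct [consumes 1, case_names one g7 g3 inv_g7 inv_g3 mult]:
  assumes "g \<in> F21" "P (mat 1)" "P g7" "P g3" "P (matrix_inv g7)" "P (matrix_inv g3)"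
    "\<And>g h. g \<in> F21 \<Longrightarrow> h \<in> F21 \<Longrightarrow> P g \<Longrightarrow> P h \<Longrightarrow> P (g ** h)"
  shows "P g"
  using assms(1) unfolding F21_def
proof (induction rule: generate.induct)
  case one then show ?case using assms(2) by (simp only: SL6_simps)
next
  case (incl h) then show ?case using assms(3,4) by blast
next
  case (inv h) then show ?case using assms(5,6) by (auto simp only: inv_SL6 det_g7 det_g3 insert_iff)
next
  case (eng h1 h2) then show ?case using assms(7)[of h1 h2] by (simp only: SL6_simps F21_def)
qed

lemma F21_elt_in_F21: "F21_elt i 0 \<in> F21"
proof (induction i)
  case 0
  have "F21_elt 0 0 = mat 1" unfolding F21_elt_def mat_monomial by simp
  then show ?case by (simp add: F21_one)
next
  case (Suc i)
  then show ?case using F21_mult[OF Suc F21_gen(1)] unfolding g7_monomial F21_elt_mult_0 by simp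
qed

lemma F21_form:
  assumes "g \<in> F21" obtains i s where "s \<in> {0, 2, 4}" "g = F21_elt i s"
proof -
  have "\<exists>s\<in>{0,2,4}. \<exists>i. g = F21_elt i s"
    using assms
  proof (induction rule: F21_induct)
    case one
    have "mat 1 = F21_elt 0 0" unfolding F21_elt_def mat_monomial by simp
    then show ?case by blast
  next
    case g7 show ?case unfolding g7_monomial by blast
  next
    case g3 show ?case unfolding g3_monomial by blast
  next
    case inv_g7
    have "matrix_inv g7 = F21_elt 6 0"
    proof (rule matrix_inv_unique)
      have "\<zeta> ^ (n * 7) = 1" for n by (simp add: zeta_power_eq_1_iff)
      then show "g7 ** F21_elt 6 0 = mat 1" "F21_elt 6 0 ** g7 = mat 1"
        unfolding g7_monomial F21_elt_mult_0 unfolding F21_elt_def mat_monomial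
        by (simp_all add: mult.commute)
    qed
    then show ?case by blast
  next
    case inv_g3
    have "matrix_inv g3 = F21_elt 0 2"
      by (rule matrix_inv_unique)
        (simp_all add: g3_monomial F21_elt_def mat_monomial monomial_matrix_mult numerals_mod_6)
    then show ?case by blast
  next
    case (mult g h)
    then obtain s i s' i' where s: "s \<in> {0,2,4}" "s' \<in> {0,2,4}" "g = F21_elt i s" "h = F21_elt i' s'"
      by blast
    have "s + s' \<in> {0,2,4}" using s(1,2) by (auto simp: numerals_mod_6)
    then show ?case using F21_elt_mult[OF s(1)] unfolding s by metis
  qed
  then show ?thesis using that by blast
qed

lemma F21_invertible: "g \<in> F21 \<Longrightarrow> invertible g"
  using det_F21 det_matrix_inv(1) by blast

lemma mem_N_F21_iff:
  assumes A: "invertible A"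
  shows "to_PGL6 A \<in> N_F21 \<longleftrightarrow>
    (\<lambda>g. to_PGL6 (A ** g ** matrix_inv A)) ` F21 = to_PGL6 ` F21"
proof -
  let ?H = "to_PGL6 ` F21"
  have H: "?H \<subseteq> carrier PGL6" using F21_invertible carrier_PGL6 by blast
  have C: "to_PGL6 A \<in> carrier PGL6" using A carrier_PGL6 by blast
  have "to_PGL6 A <#\<^bsub>PGL6\<^esub> ?H #>\<^bsub>PGL6\<^esub> (inv\<^bsub>PGL6\<^esub> (to_PGL6 A)) =
     (\<lambda>X. to_PGL6 A \<otimes>\<^bsub>PGL6\<^esub> X \<otimes>\<^bsub>PGL6\<^esub> (inv\<^bsub>PGL6\<^esub> (to_PGL6 A))) ` ?H"
    unfolding l_coset_def r_coset_def by blast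
  also have "\<dots> = (\<lambda>g. to_PGL6 (A ** g ** matrix_inv A)) ` F21"
    unfolding image_image
  proof (rule image_cong[OF refl])
    fix g assume "g \<in> F21"
    then have g: "invertible g" by (rule F21_invertible)
    show "to_PGL6 A \<otimes>\<^bsub>PGL6\<^esub> to_PGL6 g \<otimes>\<^bsub>PGL6\<^esub> (inv\<^bsub>PGL6\<^esub> (to_PGL6 A)) = to_PGL6 (A ** g ** matrix_inv A)"
      unfolding to_PGL6_inv[OF A] to_PGL6_mult[OF A g]
        to_PGL6_mult[OF invertible_mult[OF A g] invertible_matrix_inv[OF A]] ..
  qed
  finally show ?thesis
    unfolding N_F21_def normalizer_def stabilizer_def using C H by simp
qed

section \<open>The normalizer\<close>

text \<open>Conjugation written without an inverse, so that it passes to products; the scalar c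
  accounts for working in the projective group.\<close>

definition conj_into_F21 :: "complex^6^6 \<Rightarrow> complex^6^6 \<Rightarrow> bool" where
  "conj_into_F21 A g \<longleftrightarrow> (\<exists>c h. c \<noteq> 0 \<and> h \<in> F21 \<and> A ** g = mat c ** h ** A)"

lemma conj_into_F21_mult:
  assumes "conj_into_F21 A g" "conj_into_F21 A g'" shows "conj_into_F21 A (g ** g')"
proof -
  obtain c h c' h' where h: "c \<noteq> 0" "h \<in> F21" "A ** g = mat c ** h ** A"
    "c' \<noteq> 0" "h' \<in> F21" "A ** g' = mat c' ** h' ** A"
    using assms unfolding conj_into_F21_def by blast
  have "A ** (g ** g') = mat c ** h ** (A ** g')" by (simp add: matrix_mul_assoc h(3))
  also have "\<dots> = mat c ** (h ** mat c') ** h' ** A" by (simp add: matrix_mul_assoc h(6))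
  also have "\<dots> = mat (c * c') ** (h ** h') ** A"
    unfolding mat_mult_commute[of c' h, symmetric] by (simp add: matrix_mul_assoc mat_mult_mat)
  finally have "A ** (g ** g') = mat (c * c') ** (h ** h') ** A" .
  moreover have "c * c' \<noteq> 0" using h by simp
  ultimately show ?thesis unfolding conj_into_F21_def using F21_mult[OF h(2,5)] by blast
qed

lemma conj_into_F21_inv:
  assumes "conj_into_F21 A g" "g \<in> F21" shows "conj_into_F21 A (matrix_inv g)"
proof -
  obtain c h where h: "c \<noteq> 0" "h \<in> F21" "A ** g = mat c ** h ** A"
    using assms unfolding conj_into_F21_def by blast
  have "mat (inverse c) ** matrix_inv h ** (A ** g) ** matrix_inv g =
     (mat (inverse c) ** (matrix_inv h ** mat c) ** h ** A) ** matrix_inv g"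
    unfolding h(3) by (simp add: matrix_mul_assoc)
  also have "\<dots> = (mat (inverse c) ** mat c) ** (matrix_inv h ** h) ** A ** matrix_inv g"
    unfolding mat_mult_commute[of c "matrix_inv h", symmetric] by (simp add: matrix_mul_assoc)
  also have "\<dots> = A ** matrix_inv g"
    using h(1) matrix_inv_cancel(2)[OF F21_invertible[OF h(2)]] by (simp add: mat_mult_mat)
  also have "mat (inverse c) ** matrix_inv h ** (A ** g) ** matrix_inv g =
     mat (inverse c) ** matrix_inv h ** A ** (g ** matrix_inv g)" by (simp add: matrix_mul_assoc)
  finally have "A ** matrix_inv g = mat (inverse c) ** matrix_inv h ** A"
    using matrix_inv_cancel(1)[OF F21_invertible[OF assms(2)]] by simp
  then show ?thesis unfolding conj_into_F21_def using h(1) F21_matrix_inv[OF h(2)]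
    by (intro exI[of _ "inverse c"] exI[of _ "matrix_inv h"]) simp
qed

lemma conj_into_F21_all:
  assumes "conj_into_F21 A g7" "conj_into_F21 A g3" "g \<in> F21" shows "conj_into_F21 A g"
  using assms(3)
proof (induction rule: F21_induct)
  case one
  have "A ** mat 1 = mat 1 ** mat 1 ** A" by simp
  then show ?case unfolding conj_into_F21_def using F21_one one_neq_zero by blast
qed (use assms conj_into_F21_inv F21_gen conj_into_F21_mult in blast)+

text \<open>Checking generators for \<open>A\<close> gives one inclusion between the conjugated
  group and the group itself, checking them for the inverse of \<open>A\<close> gives the
  other.\<close>

lemma mem_N_F21I:
  assumes A: "invertible A" and "conj_into_F21 A g7" "conj_into_F21 A g3"
    "conj_into_F21 (matrix_inv A) g7" "conj_into_F21 (matrix_inv A) g3"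
  shows "to_PGL6 A \<in> N_F21"
  unfolding mem_N_F21_iff[OF A]
proof (intro equalityI subsetI)
  fix X assume "X \<in> (\<lambda>g. to_PGL6 (A ** g ** matrix_inv A)) ` F21"
  then obtain g where g: "g \<in> F21" "X = to_PGL6 (A ** g ** matrix_inv A)" by blast
  obtain c h where h: "c \<noteq> 0" "h \<in> F21" "A ** g = mat c ** h ** A"
    using conj_into_F21_all[OF assms(2,3) g(1)] unfolding conj_into_F21_def by blast
  have "A ** g ** matrix_inv A = mat c ** h ** (A ** matrix_inv A)"
    unfolding h(3) by (simp add: matrix_mul_assoc)
  then have "X = to_PGL6 h" using g(2) to_PGL6_scale[OF h(1)] by (simp add: matrix_inv_cancel[OF A])
  then show "X \<in> to_PGL6 ` F21" using h(2) by blast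
next
  fix X assume "X \<in> to_PGL6 ` F21"
  then obtain g where g: "g \<in> F21" "X = to_PGL6 g" by blast
  obtain c h where h: "c \<noteq> 0" "h \<in> F21" "matrix_inv A ** g = mat c ** h ** matrix_inv A"
    using conj_into_F21_all[OF assms(4,5) g(1)] unfolding conj_into_F21_def by blast
  have "g = A ** matrix_inv A ** g" by (simp add: matrix_inv_cancel[OF A])
  also have "\<dots> = A ** (mat c ** h ** matrix_inv A)" by (simp add: h(3) flip: matrix_mul_assoc)
  also have "\<dots> = (A ** mat c) ** h ** matrix_inv A" by (simp add: matrix_mul_assoc)
  also have "\<dots> = mat c ** (A ** h ** matrix_inv A)"
    unfolding mat_mult_commute[symmetric] by (simp add: matrix_mul_assoc)
  finally have "X = to_PGL6 (A ** h ** matrix_inv A)" using g(2) to_PGL6_scale[OF h(1)] by simp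
  then show "X \<in> (\<lambda>g. to_PGL6 (A ** g ** matrix_inv A)) ` F21" using h(2) by blast
qed

text \<open>Diagonal matrices commute with \<open>g7\<close>. They commute with \<open>g3\<close> up
  to the scalar \<epsilon> when the entries change by the constant factor \<epsilon> along the
  orbits of the shift by 4.\<close>

lemma conj_into_F21_diag:
  assumes "\<And>k. d k = \<epsilon> * d (k + 4)" "\<epsilon> \<noteq> 0"
  shows "conj_into_F21 (monomial_matrix d 0) g7" "conj_into_F21 (monomial_matrix d 0) g3"
proof -
  have "monomial_matrix d 0 ** g7 = mat 1 ** g7 ** monomial_matrix d 0"
    unfolding g7_monomial F21_elt_def mat_monomial monomial_matrix_mult by (simp add: mult.commute)
  then show "conj_into_F21 (monomial_matrix d 0) g7"
    unfolding conj_into_F21_def using F21_gen(1) one_neq_zero by blast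
  have "monomial_matrix d 0 ** g3 = mat \<epsilon> ** g3 ** monomial_matrix d 0"
    unfolding g3_monomial F21_elt_def mat_monomial monomial_matrix_mult
    by (simp add: assms(1)[symmetric])
  then show "conj_into_F21 (monomial_matrix d 0) g3"
    unfolding conj_into_F21_def using F21_gen(2) assms(2) by blast
qed

lemma diag_in_N_F21:
  assumes "\<And>k. d k = \<epsilon> * d (k + 4)" "\<epsilon> \<noteq> 0" "\<And>k. d k \<noteq> 0"
  shows "to_PGL6 (monomial_matrix d 0) \<in> N_F21"
proof (rule mem_N_F21I)
  have inv: "matrix_inv (monomial_matrix d 0) = monomial_matrix (\<lambda>k. inverse (d k)) 0"
    using monomial_matrix_inverse(2)[of d 0] assms(3) by simp
  have "inverse (d k) = inverse \<epsilon> * inverse (d (k + 4))" for k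
    using arg_cong[OF assms(1)[of k], of inverse] by (simp add: mult.commute)
  note inv_diag = conj_into_F21_diag[where d = "\<lambda>k. inverse (d k)" and \<epsilon> = "inverse \<epsilon>", OF this]
  show "conj_into_F21 (matrix_inv (monomial_matrix d 0)) g7"
    "conj_into_F21 (matrix_inv (monomial_matrix d 0)) g3"
    unfolding inv using inv_diag assms(2) by simp_all
qed (rule conj_into_F21_diag[where d = d and \<epsilon> = \<epsilon>, OF assms(1,2)]
    monomial_matrix_inverse(1)[OF assms(3)])+

text \<open>The shift by 1 multiplies the weights by 5 modulo 7 and its inverse, the shift by 5,
  multiplies them by 3. They therefore carry \<open>g7\<close> to its fifth and third power, and
  they commute with \<open>g3\<close>.\<close>

lemma shift_in_N_F21: "to_PGL6 (monomial_matrix (\<lambda>k. 1) 1) \<in> N_F21"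
proof (rule mem_N_F21I)
  have inv: "matrix_inv (monomial_matrix (\<lambda>k. 1) 1) = monomial_matrix (\<lambda>k. 1) 5"
  proof -
    have m1: "- 1 = (5 :: 6)" by (rule minus_unique) simp
    show ?thesis using monomial_matrix_inverse(2)[of "\<lambda>k. 1" 1] unfolding m1 by simp
  qed
  have g7: "conj_into_F21 (monomial_matrix (\<lambda>k. 1) e) g7"
    if e: "\<And>k. wt (k + e) mod 7 = (r * wt k) mod 7" for e r
  proof -
    have "\<zeta> ^ wt (k + e) = \<zeta> ^ (r * wt k)" for k using e[of k] by (simp add: zeta_power_eq_iff)
    then have "monomial_matrix (\<lambda>k. 1) e ** g7 = mat 1 ** F21_elt r 0 ** monomial_matrix (\<lambda>k. 1) e"
      unfolding g7_monomial F21_elt_def mat_monomial monomial_matrix_mult by simp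
    then show ?thesis unfolding conj_into_F21_def using F21_elt_in_F21 one_neq_zero by blast
  qed
  have g3: "conj_into_F21 (monomial_matrix (\<lambda>k. 1) e) g3" for e
  proof -
    have "monomial_matrix (\<lambda>k. 1) e ** g3 = mat 1 ** g3 ** monomial_matrix (\<lambda>k. 1) e"
      unfolding g3_monomial F21_elt_def mat_monomial monomial_matrix_mult
      by (simp add: add.commute)
    then show ?thesis unfolding conj_into_F21_def using F21_gen one_neq_zero by blast
  qed
  show "conj_into_F21 (monomial_matrix (\<lambda>k. 1) 1) g7" by (rule g7[OF wt_shift_mod(1)])
  show "conj_into_F21 (matrix_inv (monomial_matrix (\<lambda>k. 1) 1)) g7"
    unfolding inv by (rule g7[OF wt_shift_mod(4)])
  show "conj_into_F21 (monomial_matrix (\<lambda>k. 1) 1) g3"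
    "conj_into_F21 (matrix_inv (monomial_matrix (\<lambda>k. 1) 1)) g3"
    unfolding inv by (rule g3)+
  show "invertible (monomial_matrix (\<lambda>k. 1) 1)" by (rule monomial_matrix_inverse) simp
qed

lemma scale_into_N_SL_F21:
  assumes "invertible A" "to_PGL6 A \<in> N_F21"
  obtains k where "k \<noteq> 0" "mat k ** A \<in> N_SL_F21"
proof -
  have "det A \<noteq> 0" using assms(1) by (simp add: invertible_det_nz)
  then obtain k :: complex where k: "k \<noteq> 0" "k ^ 6 = inverse (det A)"
    using exists_power_6_root[of "inverse (det A)"] by auto
  have "det (mat k ** A) = 1" using k(2) \<open>det A \<noteq> 0\<close> by (simp add: det_mul det_mat)
  then have "mat k ** A \<in> N_SL_F21"
    unfolding N_SL_F21_def using assms(2) k(1) by (simp add: SL6_simps to_PGL6_scale)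
  then show ?thesis using that k(1) by blast
qed

lemma monomial_matrix_eqD:
  assumes "monomial_matrix d e = monomial_matrix d' e'" "\<And>k. d k \<noteq> 0"
  shows "e = e'" "d = d'"
proof -
  have 1: "monomial_matrix d e $ k $ l = monomial_matrix d' e' $ k $ l" for k l using assms(1) by simp
  show e: "e = e'"
  proof (rule ccontr)
    assume "e \<noteq> e'"
    then show False using 1[of 1 "1 + e"] assms(2)[of 1] by (simp add: monomial_matrix_def)
  qed
  show "d = d'"
  proof
    fix k show "d k = d' k" using 1[of k "k + e"] e by (simp add: monomial_matrix_def)
  qed
qed

text \<open>Weights run through all nonzero residues as powers of a primitive root, so
  multiplication by i is a translation of the exponent.\<close>

lemma discrete_log:
  assumes "i mod 7 \<noteq> 0"
  shows "\<exists>e. \<forall>k l. wt l mod 7 = (i * wt k) mod 7 \<longrightarrow> l = k + e"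
proof -
  have "\<exists>e. i mod 7 = wt (1 + e)"
  proof -
    have "i mod 7 < 7" by simp
    then have "i mod 7 = 1 \<or> i mod 7 = 2 \<or> i mod 7 = 3 \<or> i mod 7 = 4 \<or> i mod 7 = 5 \<or> i mod 7 = 6"
      using assms by linarith
    moreover have "wt (1 + 0) = 1" "wt (1 + 4) = 2" "wt (1 + 5) = 3" "wt (1 + 2) = 4" "wt (1 + 1) = 5"
      "wt (1 + 3) = 6" by (simp_all add: wt_simps)
    ultimately show ?thesis by metis
  qed
  then obtain e where e: "i mod 7 = wt (1 + e)" by blast
  have mult: "\<forall>e k. (wt (1 + e) * wt k) mod 7 = wt (k + e) mod 7"
    unfolding forall_6 by (simp add: wt_simps numerals_mod_6)
  have inj: "\<forall>k l. wt k mod 7 = wt l mod 7 \<longrightarrow> k = l"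
    unfolding forall_6 by (simp add: wt_simps)
  have "(i * wt k) mod 7 = wt (k + e) mod 7" for k
    using mult e by (metis mod_mult_left_eq)
  then show ?thesis using inj by metis
qed

lemma wt_mult_mod_7: "(i * wt k) mod 7 = 0 \<longleftrightarrow> i mod 7 = 0"
proof -
  have "\<forall>k. (i * wt k) mod 7 = 0 \<longleftrightarrow> i mod 7 = 0"
    unfolding forall_6 wt_simps by (intro conjI; presburger)
  then show ?thesis by (rule spec)
qed

lemma N_SL_F21_conj:
  assumes "A \<in> N_SL_F21" "g \<in> F21"
  obtains c h where "c \<noteq> 0" "h \<in> F21" "matrix_inv A ** g = mat c ** h ** matrix_inv A"
proof -
  have A: "invertible A" "to_PGL6 A \<in> N_F21"
    using assms(1) det_matrix_inv(1) unfolding N_SL_F21_def SL6_simps by blast+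
  obtain h where h: "h \<in> F21" "to_PGL6 g = to_PGL6 (A ** h ** matrix_inv A)"
    using A(2) assms(2) unfolding mem_N_F21_iff[OF A(1)] by blast
  obtain c where c: "c \<noteq> 0" "g = mat c ** (A ** h ** matrix_inv A)" using to_PGL6_eqD[OF h(2)] .
  have "matrix_inv A ** g = (matrix_inv A ** mat c) ** A ** h ** matrix_inv A"
    unfolding c(2) by (simp add: matrix_mul_assoc)
  also have "\<dots> = mat c ** (matrix_inv A ** A) ** h ** matrix_inv A"
    unfolding mat_mult_commute[symmetric] by (simp add: matrix_mul_assoc)
  finally show ?thesis using that[OF c(1) h(1)] by (simp add: matrix_inv_cancel[OF A(1)])
qed

lemma F21_elt_mult_nth: "(F21_elt i s ** B) $ k $ l = \<zeta> ^ (i * wt k) * B $ (k + s) $ l"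
  unfolding F21_elt_def monomial_matrix_mult_nth ..

lemma mult_F21_elt_0_nth: "(B ** F21_elt i 0) $ k $ l = B $ k $ l * \<zeta> ^ (i * wt l)"
  unfolding F21_elt_def matrix_matrix_mult_def monomial_matrix_def
  by (simp add: if_distrib[where f = "\<lambda>x. _ * x"] cong: if_cong)

text \<open>The inverse of \<open>A\<close> is studied because \<open>act\<close> substitutes it. It
  conjugates \<open>g7\<close> to c h with h in the group; once h = g7^i and c = 1 are known, both
  sides are diagonal with six different eigenvalues, so the coordinate axes are permuted, and
  \<open>discrete_log\<close> shows that they are shifted.\<close>

lemma N_SL_F21_monomial:
  assumes A: "A \<in> N_SL_F21"
  obtains b e where "matrix_inv A = monomial_matrix b e" "\<And>k. b k \<noteq> 0"
proof -
  define B where "B = matrix_inv A"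
  have "det A = 1" using A unfolding N_SL_F21_def SL6_simps by blast
  then have B: "invertible B" unfolding B_def using det_matrix_inv(1) invertible_matrix_inv by blast
  have col: "\<exists>k. B $ k $ l \<noteq> 0" for l
  proof (rule ccontr)
    assume "\<not> (\<exists>k. B $ k $ l \<noteq> 0)"
    then have "(matrix_inv B ** B) $ l $ l = 0" by (simp add: matrix_matrix_mult_def)
    then show False using matrix_inv_cancel(2)[OF B] by (simp add: mat_def)
  qed
  obtain c h where c: "c \<noteq> 0" "h \<in> F21" "B ** g7 = mat c ** h ** B"
    unfolding B_def by (rule N_SL_F21_conj[OF A F21_gen(1)])
  obtain i s where s: "s \<in> {0, 2, 4}" "h = F21_elt i s" using F21_form[OF c(2)] .
  have eq: "B $ k $ l * \<zeta> ^ wt l = c * \<zeta> ^ (i * wt k) * B $ (k + s) $ l" for k l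
  proof -
    have "(B ** F21_elt 1 0) $ k $ l = (mat c ** (F21_elt i s ** B)) $ k $ l"
      using c(3) by (simp add: s(2) g7_monomial matrix_mul_assoc)
    then show ?thesis unfolding mat_mult_nth F21_elt_mult_nth mult_F21_elt_0_nth by simp
  qed
  \<comment> \<open>If s were nonzero, h^3 would be the identity, since the weights over an orbit of
    the shift add up to 0 modulo 7. Then g7^3 would be conjugate to the scalar c^3, but it is not
    scalar.\<close>
  have "s = 0"
  proof (rule ccontr)
    assume "s \<noteq> 0"
    then have s': "s = 2 \<or> s = 4" using s(1) by blast
    have s3: "k + s + s + s = k" for k using s' by (auto simp: add.assoc numerals_mod_6)
    have w: "\<forall>k. (wt k + wt (k + s) + wt (k + s + s)) mod 7 = 0"
      unfolding forall_6 using s' by (auto simp: wt_simps numerals_mod_6)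
    have "\<zeta> ^ (3 * wt l) = c ^ 3" for l
    proof -
      obtain k where k: "B $ k $ l \<noteq> 0" using col by blast
      have "B $ k $ l * \<zeta> ^ (3 * wt l) = ((B $ k $ l * \<zeta> ^ wt l) * \<zeta> ^ wt l) * \<zeta> ^ wt l"
        unfolding mult.commute[of 3 "wt l"] power_mult power3_eq_cube by (simp only: mult.assoc)
      also have "\<dots> = c * \<zeta> ^ (i * wt k) * (c * \<zeta> ^ (i * wt (k + s)) * (c * \<zeta> ^ (i * wt (k + s + s)) * B $
          (k + s + s + s) $ l))"
        using eq[of k l] eq[of "k + s" l] eq[of "k + s + s" l] by (simp add: mult_ac)
      also have "\<dots> = c ^ 3 * \<zeta> ^ (i * (wt k + wt (k + s) + wt (k + s + s))) * B $ k $ l"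
        unfolding s3 by (simp add: power3_eq_cube distrib_left power_add mult_ac)
      also have "\<zeta> ^ (i * (wt k + wt (k + s) + wt (k + s + s))) = 1"
        unfolding zeta_power_eq_1_iff using w
          by (simp add: mod_mult_right_eq[symmetric] del: mod_mult_right_eq)
      finally show ?thesis using k by simp
    qed
    then have "\<zeta> ^ (3 * wt 1) = \<zeta> ^ (3 * wt 2)" by simp
    then show False unfolding zeta_power_eq_iff by (simp add: wt_simps)
  qed
  have eq': "\<zeta> ^ wt l = c * \<zeta> ^ (i * wt k)" if "B $ k $ l \<noteq> 0" for k l
    using eq[of k l] that \<open>s = 0\<close> by simp
  \<comment> \<open>c is a quotient of eigenvalues. Exponents are natural numbers, so the factor 6
    stands for -1 modulo 7.\<close>
  have "\<exists>\<gamma>. c = \<zeta> ^ \<gamma>"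
  proof -
    obtain k where k: "B $ k $ 1 \<noteq> 0" using col by blast
    have "\<zeta> ^ (wt 1 + 6 * (i * wt k)) = c * (\<zeta> ^ (i * wt k) * \<zeta> ^ (6 * (i * wt k)))"
      using eq'[OF k] by (simp add: power_add)
    also have "\<zeta> ^ (i * wt k) * \<zeta> ^ (6 * (i * wt k)) = \<zeta> ^ (7 * (i * wt k))" by (simp flip: power_add)
    also have "\<dots> = 1" by (simp add: zeta_power_eq_1_iff)
    finally show ?thesis by auto
  qed
  then obtain \<gamma> where \<gamma>: "c = \<zeta> ^ \<gamma>" by blast
  have i0: "i mod 7 \<noteq> 0"
  proof
    assume "i mod 7 = 0"
    then have "\<zeta> ^ (i * wt k) = 1" for k by (simp add: zeta_power_eq_1_iff wt_mult_mod_7)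
    then have "\<zeta> ^ wt l = c" for l using col[of l] eq' by auto
    then have "\<zeta> ^ wt 1 = \<zeta> ^ wt 2" by simp
    then show False unfolding zeta_power_eq_iff by (simp add: wt_simps)
  qed
  \<comment> \<open>Every seventh root of unity other than 1 is an eigenvalue of \<open>g7\<close>.
    If c were one of them, the matching eigenvalue of g7^i would be 1, which is impossible as i is
    invertible modulo 7.\<close>
  have "c = 1"
  proof (rule ccontr)
    assume "c \<noteq> 1"
    then have "\<gamma> mod 7 \<noteq> 0" using \<gamma> zeta_power_eq_1_iff by blast
    moreover have "\<gamma> mod 7 < 7" by simp
    ultimately have "\<gamma> mod 7 = wt 1 \<or> \<gamma> mod 7 = wt 2 \<or> \<gamma> mod 7 = wt 3 \<or> \<gamma> mod 7 = wt 4 \<or>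
        \<gamma> mod 7 = wt 5 \<or> \<gamma> mod 7 = wt 6"
      unfolding wt_simps by linarith
    then obtain l where l: "\<gamma> mod 7 = wt l" by blast
    obtain k where k: "B $ k $ l \<noteq> 0" using col by blast
    have "\<zeta> ^ wt l = c" using \<gamma> zeta_power_mod[of \<gamma>] l by simp
    then have "\<zeta> ^ (i * wt k) = 1" using eq'[OF k] c(1) by simp
    then show False using i0 by (simp add: zeta_power_eq_1_iff wt_mult_mod_7)
  qed
  obtain e where e: "\<And>k l. wt l mod 7 = (i * wt k) mod 7 \<Longrightarrow> l = k + e"
    using discrete_log[OF i0] by blast
  have zero: "l = k + e" if "B $ k $ l \<noteq> 0" for k l
    using eq'[OF that] \<open>c = 1\<close> e by (simp add: zeta_power_eq_iff)
  show ?thesis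
  proof (rule that)
    show "matrix_inv A = monomial_matrix (\<lambda>k. B $ k $ (k + e)) e"
      unfolding B_def[symmetric] monomial_matrix_def vec_eq_iff using zero by auto
    fix k
    obtain k' where "B $ k' $ (k + e) \<noteq> 0" using col by blast
    then show "B $ k $ (k + e) \<noteq> 0" using zero by (metis add_right_cancel)
  qed
qed

text \<open>The same comparison for \<open>g3\<close> gives b k = c z^(wt k) b (k + 4) with z^7 = 1.
  Running through an orbit of three indices yields c^3 = 1, and then the products belonging to x_i^2
  x_(i+1) agree within each orbit.\<close>

lemma N_SL_F21_entries:
  assumes A: "A \<in> N_SL_F21"
  obtains b e where "matrix_inv A = monomial_matrix b e" "\<And>k. b k \<noteq> 0"
    "(b 3)^2 * b 4 = (b 1)^2 * b 2" "(b 5)^2 * b 6 = (b 1)^2 * b 2"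
    "(b 4)^2 * b 5 = (b 2)^2 * b 3" "(b 6)^2 * b 1 = (b 2)^2 * b 3"
    "(b 1 * b 2 * b 3 * b 4 * b 5 * b 6)^2 = 1"
proof -
  obtain b e where b: "matrix_inv A = monomial_matrix b e" "\<And>k. b k \<noteq> 0"
    by (rule N_SL_F21_monomial[OF A]) (rule that)
  obtain c h where c: "c \<noteq> 0" "h \<in> F21" "matrix_inv A ** g3 = mat c ** h ** matrix_inv A"
    by (rule N_SL_F21_conj[OF A F21_gen(2)])
  obtain i s where s: "s \<in> {0, 2, 4}" "h = F21_elt i s" using F21_form[OF c(2)] .
  have eq: "monomial_matrix b (e + 4) = monomial_matrix (\<lambda>k. c * \<zeta> ^ (i * wt k) * b (k + s)) (s + e)"
    using c(3) unfolding b(1) s(2) g3_monomial F21_elt_def mat_monomial monomial_matrix_mult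
    by simp
  have "s = 4" using monomial_matrix_eqD(1)[OF eq b(2)] by (simp add: add.commute)
  then have bk: "b k = c * \<zeta> ^ (i * wt k) * b (k + 4)" for k
    using fun_cong[OF monomial_matrix_eqD(2)[OF eq b(2)], of k] by simp
  define z where "z = \<zeta> ^ i"
  have z: "z ^ 7 = 1" unfolding z_def power_mult[symmetric] by (simp add: zeta_power_eq_1_iff)
  have bs: "b 1 = c * z * b 5" "b 2 = c * z ^ 5 * b 6" "b 3 = c * z ^ 4 * b 1"
    "b 4 = c * z ^ 6 * b 2" "b 5 = c * z ^ 2 * b 3" "b 6 = c * z ^ 3 * b 4"
    using bk[of 1] bk[of 2] bk[of 3] bk[of 4] bk[of 5] bk[of 6]
    by (simp_all add: wt_simps numerals_mod_6 z_def power_mult)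
  have "b 1 = c ^ 3 * z ^ 7 * b 1" using bs(1,3,5) by algebra
  then have c3: "c ^ 3 = 1" using z b(2)[of 1] by simp
  show ?thesis
  proof (rule that[OF b])
    show "(b 3)^2 * b 4 = (b 1)^2 * b 2" unfolding bs(3,4) using c3 z by algebra
    show "(b 4)^2 * b 5 = (b 2)^2 * b 3" unfolding bs(4,5) using c3 z by algebra
    show "(b 5)^2 * b 6 = (b 1)^2 * b 2" using bs(3-6) c3 z by algebra
    show "(b 6)^2 * b 1 = (b 2)^2 * b 3" using bs(1,2,4-6) c3 z by algebra
    have "det A = 1" using A unfolding N_SL_F21_def SL6_simps by blast
    then have "(det (monomial_matrix b e))^2 = 1" using det_matrix_inv(2) b(1) by (metis power_one)
    then show "(b 1 * b 2 * b 3 * b 4 * b 5 * b 6)^2 = 1"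
      unfolding det_monomial_square prod_6 .
  qed
qed

section \<open>The invariant cubic forms\<close>

lemma matrix_inv_mult:
  fixes A B :: "complex^'n^'n"
  assumes "invertible A" "invertible B" shows "matrix_inv (A ** B) = matrix_inv B ** matrix_inv A"
proof (rule matrix_inv_unique)
  have "A ** B ** (matrix_inv B ** matrix_inv A) = A ** (B ** matrix_inv B) ** matrix_inv A"
    by (simp add: matrix_mul_assoc)
  then show "A ** B ** (matrix_inv B ** matrix_inv A) = mat 1"
    by (simp add: matrix_inv_cancel assms)
  have "matrix_inv B ** matrix_inv A ** (A ** B) = matrix_inv B ** (matrix_inv A ** A) ** B"
    by (simp add: matrix_mul_assoc)
  then show "matrix_inv B ** matrix_inv A ** (A ** B) = mat 1"
    by (simp add: matrix_inv_cancel assms)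
qed

lemma act_mult:
  assumes "invertible A" "invertible B" shows "act (A ** B) f = act A (act B f)"
  unfolding act_def by (simp add: matrix_inv_mult[OF assms] matrix_vector_mul_assoc)

lemma act_eq_iff:
  assumes "invertible A" shows "act A f = f \<longleftrightarrow> (\<forall>x. f (A *v x) = f x)"
proof
  assume eq: "act A f = f"
  show "\<forall>x. f (A *v x) = f x"
  proof
    fix x
    have "f (A *v x) = act A f (A *v x)" by (simp add: eq)
    then show "f (A *v x) = f x"
      by (simp add: act_def matrix_vector_mul_assoc matrix_inv_cancel[OF assms])
  qed
next
  assume eq: "\<forall>x. f (A *v x) = f x"
  show "act A f = f"
  proof
    fix x
    have "f (matrix_inv A *v x) = f (A *v (matrix_inv A *v x))" by (simp add: eq)
    then show "act A f x = f x"
      by (simp add: act_def matrix_vector_mul_assoc matrix_inv_cancel[OF assms])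
  qed
qed

lemma F21_invariantI:
  assumes "\<And>x. f (g7 *v x) = f x" "\<And>x. f (g3 *v x) = f x" "g \<in> F21"
  shows "act g f = f"
proof -
  have inv: "act (matrix_inv A) f = f" if "A \<in> F21" "act A f = f" for A
  proof -
    have A: "invertible A" using F21_invertible[OF that(1)] .
    have "act (matrix_inv A) f = act (matrix_inv A) (act A f)" by (simp add: that(2))
    also have "\<dots> = act (mat 1) f"
      using A by (simp add: act_mult[symmetric] invertible_matrix_inv matrix_inv_cancel)
    also have "\<dots> = f" by (simp add: act_eq_iff invertible_mat)
    finally show ?thesis .
  qed
  have g: "act g7 f = f" "act g3 f = f"
    using assms(1,2) by (simp_all add: act_eq_iff F21_invertible F21_gen)
  show ?thesis using assms(3)
  proof (induction rule: F21_induct)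
    case one show ?case by (simp add: act_eq_iff invertible_mat)
  next
    case (mult g h) then show ?case by (simp add: act_mult F21_invertible)
  qed (use g inv F21_gen in auto)
qed

lemma g7_vec: "(g7 *v x) $ k = \<zeta> ^ wt k * x $ k"
  unfolding g7_monomial F21_elt_def monomial_matrix_vec by simp

lemma g3_vec: "(g3 *v x) $ k = x $ (k + 4)"
  unfolding g3_monomial F21_elt_def monomial_matrix_vec by simp

lemma cubic_abcd_cubic_form: "cubic_abcd a b c d \<in> cubic_forms"
proof -
  define T where "T = (\<lambda>(i::6) (j::6) (k::6).
      (if (i, j, k) \<in> {(1,1,2), (3,3,4), (5,5,6)} then a else 0)
    + (if (i, j, k) \<in> {(2,2,3), (4,4,5), (6,6,1)} then b else 0)
    + (if (i, j, k) = (1,3,5) then c else 0) + (if (i, j, k) = (2,4,6) then d else 0))"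
  have "cubic_abcd a b c d x = (\<Sum>i\<in>UNIV. \<Sum>j\<in>UNIV. \<Sum>k\<in>UNIV. T i j k * x $ i * x $ j * x $ k)" for x
    unfolding sum_6 T_def cubic_abcd_def by (simp add: algebra_simps power2_eq_square)
  then show ?thesis unfolding cubic_forms_def by blast
qed

lemma cubic_abcd_in_V: "cubic_abcd a b c d \<in> V_F21"
proof -
  have "cubic_abcd a b c d (g7 *v x) = cubic_abcd a b c d x" for x
  proof -
    have "\<zeta> ^ 7 = 1" by (rule zeta_power_7)
    then show ?thesis unfolding cubic_abcd_def g7_vec wt_simps by algebra
  qed
  moreover have "cubic_abcd a b c d (g3 *v x) = cubic_abcd a b c d x" for x
    unfolding cubic_abcd_def g3_vec by (simp add: numerals_mod_6 algebra_simps)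
  ultimately show ?thesis unfolding V_F21_def using cubic_abcd_cubic_form F21_invariantI by blast
qed

lemma zeta_power_sum: "(\<Sum>m<7. \<zeta> ^ (m * n)) = (if n mod 7 = 0 then 7 else 0)"
proof (cases "n mod 7 = 0")
  case True
  then have "\<zeta> ^ (m * n) = 1" for m by (auto simp: zeta_power_eq_1_iff)
  then show ?thesis using True by simp
next
  case False
  have "(\<Sum>m<7. \<zeta> ^ (m * n)) = (\<Sum>m<7. (\<zeta> ^ n) ^ m)" by (simp add: mult.commute flip: power_mult)
  also have "\<dots> = 0"
    using geometric_sum[of "\<zeta> ^ n" 7] False by (simp add: zeta_power_eq_1_iff flip: power_mult)
  finally show ?thesis using False by simp
qed

text \<open>Averaging over the powers of \<open>g7\<close> removes the monomials whose weight is
  nonzero modulo 7. Eight remain, the six x_i^2 x_(i+1) and the products of the three odd and of the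
  three even coordinates. Invariance under \<open>g3\<close> equates the coefficients within
  orbits.\<close>

lemma V_F21_imp_cubic_abcd:
  assumes "f \<in> V_F21" shows "\<exists>a b c d. f = cubic_abcd a b c d"
proof -
  obtain T where T: "\<And>x. f x = (\<Sum>i\<in>UNIV. \<Sum>j\<in>UNIV. \<Sum>k\<in>UNIV. T i j k * x $ i * x $ j * x $ k)"
    using assms unfolding V_F21_def cubic_forms_def by blast
  have g: "f (g7 *v x) = f x" "f (g3 *v x) = f x" for x
    using assms F21_gen act_eq_iff[OF F21_invertible] unfolding V_F21_def by blast+
  have "f (F21_elt m 0 *v x) = f x" for m x
  proof (induction m)
    case 0
    have "F21_elt 0 0 = mat 1" unfolding F21_elt_def mat_monomial by simp
    then show ?case by simp
  next
    case (Suc m)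
    have "F21_elt (Suc m) 0 = g7 ** F21_elt m 0" unfolding g7_monomial F21_elt_mult_0 by simp
    then show ?case using Suc g(1) by (simp add: matrix_vector_mul_assoc[symmetric])
  qed
  then have "7 * f x = (\<Sum>m<7. f (F21_elt m 0 *v x))" for x by simp
  also have "\<dots> x = (\<Sum>m<7. \<Sum>i\<in>UNIV. \<Sum>j\<in>UNIV. \<Sum>k\<in>UNIV.
      T i j k * x $ i * x $ j * x $ k * \<zeta> ^ (m * (wt i + wt j + wt k)))" for x
    unfolding T F21_elt_def monomial_matrix_vec by (simp add: power_add distrib_left mult_ac)
  also have "\<dots> x = (\<Sum>i\<in>UNIV. \<Sum>j\<in>UNIV. \<Sum>k\<in>UNIV.
      T i j k * x $ i * x $ j * x $ k * (\<Sum>m<7. \<zeta> ^ (m * (wt i + wt j + wt k))))" for x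
    unfolding sum_distrib_left by (subst sum.swap, subst (2) sum.swap, subst (3) sum.swap) (rule refl)
  finally have "7 * f x = 7 * (\<Sum>i\<in>UNIV. \<Sum>j\<in>UNIV. \<Sum>k\<in>UNIV.
      if (wt i + wt j + wt k) mod 7 = 0 then T i j k * (x $ i * x $ j * x $ k) else 0)" for x
    unfolding zeta_power_sum sum_distrib_left
    by (simp add: if_distrib[where f = "\<lambda>y. _ * y"] mult_ac cong: if_cong)
  then have sum: "f x = (\<Sum>i\<in>UNIV. \<Sum>j\<in>UNIV. \<Sum>k\<in>UNIV.
      if (wt i + wt j + wt k) mod 7 = 0 then T i j k * (x $ i * x $ j * x $ k) else 0)" for x
    by simp
  \<comment> \<open>The tensor T need not be symmetric, so \<open>t\<close> and \<open>q\<close>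
    collect all entries contributing to x_i x_j x_k and to x_i^2 x_k.\<close>
  define t where "t = (\<lambda>i j k. T i j k + T i k j + T j i k + T j k i + T k i j + T k j i)"
  define q where "q = (\<lambda>i k. T i i k + T i k i + T k i i)"
  have f: "f x = q 1 2 * ((x$1)^2 * x$2) + q 3 4 * ((x$3)^2 * x$4) + q 5 6 * ((x$5)^2 * x$6)
    + q 2 3 * ((x$2)^2 * x$3) + q 4 5 * ((x$4)^2 * x$5) + q 6 1 * ((x$6)^2 * x$1)
    + t 1 3 5 * (x$1 * x$3 * x$5) + t 2 4 6 * (x$2 * x$4 * x$6)" for x
    unfolding sum sum_6 wt_simps t_def q_def by (simp add: algebra_simps power2_eq_square)
  \<comment> \<open>At a sum of two neighbouring basis vectors exactly one of the eight monomials is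
    nonzero, so these evaluations compare single coefficients.\<close>
  have v: "g3 *v vector [1,1,0,0,0,0] = vector [0,0,1,1,0,0]" "g3 *v vector [0,0,1,1,0,0] =
      vector [0,0,0,0,1,1]"
    "g3 *v vector [0,1,1,0,0,0] = vector [0,0,0,1,1,0]" "g3 *v vector [0,0,0,1,1,0] = vector [1,0,0,0,0,1]"
    unfolding vec_eq_iff forall_6 g3_vec by (simp_all add: numerals_mod_6 vector_6 vector_6_0)
  have "q 3 4 = q 1 2" "q 5 6 = q 3 4" "q 4 5 = q 2 3" "q 6 1 = q 4 5"
    using g(2)[of "vector [1,1,0,0,0,0]"] g(2)[of "vector [0,0,1,1,0,0]"]
      g(2)[of "vector [0,1,1,0,0,0]"] g(2)[of "vector [0,0,0,1,1,0]"]
    unfolding v f vector_6 by simp_all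
  then have "f = cubic_abcd (q 1 2) (q 2 3) (t 1 3 5) (t 2 4 6)"
    unfolding fun_eq_iff f cubic_abcd_def by (simp add: algebra_simps)
  then show ?thesis by blast
qed

lemma mem_V_F21_iff: "f \<in> V_F21 \<longleftrightarrow> (\<exists>a b c d. f = cubic_abcd a b c d)"
  using V_F21_imp_cubic_abcd cubic_abcd_in_V by blast

section \<open>Invariants of the normalizer\<close>

text \<open>Each of the four points annihilates all but one of the summands of
  \<open>cubic_abcd\<close>. Reading coefficients by evaluation makes their linearity, and so
  membership in \<open>poly_functions\<close>, immediate.\<close>

definition coef_a :: "form6 \<Rightarrow> complex" where "coef_a f = f (vector [1,1,0,0,0,0])"
definition coef_b :: "form6 \<Rightarrow> complex" where "coef_b f = f (vector [0,1,1,0,0,0])"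
definition coef_c :: "form6 \<Rightarrow> complex" where "coef_c f = f (vector [1,0,1,0,1,0])"
definition coef_d :: "form6 \<Rightarrow> complex" where "coef_d f = f (vector [0,1,0,1,0,1])"

lemma coef_cubic_abcd [simp]:
  "coef_a (cubic_abcd a b c d) = a" "coef_b (cubic_abcd a b c d) = b"
  "coef_c (cubic_abcd a b c d) = c" "coef_d (cubic_abcd a b c d) = d"
  unfolding coef_a_def coef_b_def coef_c_def coef_d_def cubic_abcd_def vector_6 by simp_all

lemma cubic_abcd_eq_iff:
  "cubic_abcd a b c d = cubic_abcd a' b' c' d' \<longleftrightarrow> a = a' \<and> b = b' \<and> c = c' \<and> d = d'"
  by (metis coef_cubic_abcd)

lemma cubic_abcd_0: "cubic_abcd 0 0 0 0 = (\<lambda>x. 0)"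
  by (simp add: cubic_abcd_def fun_eq_iff)

lemma cubic_abcd_scale_form: "(\<lambda>x. k * cubic_abcd a b c d x) = cubic_abcd (k * a) (k * b) (k * c) (k * d)"
  by (simp add: fun_eq_iff cubic_abcd_mult)

lemma cubic_abcd_add: "(\<lambda>x. cubic_abcd a b c d x + cubic_abcd a' b' c' d' x) =
    cubic_abcd (a + a') (b + b') (c + c') (d + d')"
  by (simp add: fun_eq_iff cubic_abcd_def algebra_simps)

lemma coef_poly_functions:
  "coef_a \<in> poly_functions V" "coef_b \<in> poly_functions V" "coef_c \<in> poly_functions V"
  "coef_d \<in> poly_functions V"
  by (rule poly_functions.linear; simp add: coef_a_def coef_b_def coef_c_def coef_d_def)+

lemma poly_functions_power: "P \<in> poly_functions V \<Longrightarrow> (\<lambda>f. P f ^ n) \<in> poly_functions V"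
proof (induction n)
  case 0 show ?case using poly_functions.const[of 1] by simp
next
  case (Suc n) then show ?case using poly_functions.mult[of P V "\<lambda>f. P f ^ n"] by simp
qed

lemma poly_functions_diff:
  assumes "P \<in> poly_functions V" "Q \<in> poly_functions V" shows "(\<lambda>f. P f - Q f) \<in> poly_functions V"
  using poly_functions.add[OF assms(1) poly_functions.mult[OF poly_functions.const[of "-1"] assms(2)]]
  by simp

lemmas poly_functions_intros = coef_poly_functions poly_functions_power poly_functions_diff
  poly_functions.add poly_functions.mult poly_functions.const

lemma act_inverse_monomial:
  assumes "matrix_inv A = monomial_matrix b e"
  shows "act A f x = f (\<chi> k. b k * x $ (k + e))"
proof -
  have "matrix_inv A *v x = (\<chi> k. b k * x $ (k + e))"
    by (simp add: vec_eq_iff assms monomial_matrix_vec)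
  then show ?thesis by (simp add: act_def)
qed

text \<open>The relations come from multiplying the entry products over an orbit of the shift by 2.
  An odd shift exchanges a with b and c with d; being an odd permutation of six coordinates, it
  makes the product \<beta>3 \<beta>4 of all entries equal to -1 in determinant 1. This is why only
  the square of that product is recorded.\<close>

lemma act_N_SL_F21:
  assumes "A \<in> N_SL_F21"
  obtains \<beta>1 \<beta>2 \<beta>3 \<beta>4 where "\<beta>1 \<noteq> 0" "\<beta>2 \<noteq> 0" "\<beta>3 \<noteq> 0" "\<beta>4 \<noteq> 0"
    "\<beta>1^3 = \<beta>3^2 * \<beta>4" "\<beta>2^3 = \<beta>4^2 * \<beta>3" "(\<beta>3 * \<beta>4)^2 = 1"
    "(\<forall>a b c d. act A (cubic_abcd a b c d) = cubic_abcd (\<beta>1 * a) (\<beta>2 * b) (\<beta>3 * c) (\<beta>4 * d)) \<or>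
     (\<forall>a b c d. act A (cubic_abcd a b c d) = cubic_abcd (\<beta>2 * b) (\<beta>1 * a) (\<beta>4 * d) (\<beta>3 * c))"
proof -
  obtain b e where A: "matrix_inv A = monomial_matrix b e" and b0: "\<And>k. b k \<noteq> 0" and
    b: "(b 3)^2 * b 4 = (b 1)^2 * b 2" "(b 5)^2 * b 6 = (b 1)^2 * b 2"
    "(b 4)^2 * b 5 = (b 2)^2 * b 3" "(b 6)^2 * b 1 = (b 2)^2 * b 3" and
    prod: "(b 1 * b 2 * b 3 * b 4 * b 5 * b 6)^2 = 1"
    by (rule N_SL_F21_entries[OF assms]) (rule that)
  define \<beta>1 \<beta>2 \<beta>3 \<beta>4 where \<beta>: "\<beta>1 = (b 1)^2 * b 2" "\<beta>2 = (b 2)^2 * b 3"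
    "\<beta>3 = b 1 * b 3 * b 5" "\<beta>4 = b 2 * b 4 * b 6"
  have "\<beta>1^3 = ((b 1)^2 * b 2) * ((b 3)^2 * b 4) * ((b 5)^2 * b 6)"
    unfolding b(1,2) \<beta> by (simp add: power3_eq_cube)
  then have \<beta>13: "\<beta>1^3 = \<beta>3^2 * \<beta>4" unfolding \<beta> by (simp add: power_mult_distrib mult_ac)
  have "\<beta>2^3 = ((b 2)^2 * b 3) * ((b 4)^2 * b 5) * ((b 6)^2 * b 1)"
    unfolding b(3,4) \<beta> by (simp add: power3_eq_cube)
  then have \<beta>23: "\<beta>2^3 = \<beta>4^2 * \<beta>3" unfolding \<beta> by (simp add: power_mult_distrib mult_ac)
  have \<beta>34: "(\<beta>3 * \<beta>4)^2 = 1" using prod unfolding \<beta> by (simp add: mult_ac)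
  have form: "act A (cubic_abcd p q r s) x =
      p * \<beta>1 * ((x $ (1 + e))\<^sup>2 * x $ (2 + e) + (x $ (3 + e))\<^sup>2 * x $ (4 + e) + (x $ (5 + e))\<^sup>2 * x $
        (6 + e))
    + q * \<beta>2 * ((x $ (2 + e))\<^sup>2 * x $ (3 + e) + (x $ (4 + e))\<^sup>2 * x $ (5 + e) + (x $ (6 + e))\<^sup>2 * x $
      (1 + e))
    + r * \<beta>3 * (x $ (1 + e) * x $ (3 + e) * x $ (5 + e))
    + s * \<beta>4 * (x $ (2 + e) * x $ (4 + e) * x $ (6 + e))" for p q r s x
  proof -
    have "act A (cubic_abcd p q r s) x =
      p * (((b 1)^2 * b 2) * ((x $ (1 + e))\<^sup>2 * x $ (2 + e)) + ((b 3)^2 * b 4) * ((x $ (3 + e))\<^sup>2 * x $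
        (4 + e))
        + ((b 5)^2 * b 6) * ((x $ (5 + e))\<^sup>2 * x $ (6 + e)))
    + q * (((b 2)^2 * b 3) * ((x $ (2 + e))\<^sup>2 * x $ (3 + e)) + ((b 4)^2 * b 5) * ((x $ (4 + e))\<^sup>2 * x $
      (5 + e))
        + ((b 6)^2 * b 1) * ((x $ (6 + e))\<^sup>2 * x $ (1 + e)))
    + r * ((b 1 * b 3 * b 5) * (x $ (1 + e) * x $ (3 + e) * x $ (5 + e)))
    + s * ((b 2 * b 4 * b 6) * (x $ (2 + e) * x $ (4 + e) * x $ (6 + e)))"
      unfolding act_inverse_monomial[OF A] cubic_abcd_def vec_lambda_beta power_mult_distrib
      by (simp only: mult_ac)
    then show ?thesis unfolding b \<beta>[symmetric] by (simp add: distrib_left mult_ac)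
  qed
  have "(\<forall>p q r s. act A (cubic_abcd p q r s) = cubic_abcd (\<beta>1 * p) (\<beta>2 * q) (\<beta>3 * r) (\<beta>4 * s)) \<or>
     (\<forall>p q r s. act A (cubic_abcd p q r s) = cubic_abcd (\<beta>2 * q) (\<beta>1 * p) (\<beta>4 * s) (\<beta>3 * r))"
  proof -
    consider "e = 2 \<or> e = 4 \<or> e = 6" | "e = 1 \<or> e = 3 \<or> e = 5" using exhaust_6[of e] by blast
    then show ?thesis
    proof cases
      case 1
      have "act A (cubic_abcd p q r s) x = cubic_abcd (\<beta>1 * p) (\<beta>2 * q) (\<beta>3 * r) (\<beta>4 * s) x" for p q r s x
        unfolding form using 1 by (elim disjE) (simp_all add: cubic_abcd_def numerals_mod_6 mult_ac add_ac)
      then show ?thesis by blast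
    next
      case 2
      have "act A (cubic_abcd p q r s) x = cubic_abcd (\<beta>2 * q) (\<beta>1 * p) (\<beta>4 * s) (\<beta>3 * r) x" for p q r s x
        unfolding form using 2 by (elim disjE) (simp_all add: cubic_abcd_def numerals_mod_6 mult_ac add_ac)
      then show ?thesis by blast
    qed
  qed
  then show ?thesis using that[of \<beta>1 \<beta>2 \<beta>3 \<beta>4] \<beta>13 \<beta>23 \<beta>34 b0 unfolding \<beta> by simp
qed

lemma act_N_SL_in_V: "A \<in> N_SL_F21 \<Longrightarrow> f \<in> V_F21 \<Longrightarrow> act A f \<in> V_F21"
  unfolding mem_V_F21_iff using act_N_SL_F21[of A] by metis

section \<open>Four explicit invariants\<close>

abbreviation inv_forms :: "nat \<Rightarrow> (form6 \<Rightarrow> complex) set" where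
  "inv_forms n \<equiv> homogeneous_invariants N_SL_F21 V_F21 n"

lemma inv_formsI:
  assumes "P \<in> poly_functions V_F21"
    and P: "\<And>f. P f = F (coef_a f) (coef_b f) (coef_c f) (coef_d f)"
    and hom: "\<And>k a b c d. F (k * a) (k * b) (k * c) (k * d) = k^n * F a b c d"
    and inv: "\<And>\<beta>1 \<beta>2 \<beta>3 \<beta>4 a b c d. \<beta>1^3 = \<beta>3^2 * \<beta>4 \<Longrightarrow> \<beta>2^3 = \<beta>4^2 * \<beta>3 \<Longrightarrow> (\<beta>3 * \<beta>4)^2 = 1 \<Longrightarrow>
      F (\<beta>1 * a) (\<beta>2 * b) (\<beta>3 * c) (\<beta>4 * d) = F a b c d"
    and swap: "\<And>a b c d. F b a d c = F a b c d"
  shows "P \<in> inv_forms n"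
  unfolding homogeneous_invariants_def
proof (intro CollectI conjI ballI allI)
  show "P \<in> poly_functions V_F21" by fact
  show "P (\<lambda>x. k * f x) = k ^ n * P f" if "f \<in> V_F21" for f k
    using that unfolding mem_V_F21_iff by (auto simp: P cubic_abcd_scale_form hom)
  show "P (act A f) = P f" if A: "A \<in> N_SL_F21" and f: "f \<in> V_F21" for A f
  proof -
    obtain a b c d where f: "f = cubic_abcd a b c d" using f unfolding mem_V_F21_iff by blast
    obtain \<beta>1 \<beta>2 \<beta>3 \<beta>4 where \<beta>: "\<beta>1^3 = \<beta>3^2 * \<beta>4" "\<beta>2^3 = \<beta>4^2 * \<beta>3" "(\<beta>3 * \<beta>4)^2 = 1"
      and "act A f = cubic_abcd (\<beta>1 * a) (\<beta>2 * b) (\<beta>3 * c) (\<beta>4 * d) \<or>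
         act A f = cubic_abcd (\<beta>2 * b) (\<beta>1 * a) (\<beta>4 * d) (\<beta>3 * c)"
      unfolding f by (rule act_N_SL_F21[OF A]) blast
    then show ?thesis unfolding f P using inv[OF \<beta>] swap by auto
  qed
qed

definition inv_s :: "form6 \<Rightarrow> complex" where
  "inv_s f = coef_a f ^ 3 * coef_d f + coef_b f ^ 3 * coef_c f"
text \<open>Squares, because v = c d and w = (a b)^3 both change sign when \<beta>3 \<beta>4 = -1.
  \<open>disc\<close> is invariant as it stands: each of its terms has even total degree in v and
  w.\<close>

definition inv_v2 :: "form6 \<Rightarrow> complex" where "inv_v2 f = (coef_c f * coef_d f)^2"
definition inv_w2 :: "form6 \<Rightarrow> complex" where "inv_w2 f = (coef_a f * coef_b f)^6"
definition inv_disc :: "form6 \<Rightarrow> complex" where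
  "inv_disc f = disc (coef_a f) (coef_b f) (coef_c f) (coef_d f)"

lemma inv_s: "inv_s \<in> inv_forms 4"
proof (rule inv_formsI[where F = "\<lambda>a b c d. a^3 * d + b^3 * c"])
  show "inv_s \<in> poly_functions V_F21" unfolding inv_s_def by (intro poly_functions_intros)
  fix \<beta>1 \<beta>2 \<beta>3 \<beta>4 a b c d :: complex
  assume "\<beta>1^3 = \<beta>3^2 * \<beta>4" "\<beta>2^3 = \<beta>4^2 * \<beta>3" "(\<beta>3 * \<beta>4)^2 = 1"
  then show "(\<beta>1 * a)^3 * (\<beta>4 * d) + (\<beta>2 * b)^3 * (\<beta>3 * c) = a^3 * d + b^3 * c"
    unfolding power_mult_distrib by algebra
qed (auto simp: inv_s_def algebra_simps eval_nat_numeral)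

lemma inv_v2: "inv_v2 \<in> inv_forms 4"
proof (rule inv_formsI[where F = "\<lambda>a b c d. (c * d)^2"])
  show "inv_v2 \<in> poly_functions V_F21" unfolding inv_v2_def by (intro poly_functions_intros)
  fix \<beta>1 \<beta>2 \<beta>3 \<beta>4 a b c d :: complex
  assume "(\<beta>3 * \<beta>4)^2 = 1"
  then show "(\<beta>3 * c * (\<beta>4 * d))^2 = (c * d)^2" by algebra
qed (auto simp: inv_v2_def algebra_simps eval_nat_numeral)

lemma inv_w2: "inv_w2 \<in> inv_forms 12"
proof (rule inv_formsI[where F = "\<lambda>a b c d. (a * b)^6"])
  show "inv_w2 \<in> poly_functions V_F21" unfolding inv_w2_def by (intro poly_functions_intros)
  fix \<beta>1 \<beta>2 \<beta>3 \<beta>4 a b c d :: complex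
  assume "\<beta>1^3 = \<beta>3^2 * \<beta>4" "\<beta>2^3 = \<beta>4^2 * \<beta>3" "(\<beta>3 * \<beta>4)^2 = 1"
  then have "\<beta>1^6 * \<beta>2^6 = 1" by algebra
  then show "(\<beta>1 * a * (\<beta>2 * b))^6 = (a * b)^6" by (simp add: power_mult_distrib mult_ac)
qed (auto simp: inv_w2_def algebra_simps power_mult_distrib eval_nat_numeral)

lemma inv_disc: "inv_disc \<in> inv_forms 12"
proof (rule inv_formsI[where F = disc])
  show "inv_disc \<in> poly_functions V_F21" unfolding inv_disc_def disc_def Let_def
    by (intro poly_functions_intros)
  show "disc (k * a) (k * b) (k * c) (k * d) = k ^ 12 * disc a b c d" for k a b c d
    unfolding disc_def Let_def by algebra
  show "disc b a d c = disc a b c d" for a b c d unfolding disc_def Let_def by algebra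
  fix \<beta>1 \<beta>2 \<beta>3 \<beta>4 a b c d :: complex
  assume \<beta>: "\<beta>1^3 = \<beta>3^2 * \<beta>4" "\<beta>2^3 = \<beta>4^2 * \<beta>3" "(\<beta>3 * \<beta>4)^2 = 1"
  define \<delta> where "\<delta> = \<beta>3 * \<beta>4"
  have \<delta>: "\<delta> ^ 2 = 1" using \<beta>(3) by (simp add: \<delta>_def)
  have v: "\<beta>3 * c * (\<beta>4 * d) = \<delta> * (c * d)" by (simp add: \<delta>_def mult_ac)
  have s: "(\<beta>1 * a)^3 * (\<beta>4 * d) + (\<beta>2 * b)^3 * (\<beta>3 * c) = a^3 * d + b^3 * c"
    using \<beta> unfolding power_mult_distrib by algebra
  have w: "(\<beta>1 * a * (\<beta>2 * b))^3 = \<delta> * (a * b)^3"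
    using \<beta> unfolding power_mult_distrib \<delta>_def by algebra
  show "disc (\<beta>1 * a) (\<beta>2 * b) (\<beta>3 * c) (\<beta>4 * d) = disc a b c d"
    unfolding disc_def Let_def v s w using \<delta> by algebra
qed (simp add: inv_disc_def)

section \<open>Lines of invariant cubics and nonvanishing of invariants\<close>

lemma line_self: "f \<in> line f" unfolding line_def by (auto intro!: exI[of _ 1])

lemma inv_forms_scale:
  assumes "P \<in> inv_forms n"
  shows "P (cubic_abcd (k * a) (k * b) (k * c) (k * d)) = k^n * P (cubic_abcd a b c d)"
  using assms cubic_abcd_in_V[of a b c d] unfolding homogeneous_invariants_def
  by (auto simp flip: cubic_abcd_scale_form)

lemma inv_forms_act:
  assumes "P \<in> inv_forms n" "A \<in> N_SL_F21"
  shows "P (act A (cubic_abcd a b c d)) = P (cubic_abcd a b c d)"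
  using assms cubic_abcd_in_V[of a b c d] unfolding homogeneous_invariants_def by blast

lemma nonvanishing_pt:
  assumes "P \<in> inv_forms n" "n > 0"
  shows "nonvanishing P (pt a b c d) \<longleftrightarrow> P (cubic_abcd a b c d) \<noteq> 0"
proof
  assume "nonvanishing P (pt a b c d)"
  then obtain k where "P (cubic_abcd (k * a) (k * b) (k * c) (k * d)) \<noteq> 0"
    unfolding nonvanishing_def by (auto elim: pt_memE)
  then show "P (cubic_abcd a b c d) \<noteq> 0" unfolding inv_forms_scale[OF assms(1)] by auto
next
  assume "P (cubic_abcd a b c d) \<noteq> 0"
  then show "nonvanishing P (pt a b c d)" unfolding nonvanishing_def pt_def using line_self by blast
qed

lemma cubic_abcd_nonzero_iff:
  "cubic_abcd a b c d \<noteq> (\<lambda>x. 0) \<longleftrightarrow> a \<noteq> 0 \<or> b \<noteq> 0 \<or> c \<noteq> 0 \<or> d \<noteq> 0"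
  unfolding cubic_abcd_0[symmetric] cubic_abcd_eq_iff by blast

lemma mem_proj_V_iff:
  "l \<in> proj V_F21 \<longleftrightarrow> (\<exists>a b c d. (a \<noteq> 0 \<or> b \<noteq> 0 \<or> c \<noteq> 0 \<or> d \<noteq> 0) \<and> l = pt a b c d)"
proof
  assume "l \<in> proj V_F21"
  then obtain a b c d where "l = line (cubic_abcd a b c d)" "cubic_abcd a b c d \<noteq> (\<lambda>x. 0)"
    unfolding proj_def mem_V_F21_iff by blast
  then show "\<exists>a b c d. (a \<noteq> 0 \<or> b \<noteq> 0 \<or> c \<noteq> 0 \<or> d \<noteq> 0) \<and> l = pt a b c d"
    unfolding pt_def cubic_abcd_nonzero_iff by blast
next
  assume "\<exists>a b c d. (a \<noteq> 0 \<or> b \<noteq> 0 \<or> c \<noteq> 0 \<or> d \<noteq> 0) \<and> l = pt a b c d"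
  then show "l \<in> proj V_F21"
    unfolding proj_def pt_def cubic_abcd_nonzero_iff[symmetric] using cubic_abcd_in_V by blast
qed

lemma pt_eq_range: "pt a b c d = range (\<lambda>j. cubic_abcd (j * a) (j * b) (j * c) (j * d))"
  unfolding pt_def line_def cubic_abcd_scale_form by blast

lemma pt_scale:
  assumes "k \<noteq> 0" shows "pt (k * a) (k * b) (k * c) (k * d) = pt a b c d"
proof (intro equalityI subsetI)
  fix f assume "f \<in> pt (k * a) (k * b) (k * c) (k * d)"
  then obtain j where "f = cubic_abcd ((j * k) * a) ((j * k) * b) ((j * k) * c) ((j * k) * d)"
    unfolding pt_eq_range mult.assoc by blast
  then show "f \<in> pt a b c d" unfolding pt_eq_range by blast
next
  fix f assume "f \<in> pt a b c d"
  then obtain j where j: "f = cubic_abcd (j * a) (j * b) (j * c) (j * d)"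
    unfolding pt_eq_range by blast
  show "f \<in> pt (k * a) (k * b) (k * c) (k * d)"
    unfolding pt_eq_range by (rule range_eqI[where x = "j / k"]) (simp add: j assms)
qed

section \<open>Explicit elements of the normalizer acting on cubics\<close>

lemma act_scaled_monomial:
  assumes "k \<noteq> 0" "\<And>i. d i \<noteq> 0"
  shows "act (mat k ** monomial_matrix d e) f x =
    f (\<chi> i. inverse (k * d (i - e)) * x $ (i - e))"
proof -
  have eq: "mat k ** monomial_matrix d e = monomial_matrix (\<lambda>i. k * d i) e"
    by (simp add: mat_monomial monomial_matrix_mult)
  have "matrix_inv (mat k ** monomial_matrix d e) = monomial_matrix (\<lambda>i. inverse (k * d (i - e))) (- e)"
    unfolding eq using monomial_matrix_inverse(2)[of "\<lambda>i. k * d i" e] assms by simp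
  from act_inverse_monomial[OF this] show ?thesis by simp
qed

text \<open>Odd coordinates are scaled by l and even ones by n, up to powers of \<epsilon>; the
  ratio \<epsilon> within each parity is what normalising \<open>g3\<close> up to a scalar asks for.
  The matrices below carry the inverse entries because \<open>act\<close> substitutes the inverse
  matrix.\<close>

definition torus_entries :: "complex \<Rightarrow> complex \<Rightarrow> complex \<Rightarrow> 6 \<Rightarrow> complex" where
  "torus_entries \<epsilon> l n k = (vector [l, n, \<epsilon> * l, \<epsilon> * n, \<epsilon>^2 * l, \<epsilon>^2 * n] :: complex^6) $ k"

lemma torus_entries_simps:
  "torus_entries \<epsilon> l n 1 = l" "torus_entries \<epsilon> l n 2 = n" "torus_entries \<epsilon> l n 3 = \<epsilon> * l"
  "torus_entries \<epsilon> l n 4 = \<epsilon> * n" "torus_entries \<epsilon> l n 5 = \<epsilon>^2 * l" "torus_entries \<epsilon> l n 6 = \<epsilon>^2 * n"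
  "torus_entries \<epsilon> l n 0 = \<epsilon>^2 * n"
  unfolding torus_entries_def vector_6 vector_6_0 by simp_all

lemma torus_in_N_F21:
  assumes "\<epsilon>^3 = 1" "l \<noteq> 0" "n \<noteq> 0"
  shows "torus_entries \<epsilon> l n k \<noteq> 0"
    "to_PGL6 (monomial_matrix (\<lambda>k. inverse (torus_entries \<epsilon> l n k)) 0) \<in> N_F21"
proof -
  have \<epsilon>: "\<epsilon> \<noteq> 0" using assms(1) by auto
  have "\<forall>k. torus_entries \<epsilon> l n k \<noteq> 0"
    unfolding forall_6 torus_entries_simps using assms \<epsilon> by simp
  then show nz: "torus_entries \<epsilon> l n k \<noteq> 0" for k by blast
  have "\<forall>k. torus_entries \<epsilon> l n k = \<epsilon> * torus_entries \<epsilon> l n (k + 4)"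
    unfolding forall_6 using assms(1)
    by (simp add: torus_entries_simps numerals_mod_6 power3_eq_cube power2_eq_square mult.assoc)
  then have "inverse (torus_entries \<epsilon> l n k) = inverse \<epsilon> * inverse (torus_entries \<epsilon> l n (k + 4))" for k
    by (metis inverse_mult_distrib)
  from diag_in_N_F21[of "\<lambda>k. inverse (torus_entries \<epsilon> l n k)" "inverse \<epsilon>", OF this]
  show "to_PGL6 (monomial_matrix (\<lambda>k. inverse (torus_entries \<epsilon> l n k)) 0) \<in> N_F21"
    using \<epsilon> nz by simp
qed

lemma cubic_torus:
  assumes "\<epsilon>^3 = 1"
  shows "cubic_abcd a b c d (\<chi> i. j * torus_entries \<epsilon> l n i * x $ i) =
     cubic_abcd (j^3 * (l^2 * n * a)) (j^3 * (\<epsilon> * n^2 * l * b)) (j^3 * (l^3 * c)) (j^3 * (n^3 * d)) x"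
  unfolding cubic_abcd_def vec_lambda_beta torus_entries_simps using assms by algebra

text \<open>A scalar brings the diagonal matrix to determinant 1 at the price of a factor j^3 on the
  form, which does not affect nonvanishing.\<close>

lemma nonvanishing_torus:
  assumes P: "P \<in> inv_forms m" "m > 0" and "\<epsilon>^3 = 1" "l \<noteq> 0" "n \<noteq> 0"
  shows "nonvanishing P (pt (l^2 * n * a) (\<epsilon> * n^2 * l * b) (l^3 * c) (n^3 * d)) \<longleftrightarrow>
    nonvanishing P (pt a b c d)"
proof -
  let ?d = "\<lambda>k. inverse (torus_entries \<epsilon> l n k)"
  note nz = torus_in_N_F21(1)[OF assms(3-5)]
  have "invertible (monomial_matrix ?d 0)" by (rule monomial_matrix_inverse) (simp add: nz)
  from scale_into_N_SL_F21[OF this torus_in_N_F21(2)[OF assms(3-5)]]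
  obtain k where k: "k \<noteq> 0" "mat k ** monomial_matrix ?d 0 \<in> N_SL_F21" by blast
  define j where "j = inverse k"
  have "act (mat k ** monomial_matrix ?d 0) (cubic_abcd a b c d) =
     cubic_abcd (j^3 * (l^2 * n * a)) (j^3 * (\<epsilon> * n^2 * l * b)) (j^3 * (l^3 * c)) (j^3 * (n^3 * d))"
    unfolding fun_eq_iff using act_scaled_monomial[OF k(1), of ?d 0] nz
    by (simp add: cubic_torus[OF assms(3), symmetric] j_def)
  then have "(j^3)^m * P (cubic_abcd (l^2 * n * a) (\<epsilon> * n^2 * l * b) (l^3 * c) (n^3 * d)) =
      P (cubic_abcd a b c d)"
    using inv_forms_act[OF P(1) k(2), of a b c d] by (simp only: inv_forms_scale[OF P(1)])
  moreover have "j \<noteq> 0" using k by (simp add: j_def)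
  ultimately show ?thesis unfolding nonvanishing_pt[OF P] by auto
qed

lemma nonvanishing_swap:
  assumes P: "P \<in> inv_forms m" "m > 0"
  shows "nonvanishing P (pt b a d c) \<longleftrightarrow> nonvanishing P (pt a b c d)"
proof -
  have "invertible (monomial_matrix (\<lambda>k. 1) 1)" by (rule monomial_matrix_inverse) simp
  from scale_into_N_SL_F21[OF this shift_in_N_F21]
  obtain k where k: "k \<noteq> 0" "mat k ** monomial_matrix (\<lambda>k. 1) 1 \<in> N_SL_F21" by blast
  define j where "j = inverse k"
  have m1: "i - 1 = i + 5" for i :: 6
  proof -
    have "i + 5 = i + 6 - 1" by simp
    then show ?thesis by simp
  qed
  have "act (mat k ** monomial_matrix (\<lambda>k. 1) 1) (cubic_abcd a b c d) =
     cubic_abcd (j^3 * b) (j^3 * a) (j^3 * d) (j^3 * c)"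
    unfolding fun_eq_iff using act_scaled_monomial[OF k(1), of "\<lambda>k. 1" 1]
    by (simp add: m1 numerals_mod_6 cubic_abcd_def j_def[symmetric] power2_eq_square power3_eq_cube
      algebra_simps)
  then have "(j^3)^m * P (cubic_abcd b a d c) = P (cubic_abcd a b c d)"
    using inv_forms_act[OF P(1) k(2), of a b c d] by (simp only: inv_forms_scale[OF P(1)])
  moreover have "j \<noteq> 0" using k by (simp add: j_def)
  ultimately show ?thesis unfolding nonvanishing_pt[OF P] by auto
qed

text \<open>For l = t and n = 1/t the determinant is already 1. No rescaling intervenes, so the
  value itself is preserved and not merely its nonvanishing, as the passage to t = 0
  requires.\<close>

lemma inv_forms_one_parameter_subgroup:
  assumes P: "P \<in> inv_forms m" and "t \<noteq> 0"
  shows "P (cubic_abcd (t * a) (b / t) (t^3 * c) (d / t^3)) = P (cubic_abcd a b c d)"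
proof -
  let ?d = "\<lambda>k. inverse (torus_entries 1 t (1 / t) k)"
  have nz: "torus_entries 1 t (1 / t) k \<noteq> 0" for k
    by (rule torus_in_N_F21) (use assms in auto)
  have N: "to_PGL6 (monomial_matrix ?d 0) \<in> N_F21" by (rule torus_in_N_F21) (use assms in auto)
  have "det (monomial_matrix ?d 0) = (\<Prod>k\<in>UNIV. ?d k)"
    by (subst det_diagonal) (auto simp: monomial_matrix_def)
  also have "\<dots> = 1" unfolding prod_6 torus_entries_simps using assms by simp
  finally have mem: "mat 1 ** monomial_matrix ?d 0 \<in> N_SL_F21"
    unfolding N_SL_F21_def SL6_simps using N by simp
  have "act (mat 1 ** monomial_matrix ?d 0) (cubic_abcd a b c d) =
     cubic_abcd (t^2 * (1/t) * a) (1 * (1/t)^2 * t * b) (t^3 * c) ((1/t)^3 * d)"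
  proof
    fix x
    have "act (mat 1 ** monomial_matrix ?d 0) (cubic_abcd a b c d) x =
      cubic_abcd a b c d (\<chi> i. 1 * torus_entries 1 t (1/t) i * x $ i)"
      using act_scaled_monomial[of 1 ?d 0] nz by simp
    then show "act (mat 1 ** monomial_matrix ?d 0) (cubic_abcd a b c d) x =
      cubic_abcd (t^2 * (1/t) * a) (1 * (1/t)^2 * t * b) (t^3 * c) ((1/t)^3 * d) x"
      unfolding cubic_torus[OF power_one] by simp
  qed
  also have "\<dots> = cubic_abcd (t * a) (b / t) (t^3 * c) (d / t^3)"
    using assms(2) by (simp add: power2_eq_square power_divide)
  finally show ?thesis using inv_forms_act[OF P mem] by metis
qed

section \<open>Points of the quotient\<close>

text \<open>A function that is linear on \<open>V_F21\<close> is a combination of the four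
  coefficients, and polynomials are closed under the remaining constructors.\<close>

lemma poly_functions_along_curve:
  assumes "P \<in> poly_functions V_F21"
  shows "\<exists>q. \<forall>t. P (cubic_abcd (poly pa t) (poly pb t) (poly pc t) (poly pd t)) = poly q t"
  using assms
proof (induction rule: poly_functions.induct)
  case (const k) show ?case by (rule exI[of _ "[:k:]"]) simp
next
  case (linear L)
  have add: "L (cubic_abcd (a + a') (b + b') (c + c') (d + d')) = L (cubic_abcd a b c d)
      + L (cubic_abcd a' b' c' d')"
    for a b c d a' b' c' d'
    using linear(1) cubic_abcd_in_V by (simp flip: cubic_abcd_add)
  have scale: "L (cubic_abcd (k * a) (k * b) (k * c) (k * d)) = k * L (cubic_abcd a b c d)" for k a b c d
    using linear(2) cubic_abcd_in_V by (simp flip: cubic_abcd_scale_form)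
  have L: "L (cubic_abcd a b c d) = a * L (cubic_abcd 1 0 0 0) + b * L (cubic_abcd 0 1 0 0)
      + c * L (cubic_abcd 0 0 1 0) + d * L (cubic_abcd 0 0 0 1)" for a b c d
    using add[of a 0 0 b 0 0 0 0] add[of a 0 b 0 0 c 0 0] add[of a 0 b 0 c 0 0 d]
      scale[of a 1 0 0 0] scale[of b 0 1 0 0] scale[of c 0 0 1 0] scale[of d 0 0 0 1] by simp
  show ?case unfolding L[of "poly pa _"]
    by (intro exI[of _ "smult (L (cubic_abcd 1 0 0 0)) pa + smult (L (cubic_abcd 0 1 0 0)) pb
        + smult (L (cubic_abcd 0 0 1 0)) pc + smult (L (cubic_abcd 0 0 0 1)) pd"]) (simp add: mult.commute)
next
  case (add P Q)
  then obtain p q where "\<forall>t. P (cubic_abcd (poly pa t) (poly pb t) (poly pc t) (poly pd t)) = poly p t"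
    "\<forall>t. Q (cubic_abcd (poly pa t) (poly pb t) (poly pc t) (poly pd t)) = poly q t" by blast
  then show ?case by (intro exI[of _ "p + q"]) simp
next
  case (mult P Q)
  then obtain p q where "\<forall>t. P (cubic_abcd (poly pa t) (poly pb t) (poly pc t) (poly pd t)) = poly p t"
    "\<forall>t. Q (cubic_abcd (poly pa t) (poly pb t) (poly pc t) (poly pd t)) = poly q t" by blast
  then show ?case by (intro exI[of _ "p * q"]) simp
qed

lemma inv_forms_poly: "P \<in> inv_forms n \<Longrightarrow> P \<in> poly_functions V_F21"
  unfolding homogeneous_invariants_def by blast

lemma inv_forms_power:
  assumes "P \<in> inv_forms n" shows "(\<lambda>f. P f ^ k) \<in> inv_forms (n * k)"
  using assms unfolding homogeneous_invariants_def
  by (auto simp: poly_functions_power power_mult_distrib power_mult)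

lemma inv_forms_lincomb:
  assumes "P \<in> inv_forms n" "Q \<in> inv_forms n" shows "(\<lambda>f. c * P f - e * Q f) \<in> inv_forms n"
  using assms unfolding homogeneous_invariants_def
  by (auto simp: algebra_simps intro!: poly_functions_diff poly_functions.mult poly_functions.const)

abbreviation semistable :: "form6 set set" where
  "semistable \<equiv> semistable_locus N_SL_F21 V_F21"

text \<open>The one-parameter subgroup drives the form to zero while every invariant stays constant.\<close>

lemma inv_forms_vanish_at_unstable:
  assumes P: "P \<in> inv_forms n" "n > 0" shows "P (cubic_abcd a 0 c 0) = 0"
proof -
  obtain q where q: "\<And>t. P (cubic_abcd (poly [:0, a:] t) (poly 0 t) (poly [:0, 0, 0, c:] t) (poly 0 t)) =
      poly q t"
    using poly_functions_along_curve[OF inv_forms_poly[OF P(1)]] by blast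
  have "poly q t = P (cubic_abcd a 0 c 0)" if "t \<noteq> 0" for t
    using inv_forms_one_parameter_subgroup[OF P(1) that, of a 0 c 0] q[of t]
    by (simp add: power3_eq_cube mult_ac)
  then have "- {0} \<subseteq> {t. poly (q - [:P (cubic_abcd a 0 c 0):]) t = 0}" by auto
  moreover have "infinite (- {0 :: complex})" by (simp add: infinite_UNIV_char_0)
  ultimately have "q - [:P (cubic_abcd a 0 c 0):] = 0"
    using poly_roots_finite finite_subset by blast
  then have "P (cubic_abcd a 0 c 0) = poly q 0" by simp
  also have "\<dots> = P (cubic_abcd (0 * a) (0 * 0) (0 * c) (0 * 0))" using q[of 0] by simp
  also have "\<dots> = 0" unfolding inv_forms_scale[OF P(1)] using P(2) by simp
  finally show ?thesis .
qed

text \<open>If a b, s and v all vanish, then b = d = 0 or a = c = 0, and the one-parameter subgroup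
  destabilises the form, in the second case after the swap. Otherwise one of \<open>inv_w2\<close>,
  \<open>inv_s\<close>, \<open>inv_v2\<close> is nonzero.\<close>

lemma semistable_iff:
  "l \<in> semistable \<longleftrightarrow> (\<exists>a b c d. l = pt a b c d \<and> (a * b \<noteq> 0 \<or> a^3 * d + b^3 * c \<noteq> 0 \<or> c * d \<noteq> 0))"
proof
  assume "l \<in> semistable"
  then obtain n P a b c d where l: "l = pt a b c d" and P: "P \<in> inv_forms n" "n > 0" "nonvanishing P l"
    unfolding semistable_locus_def mem_proj_V_iff by blast
  have "a * b \<noteq> 0 \<or> a^3 * d + b^3 * c \<noteq> 0 \<or> c * d \<noteq> 0"
  proof (rule ccontr)
    assume "\<not> ?thesis"
    then consider "b = 0" "d = 0" | "a = 0" "c = 0" by force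
    then show False
    proof cases
      case 1
      then show ?thesis using P(3) inv_forms_vanish_at_unstable[OF P(1,2)]
        unfolding l nonvanishing_pt[OF P(1,2)] by blast
    next
      case 2
      have "nonvanishing P (pt b a d c)" using P(3) nonvanishing_swap[OF P(1,2)] l by blast
      then show ?thesis using 2 inv_forms_vanish_at_unstable[OF P(1,2)]
        unfolding nonvanishing_pt[OF P(1,2)] by blast
    qed
  qed
  then show "\<exists>a b c d. l = pt a b c d \<and> (a * b \<noteq> 0 \<or> a^3 * d + b^3 * c \<noteq> 0 \<or> c * d \<noteq> 0)"
    using l by blast
next
  assume "\<exists>a b c d. l = pt a b c d \<and> (a * b \<noteq> 0 \<or> a^3 * d + b^3 * c \<noteq> 0 \<or> c * d \<noteq> 0)"
  then obtain a b c d where l: "l = pt a b c d" and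
    nz: "a * b \<noteq> 0 \<or> a^3 * d + b^3 * c \<noteq> 0 \<or> c * d \<noteq> 0" by blast
  have "l \<in> proj V_F21" unfolding mem_proj_V_iff using l nz by (metis mult_eq_0_iff add.right_neutral)
  moreover have "\<exists>n>0. \<exists>P\<in>inv_forms n. nonvanishing P l"
    using nz
  proof (elim disjE)
    assume "a * b \<noteq> 0"
    then have "nonvanishing inv_w2 l" unfolding l nonvanishing_pt[OF inv_w2 zero_less_numeral]
      by (simp add: inv_w2_def)
    then show ?thesis using inv_w2 zero_less_numeral by blast
  next
    assume "a^3 * d + b^3 * c \<noteq> 0"
    then have "nonvanishing inv_s l" unfolding l nonvanishing_pt[OF inv_s zero_less_numeral]
      by (simp add: inv_s_def)
    then show ?thesis using inv_s zero_less_numeral by blast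
  next
    assume "c * d \<noteq> 0"
    then have "nonvanishing inv_v2 l" unfolding l nonvanishing_pt[OF inv_v2 zero_less_numeral]
      by (simp add: inv_v2_def)
    then show ?thesis using inv_v2 zero_less_numeral by blast
  qed
  ultimately show "l \<in> semistable" unfolding semistable_locus_def by blast
qed

section \<open>Classes of the GIT relation\<close>

lemma git_equiv_iff: "(l, m) \<in> git_equiv N_SL_F21 V_F21 \<longleftrightarrow> l \<in> semistable \<and> m \<in> semistable \<and>
     (\<forall>n>0. \<forall>P\<in>inv_forms n. nonvanishing P l \<longleftrightarrow> nonvanishing P m)"
  unfolding git_equiv_def by blast

lemma equiv_git_equiv: "equiv semistable (git_equiv N_SL_F21 V_F21)"
proof (rule equivI)
  show "git_equiv N_SL_F21 V_F21 \<subseteq> semistable \<times> semistable" unfolding git_equiv_def by blast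
  show "refl_on semistable (git_equiv N_SL_F21 V_F21)" by (rule refl_onI) (simp add: git_equiv_iff)
  show "sym (git_equiv N_SL_F21 V_F21)" by (rule symI) (simp add: git_equiv_iff)
  show "trans (git_equiv N_SL_F21 V_F21)" by (rule transI) (simp add: git_equiv_iff)
qed

lemma mem_git_point_iff: "m \<in> git_point l \<longleftrightarrow> (l, m) \<in> git_equiv N_SL_F21 V_F21"
  unfolding git_point_def orbit_image_def by blast

lemma self_mem_git_point: "l \<in> semistable \<Longrightarrow> l \<in> git_point l"
  by (simp add: mem_git_point_iff git_equiv_iff)

lemma mem_compactified_iff: "x \<in> compactified_moduli_F21 \<longleftrightarrow> (\<exists>l\<in>semistable. x = git_point l)"
  unfolding compactified_moduli_F21_def git_quotient_def git_point_def orbit_image_def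
  by (auto simp: quotient_def)

lemma git_point_eqI:
  assumes "l \<in> semistable" "m \<in> proj V_F21"
    "\<And>n P. n > 0 \<Longrightarrow> P \<in> inv_forms n \<Longrightarrow> nonvanishing P l \<longleftrightarrow> nonvanishing P m"
  shows "git_point l = git_point m"
proof -
  have "m \<in> semistable" using assms unfolding semistable_locus_def by blast
  then have "(l, m) \<in> git_equiv N_SL_F21 V_F21" unfolding git_equiv_iff using assms by blast
  then show ?thesis unfolding git_point_def orbit_image_def
    by (rule equiv_class_eq[OF equiv_git_equiv])
qed

text \<open>For a point of the quotient and an invariant of positive degree, any representative
  decides; see \<open>nonzero_at_mem\<close>.\<close>

definition nonzero_at :: "(form6 \<Rightarrow> complex) \<Rightarrow> form6 set set \<Rightarrow> bool" where
  "nonzero_at P x \<longleftrightarrow> (\<exists>l\<in>x. nonvanishing P l)"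

lemma nonzero_at_mem:
  assumes "x \<in> compactified_moduli_F21" "l \<in> x" "P \<in> inv_forms n" "n > 0"
  shows "nonzero_at P x \<longleftrightarrow> nonvanishing P l"
proof -
  obtain m where m: "m \<in> semistable" "x = git_point m" using assms(1) mem_compactified_iff by blast
  have "nonvanishing P l' \<longleftrightarrow> nonvanishing P m" if "l' \<in> x" for l'
    using that assms(3,4) unfolding m(2) mem_git_point_iff git_equiv_iff by blast
  then show ?thesis unfolding nonzero_at_def using assms(2) by blast
qed

lemma git_point_pt:
  assumes "a * b \<noteq> 0 \<or> a^3 * d + b^3 * c \<noteq> 0 \<or> c * d \<noteq> 0"
  shows "pt a b c d \<in> semistable" "pt a b c d \<in> git_point (pt a b c d)"
    "git_point (pt a b c d) \<in> compactified_moduli_F21"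
proof -
  show s: "pt a b c d \<in> semistable" unfolding semistable_iff using assms by blast
  show "pt a b c d \<in> git_point (pt a b c d)" using self_mem_git_point[OF s] .
  show "git_point (pt a b c d) \<in> compactified_moduli_F21" using s mem_compactified_iff by blast
qed

lemma nonzero_at_git_point:
  assumes "a * b \<noteq> 0 \<or> a^3 * d + b^3 * c \<noteq> 0 \<or> c * d \<noteq> 0" "P \<in> inv_forms n" "n > 0"
  shows "nonzero_at P (git_point (pt a b c d)) \<longleftrightarrow> P (cubic_abcd a b c d) \<noteq> 0"
  using nonzero_at_mem[OF git_point_pt(3,2)[OF assms(1)] assms(2,3)] nonvanishing_pt[OF assms(2,3)]
  by simp

lemma compactified_cases:
  assumes "x \<in> compactified_moduli_F21"
  obtains a b c d where "x = git_point (pt a b c d)" "a * b \<noteq> 0 \<or> a^3 * d + b^3 * c \<noteq> 0 \<or> c * d \<noteq> 0"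
proof -
  obtain l where "l \<in> semistable" "x = git_point l" using assms mem_compactified_iff by blast
  then show ?thesis using that unfolding semistable_iff by blast
qed

lemma mem_class_cases:
  assumes "x \<in> compactified_moduli_F21" "l \<in> x"
  obtains a b c d where "l = pt a b c d" "\<And>P n. P \<in> inv_forms n \<Longrightarrow> n > 0 \<Longrightarrow>
    nonzero_at P x \<longleftrightarrow> P (cubic_abcd a b c d) \<noteq> 0"
proof -
  obtain m where m: "x = git_point m" using assms(1) mem_compactified_iff by blast
  have "l \<in> semistable" using assms(2) unfolding m mem_git_point_iff git_equiv_iff by blast
  then obtain a b c d where l: "l = pt a b c d" unfolding semistable_iff by blast
  show ?thesis by (rule that[OF l]) (simp add: nonzero_at_mem[OF assms] l nonvanishing_pt)
qed

lemma git_point_torus: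
  assumes "a * b \<noteq> 0 \<or> a^3 * d + b^3 * c \<noteq> 0 \<or> c * d \<noteq> 0" "\<epsilon>^3 = 1" "l \<noteq> 0" "n \<noteq> 0" "k \<noteq> 0"
    "l^2 * n * a = k * a'" "\<epsilon> * n^2 * l * b = k * b'" "l^3 * c = k * c'" "n^3 * d = k * d'"
  shows "git_point (pt a b c d) = git_point (pt a' b' c' d')"
proof (rule git_point_eqI)
  show "pt a b c d \<in> semistable" using git_point_pt(1)[OF assms(1)] .
  have "\<epsilon> \<noteq> 0" using assms(2) by auto
  have "a' \<noteq> 0 \<or> b' \<noteq> 0 \<or> c' \<noteq> 0 \<or> d' \<noteq> 0"
  proof (rule ccontr)
    assume "\<not> ?thesis"
    then have z: "a' = 0" "b' = 0" "c' = 0" "d' = 0" by blast+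
    have "a = 0" using assms(3,4,6) unfolding z by simp
    moreover have "b = 0" using assms(3,4,7) \<open>\<epsilon> \<noteq> 0\<close> unfolding z by simp
    moreover have "c = 0" using assms(3,8) unfolding z by simp
    moreover have "d = 0" using assms(4,9) unfolding z by simp
    ultimately have "a = 0" "b = 0" "c = 0" "d = 0" by blast+
    then show False using assms(1) by simp
  qed
  then show "pt a' b' c' d' \<in> proj V_F21" unfolding mem_proj_V_iff by blast
  fix m P assume "m > 0" and P: "P \<in> inv_forms m"
  show "nonvanishing P (pt a b c d) \<longleftrightarrow> nonvanishing P (pt a' b' c' d')"
    using nonvanishing_torus[OF P \<open>m > 0\<close> assms(2-4), of a b c d]
    unfolding assms(6-9) pt_scale[OF assms(5)] by simp
qed

lemma git_point_swap:
  assumes "a * b \<noteq> 0 \<or> a^3 * d + b^3 * c \<noteq> 0 \<or> c * d \<noteq> 0"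
  shows "git_point (pt a b c d) = git_point (pt b a d c)"
proof (rule git_point_eqI)
  show "pt a b c d \<in> semistable" using git_point_pt(1)[OF assms] .
  have "b \<noteq> 0 \<or> a \<noteq> 0 \<or> d \<noteq> 0 \<or> c \<noteq> 0" using assms by auto
  then show "pt b a d c \<in> proj V_F21" unfolding mem_proj_V_iff by blast
  show "nonvanishing P (pt a b c d) \<longleftrightarrow> nonvanishing P (pt b a d c)" if "m > 0" "P \<in> inv_forms m" for m P
    using nonvanishing_swap[OF that(2,1)] by simp
qed

section \<open>Normal forms of the points outside the moduli space\<close>

lemma git_point_b_zero:
  assumes "a \<noteq> 0" "d \<noteq> 0" shows "\<exists>t. git_point (pt a 0 c d) = git_point (pt 1 0 t (-1))"
proof -
  \<comment> \<open>Chosen so that l^2 a = -d: scaling the odd coordinates by l brings a and d into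
    the ratio 1 : -1.\<close>
  define l where "l = csqrt (- d / a)"
  have l: "l^2 = - d / a" "l \<noteq> 0" using assms by (auto simp: l_def)
  have "git_point (pt a 0 c d) = git_point (pt 1 0 (- (l^3 * c) / d) (-1))"
    by (rule git_point_torus[where \<epsilon> = 1 and l = l and n = 1 and k = "- d"])
      (use assms l in auto)
  then show ?thesis by blast
qed

lemma git_point_a_b_zero:
  assumes "c \<noteq> 0" "d \<noteq> 0" shows "git_point (pt 0 0 c d) = git_point (pt 0 0 1 1)"
proof -
  define l where "l = exp (Ln (d / c) / 3)"
  have l: "l^3 = d / c" "l \<noteq> 0" using assms by (simp_all add: l_def flip: exp_of_nat_mult)
  show ?thesis
    by (rule git_point_torus[where \<epsilon> = 1 and l = l and n = 1 and k = d]) (use assms l in auto)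
qed

text \<open>For w = 0 the discriminant is -(4 s + v^2)^3, which vanishes at [1,0,-2,-1], the limit
  of the parametrisation below for r -> 0. That point belongs to the other curve; the condition on
  \<open>inv_w2\<close> removes it, so this curve is given as a locally closed set.\<close>

definition curve_ADE :: "form6 set set set" where
  "curve_ADE = {x \<in> compactified_moduli_F21. nonzero_at inv_w2 x \<and> \<not> nonzero_at inv_disc x}"

text \<open>On the zero locus of \<open>inv_w2\<close> the condition on \<open>inv_s\<close> cuts
  away just the class of [0,0,1,1], by \<open>special_point_iff\<close>.\<close>

definition curve_non_ADE :: "form6 set set set" where
  "curve_non_ADE = {x \<in> compactified_moduli_F21. \<not> nonzero_at inv_w2 x \<and> nonzero_at inv_s x}"

lemma inv_git_point:
  assumes "a * b \<noteq> 0 \<or> a^3 * d + b^3 * c \<noteq> 0 \<or> c * d \<noteq> 0"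
  shows "nonzero_at inv_w2 (git_point (pt a b c d)) \<longleftrightarrow> a * b \<noteq> 0"
    "nonzero_at inv_disc (git_point (pt a b c d)) \<longleftrightarrow> disc a b c d \<noteq> 0"
    "nonzero_at inv_s (git_point (pt a b c d)) \<longleftrightarrow> a^3 * d + b^3 * c \<noteq> 0"
  using nonzero_at_git_point[OF assms inv_w2] nonzero_at_git_point[OF assms inv_disc]
    nonzero_at_git_point[OF assms inv_s]
  by (simp_all add: inv_w2_def inv_disc_def inv_s_def)

lemma curve_non_ADE_eq: "curve_non_ADE = {git_point (pt 1 0 t (-1)) | t. True}"
proof (intro equalityI subsetI)
  fix x assume x: "x \<in> curve_non_ADE"
  then have "x \<in> compactified_moduli_F21" unfolding curve_non_ADE_def by blast
  then obtain a b c d where ss: "x = git_point (pt a b c d)"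
    "a * b \<noteq> 0 \<or> a^3 * d + b^3 * c \<noteq> 0 \<or> c * d \<noteq> 0" by (rule compactified_cases)
  have ab: "a * b = 0" "a^3 * d + b^3 * c \<noteq> 0"
    using x unfolding curve_non_ADE_def ss(1) by (simp_all add: inv_git_point[OF ss(2)])
  have "\<exists>t. x = git_point (pt 1 0 t (-1))"
  proof (cases "b = 0")
    case True
    then show ?thesis using ab ss(1) git_point_b_zero[of a d c] by auto
  next
    case False
    then have "a = 0" using ab by simp
    then have "x = git_point (pt b 0 d c)" using git_point_swap[OF ss(2)] ss(1) by simp
    then show ?thesis using ab \<open>a = 0\<close> git_point_b_zero[of b c d] by auto
  qed
  then show "x \<in> {git_point (pt 1 0 t (-1)) | t. True}" by blast
next
  fix x assume "x \<in> {git_point (pt 1 0 t (-1)) | t. True}"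
  then obtain t where x: "x = git_point (pt 1 0 t (-1))" by blast
  then show "x \<in> curve_non_ADE" unfolding curve_non_ADE_def x
    using git_point_pt(3)[of 1 0 "-1" t] by (simp add: inv_git_point)
qed

lemma special_point_iff:
  "x \<in> compactified_moduli_F21 \<and> \<not> nonzero_at inv_w2 x \<and> \<not> nonzero_at inv_s x \<longleftrightarrow>
    x = git_point (pt 0 0 1 1)"
proof
  assume x: "x \<in> compactified_moduli_F21 \<and> \<not> nonzero_at inv_w2 x \<and> \<not> nonzero_at inv_s x"
  then have "x \<in> compactified_moduli_F21" by blast
  then obtain a b c d where ss: "x = git_point (pt a b c d)"
    "a * b \<noteq> 0 \<or> a^3 * d + b^3 * c \<noteq> 0 \<or> c * d \<noteq> 0" by (rule compactified_cases)
  have ab: "a * b = 0" "a^3 * d + b^3 * c = 0"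
    using x unfolding ss(1) by (simp_all add: inv_git_point[OF ss(2)])
  then have cd: "c \<noteq> 0" "d \<noteq> 0" using ss(2) by auto
  then have "a = 0 \<and> b = 0" using ab by force
  then show "x = git_point (pt 0 0 1 1)" using git_point_a_b_zero[OF cd] ss(1) by simp
next
  assume x: "x = git_point (pt 0 0 1 1)"
  show "x \<in> compactified_moduli_F21 \<and> \<not> nonzero_at inv_w2 x \<and> \<not> nonzero_at inv_s x"
    unfolding x using git_point_pt(3)[of 0 0 1 1] by (simp add: inv_git_point)
qed

text \<open>The parameter r is the ratio \<beta> / \<alpha> = \<epsilon> b m / a at a singular
  point. Moving that point to (1,1,1,1,1,1), up to powers of \<epsilon>, and dividing by \<alpha> =
  a m leaves the member of the family with \<alpha> = 1 and \<beta> = r.\<close>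

lemma curve_ADE_eq: "curve_ADE = {git_point (pt 1 r (- (2 + r)) (- (2 * r + 1))) | r. r \<noteq> 0}"
proof (intro equalityI subsetI)
  fix x assume x: "x \<in> curve_ADE"
  then have "x \<in> compactified_moduli_F21" unfolding curve_ADE_def by blast
  then obtain a b c d where ss: "x = git_point (pt a b c d)"
    "a * b \<noteq> 0 \<or> a^3 * d + b^3 * c \<noteq> 0 \<or> c * d \<noteq> 0" by (rule compactified_cases)
  have ab: "a \<noteq> 0" "b \<noteq> 0" "disc a b c d = 0"
    using x unfolding curve_ADE_def ss(1) by (simp_all add: inv_git_point[OF ss(2)])
  obtain \<epsilon> m where \<epsilon>: "\<epsilon>^3 = 1" and m: "m \<noteq> 0" and
    cd: "c = - (2 * (a * m) + \<epsilon> * b * m^2)" "d * m^3 = - (2 * (\<epsilon> * b * m^2) + a * m)"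
    using disc_zero_imp_parameters[OF ab] by blast
  define r where "r = \<epsilon> * b * m / a"
  have r: "\<epsilon> * b * m = a * r" using ab by (simp add: r_def)
  have "r \<noteq> 0" using \<epsilon> ab m by (auto simp: r_def)
  have "x = git_point (pt 1 r (- (2 + r)) (- (2 * r + 1)))"
    unfolding ss(1)
  proof (rule git_point_torus[OF ss(2) \<epsilon>, where l = 1 and n = m and k = "a * m"])
    have "\<epsilon> * m^2 * b = a * m * r" using r by algebra
    then show "\<epsilon> * m^2 * 1 * b = a * m * r" by simp
    have "c = a * m * (- (2 + r))" using cd(1) r by algebra
    then show "1^3 * c = a * m * (- (2 + r))" by simp
    show "m^3 * d = a * m * (- (2 * r + 1))" using cd(2) r by algebra
  qed (use m ab in auto)
  then show "x \<in> {git_point (pt 1 r (- (2 + r)) (- (2 * r + 1))) | r. r \<noteq> 0}" using \<open>r \<noteq> 0\<close> by blast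
next
  fix x assume "x \<in> {git_point (pt 1 r (- (2 + r)) (- (2 * r + 1))) | r. r \<noteq> 0}"
  then obtain r where r: "r \<noteq> 0" "x = git_point (pt 1 r (- (2 + r)) (- (2 * r + 1)))" by blast
  have "disc 1 r (- (2 + r)) (- (2 * r + 1)) = 0" using disc_zero_on_family[of 1 r] by simp
  then show "x \<in> curve_ADE" unfolding curve_ADE_def r(2)
    using git_point_pt(3)[of 1 r] r(1) by (simp add: inv_git_point)
qed

text \<open>Invariants see all representatives of a class at once, so on the curve each of them has
  a b nonzero and \<open>disc\<close> zero. Conversely, a class with w = 0 contains a cubic singular
  along a curve, and if w is nonzero a singular representative forces \<open>disc\<close> to
  vanish.\<close>

lemma curve_ADE_eq_ADE: "curve_ADE = {x \<in> compactified_moduli_F21. \<forall>l\<in>x. singular_of_ADE_type l}"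
proof (intro equalityI subsetI)
  fix x assume x: "x \<in> curve_ADE"
  then have xc: "x \<in> compactified_moduli_F21" unfolding curve_ADE_def by blast
  have "singular_of_ADE_type l" if lx: "l \<in> x" for l
  proof -
    obtain a b c d where l: "l = pt a b c d" "\<And>P n. P \<in> inv_forms n \<Longrightarrow> n > 0 \<Longrightarrow>
      nonzero_at P x \<longleftrightarrow> P (cubic_abcd a b c d) \<noteq> 0"
      by (rule mem_class_cases[OF xc lx]) (rule that)
    have "a \<noteq> 0" "b \<noteq> 0" "disc a b c d = 0"
      using x l(2)[OF inv_w2] l(2)[OF inv_disc] unfolding curve_ADE_def
      by (auto simp: inv_w2_def inv_disc_def)
    then show ?thesis unfolding l(1) using singular_if_disc_zero ADE_if_singular by blast
  qed
  then show "x \<in> {x \<in> compactified_moduli_F21. \<forall>l\<in>x. singular_of_ADE_type l}" using xc by blast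
next
  fix x assume "x \<in> {x \<in> compactified_moduli_F21. \<forall>l\<in>x. singular_of_ADE_type l}"
  then have x: "x \<in> compactified_moduli_F21" "\<And>l. l \<in> x \<Longrightarrow> singular_of_ADE_type l" by blast+
  have "x \<notin> curve_non_ADE"
  proof
    assume "x \<in> curve_non_ADE"
    then obtain t where "x = git_point (pt 1 0 t (-1))" unfolding curve_non_ADE_eq by blast
    then have "pt 1 0 t (-1) \<in> x" using git_point_pt(2)[of 1 0 "-1" t] by simp
    then show False using x(2) not_ADE_b_zero by blast
  qed
  moreover have "x \<noteq> git_point (pt 0 0 1 1)"
  proof
    assume "x = git_point (pt 0 0 1 1)"
    then have "pt 0 0 1 1 \<in> x" using git_point_pt(2)[of 0 0 1 1] by simp
    then show False using x(2) not_ADE_a_b_zero by blast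
  qed
  ultimately have w: "nonzero_at inv_w2 x"
    using special_point_iff[of x] x(1) unfolding curve_non_ADE_def by blast
  obtain a b c d where ss: "x = git_point (pt a b c d)"
    "a * b \<noteq> 0 \<or> a^3 * d + b^3 * c \<noteq> 0 \<or> c * d \<noteq> 0" by (rule compactified_cases[OF x(1)])
  have ab: "a \<noteq> 0" "b \<noteq> 0" using w unfolding ss(1) by (simp_all add: inv_git_point[OF ss(2)])
  have "singular_points (pt a b c d) \<noteq> {}"
    using x(2)[of "pt a b c d"] git_point_pt(2)[OF ss(2)] ss(1) unfolding singular_of_ADE_type_def by blast
  then have "disc a b c d = 0" using disc_zero_if_singular ab by blast
  then show "x \<in> curve_ADE" unfolding curve_ADE_def using x(1) w ss by (simp add: inv_git_point[OF ss(2)])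
qed

section \<open>The Zariski topology of the quotient\<close>

abbreviation basic_open :: "(form6 \<Rightarrow> complex) \<Rightarrow> form6 set set set" where
  "basic_open P \<equiv> {x \<in> compactified_moduli_F21. nonzero_at P x}"

lemma compactified_moduli_topology_eq:
  "compactified_moduli_topology =
    topology_generated_by {basic_open P | P n. n > 0 \<and> P \<in> inv_forms n}"
  unfolding compactified_moduli_topology_def git_topology_def nonzero_at_def
    compactified_moduli_F21_def ..

lemma openin_basic:
  assumes "P \<in> inv_forms n" "n > 0" shows "openin compactified_moduli_topology (basic_open P)"
  unfolding compactified_moduli_topology_eq
  by (rule topology_generated_by_Basis) (use assms in blast)

lemma exists_nonzero_at:
  assumes "x \<in> compactified_moduli_F21" shows "\<exists>n>0. \<exists>P\<in>inv_forms n. nonzero_at P x"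
proof -
  obtain l where l: "l \<in> semistable" "x = git_point l" using assms mem_compactified_iff by blast
  then obtain n P where "n > 0" "P \<in> inv_forms n" "nonvanishing P l"
    unfolding semistable_locus_def by blast
  then show ?thesis using self_mem_git_point[OF l(1)] l(2) unfolding nonzero_at_def by blast
qed

lemma topspace_compactified: "topspace compactified_moduli_topology = compactified_moduli_F21"
proof -
  have "topspace compactified_moduli_topology = \<Union>{basic_open P | P n. n > 0 \<and> P \<in> inv_forms n}"
    unfolding compactified_moduli_topology_eq topology_generated_by_topspace ..
  also have "\<dots> = compactified_moduli_F21"
  proof (intro equalityI subsetI)
    fix x assume x: "x \<in> compactified_moduli_F21"
    then obtain n P where "n > 0" "P \<in> inv_forms n" "x \<in> basic_open P" using exists_nonzero_at[OF x] by auto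
    then show "x \<in> \<Union>{basic_open P | P n. n > 0 \<and> P \<in> inv_forms n}"
      by (intro UnionI[where X = "basic_open P"]) auto
  qed auto
  finally show ?thesis .
qed

text \<open>
  Two invariants of equal degree can be combined to vanish at one point but not at the other, so
  that all points are closed.
\<close>

lemma separate_points:
  assumes x: "x \<in> compactified_moduli_F21" and y: "y \<in> compactified_moduli_F21" and "x \<noteq> y"
  shows "\<exists>n>0. \<exists>P\<in>inv_forms n. nonzero_at P y \<and> \<not> nonzero_at P x"
proof -
  obtain a b c d where X: "x = git_point (pt a b c d)"
    "a * b \<noteq> 0 \<or> a^3 * d + b^3 * c \<noteq> 0 \<or> c * d \<noteq> 0" using x by (rule compactified_cases)
  obtain a' b' c' d' where Y: "y = git_point (pt a' b' c' d')"
    "a' * b' \<noteq> 0 \<or> a'^3 * d' + b'^3 * c' \<noteq> 0 \<or> c' * d' \<noteq> 0" using y by (rule compactified_cases)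
  define f where "f = cubic_abcd a b c d"
  define g where "g = cubic_abcd a' b' c' d'"
  have valx: "nonzero_at P x \<longleftrightarrow> P f \<noteq> 0" if "P \<in> inv_forms n" "n > 0" for P n
    unfolding X(1) f_def using nonzero_at_git_point[OF X(2) that] .
  have valy: "nonzero_at P y \<longleftrightarrow> P g \<noteq> 0" if "P \<in> inv_forms n" "n > 0" for P n
    unfolding Y(1) g_def using nonzero_at_git_point[OF Y(2) that] .
  have "\<exists>n>0. \<exists>P\<in>inv_forms n. nonzero_at P x \<noteq> nonzero_at P y"
  proof (rule ccontr)
    assume neg: "\<not> ?thesis"
    have "git_point (pt a b c d) = git_point (pt a' b' c' d')"
    proof (rule git_point_eqI)
      show "pt a b c d \<in> semistable" using git_point_pt(1)[OF X(2)] .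
      show "pt a' b' c' d' \<in> proj V_F21"
        using git_point_pt(1)[OF Y(2)] unfolding semistable_locus_def by blast
      show "nonvanishing P (pt a b c d) \<longleftrightarrow> nonvanishing P (pt a' b' c' d')"
        if "n > 0" "P \<in> inv_forms n" for n P
        using neg that valx[OF that(2,1)] valy[OF that(2,1)]
        unfolding nonvanishing_pt[OF that(2,1)] f_def g_def by blast
    qed
    then show False using X(1) Y(1) \<open>x \<noteq> y\<close> by simp
  qed
  then obtain n P where P: "n > 0" "P \<in> inv_forms n" "nonzero_at P x \<noteq> nonzero_at P y" by blast
  show ?thesis
  proof (cases "nonzero_at P y")
    case True then show ?thesis using P by blast
  next
    case False
    then have Pg: "P g = 0" "P f \<noteq> 0" using P valx valy by auto
    obtain k R where R: "k > 0" "R \<in> inv_forms k" "nonzero_at R y" using exists_nonzero_at[OF y] by blast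
    then have Rg: "R g \<noteq> 0" using valy by blast
    define Q where "Q = (\<lambda>h. P f ^ k * R h ^ n - R f ^ n * P h ^ k)"
    have "(\<lambda>h. R h ^ n) \<in> inv_forms (n * k)"
      using inv_forms_power[OF R(2), of n] by (simp add: mult.commute)
    then have Q: "Q \<in> inv_forms (n * k)"
      unfolding Q_def by (intro inv_forms_lincomb inv_forms_power P)
    have "Q f = 0" by (simp add: Q_def)
    moreover have "Q g \<noteq> 0" using Pg Rg R(1) by (simp add: Q_def zero_power)
    ultimately show ?thesis using Q P(1) R(1) valx[OF Q] valy[OF Q] by (intro exI[of _ "n * k"]) auto
  qed
qed

lemma closedin_point:
  assumes "x \<in> compactified_moduli_F21" shows "closedin compactified_moduli_topology {x}"
proof -
  have "compactified_moduli_F21 - {x} = \<Union>{basic_open P | P n. n > 0 \<and> P \<in> inv_forms n \<and> \<not> nonzero_at P x}"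
  proof (intro equalityI subsetI)
    fix y assume y: "y \<in> compactified_moduli_F21 - {x}"
    then obtain n P where P: "n > 0" "P \<in> inv_forms n" "nonzero_at P y" "\<not> nonzero_at P x"
      using separate_points[OF assms, of y] by auto
    then show "y \<in> \<Union>{basic_open P | P n. n > 0 \<and> P \<in> inv_forms n \<and> \<not> nonzero_at P x}"
      using y by (intro UnionI[where X = "basic_open P"]) auto
  qed auto
  moreover have "openin compactified_moduli_topology \<dots>"
    by (rule openin_Union) (use openin_basic in blast)
  ultimately show ?thesis unfolding closedin_def topspace_compactified using assms by simp
qed

lemma closedin_finite:
  assumes "finite F" "F \<subseteq> compactified_moduli_F21" shows "closedin compactified_moduli_topology F"
  using assms
proof (induction rule: finite_induct)
  case (insert x F)
  then have "closedin compactified_moduli_topology ({x} \<union> F)"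
    by (intro closedin_Un closedin_point) auto
  then show ?case by simp
qed simp

text \<open>Points being closed, the induced topology on \<open>C\<close> is the cofinite one. An
  infinite cofinite space is irreducible, and its proper irreducible closed subsets are single
  points, so the longest chains are a point inside \<open>C\<close>.\<close>

lemma irreducible_curve_if_cofinite:
  assumes C: "C \<subseteq> compactified_moduli_F21" and inf: "infinite C"
    and lc: "openin compactified_moduli_topology U" "closedin compactified_moduli_topology D" "C = U \<inter> D"
    and cof: "\<And>n P. n > 0 \<Longrightarrow> P \<in> inv_forms n \<Longrightarrow> C \<inter> basic_open P = {} \<or> finite (C - basic_open P)"
  shows "irreducible_curve_in compactified_moduli_topology C"
proof -
  let ?X = compactified_moduli_topology
  \<comment> \<open>Being disjoint from \<open>C\<close> or cofinite in it passes from the basic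
    sets to finite intersections and arbitrary unions.\<close>
  have op: "C \<inter> V = {} \<or> finite (C - V)" if "openin ?X V" for V
  proof -
    have "generate_topology_on {basic_open P | P n. n > 0 \<and> P \<in> inv_forms n} V"
      using that unfolding compactified_moduli_topology_eq openin_topology_generated_by_iff .
    then show ?thesis
    proof (induction rule: generate_topology_on.induct)
      case (Int a b)
      have "C - a \<inter> b = (C - a) \<union> (C - b)" by blast
      then show ?case using Int.IH by auto
    next
      case (UN K)
      show ?case
      proof (cases "\<exists>k\<in>K. finite (C - k)")
        case True
        then obtain k where "k \<in> K" "finite (C - k)" by blast
        moreover have "C - \<Union>K \<subseteq> C - k" using \<open>k \<in> K\<close> by blast
        ultimately show ?thesis using finite_subset by blast
      next
        case False then show ?thesis using UN.IH by blast
      qed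
    next
      case (Basis s) then show ?case using cof by blast
    qed simp
  qed
  have cl: "C \<subseteq> A \<or> finite (C \<inter> A)" if "closedin ?X A" for A
  proof -
    have "openin ?X (compactified_moduli_F21 - A)"
      using that unfolding closedin_def topspace_compactified by blast
    from op[OF this] show ?thesis
    proof
      assume "C \<inter> (compactified_moduli_F21 - A) = {}" then show ?thesis using C by blast
    next
      assume "finite (C - (compactified_moduli_F21 - A))"
      moreover have "C - (compactified_moduli_F21 - A) = C \<inter> A" using C by blast
      ultimately show ?thesis by simp
    qed
  qed
  have "C \<noteq> {}" using inf by auto
  have irr: "irreducible_in ?X C" unfolding irreducible_in_def topspace_compactified
  proof (intro conjI allI impI)
    fix A B assume AB: "closedin ?X A \<and> closedin ?X B \<and> C \<subseteq> A \<union> B"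
    show "C \<subseteq> A \<or> C \<subseteq> B"
    proof (rule ccontr)
      assume "\<not> ?thesis"
      then have "finite (C \<inter> A)" "finite (C \<inter> B)" using cl AB by blast+
      moreover have "C = (C \<inter> A) \<union> (C \<inter> B)" using AB by blast
      ultimately show False using inf by (metis finite_Un)
    qed
  qed (use C \<open>C \<noteq> {}\<close> in auto)
  let ?S = "subtopology ?X C"
  have topS: "topspace ?S = C" using C topspace_compactified by auto
  have clS: "Z = C \<or> finite Z" if Z: "closedin ?S Z" for Z
  proof -
    obtain A where "closedin ?X A" "Z = A \<inter> C" using Z unfolding closedin_subtopology by blast
    then show ?thesis using cl[of A] by (auto simp: Int_commute Int_absorb1)
  qed
  have finS: "closedin ?S F" if "finite F" "F \<subseteq> C" for F
    using closedin_finite[of F] that C unfolding closedin_subtopology by blast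
  have irrS: "\<exists>x. Z = {x}" if Z: "irreducible_in ?S Z" "finite Z" for Z
  proof -
    have "Z \<noteq> {}" "Z \<subseteq> C" using Z(1) unfolding irreducible_in_def topS by blast+
    then obtain x where x: "x \<in> Z" by blast
    have "closedin ?S {x}" "closedin ?S (Z - {x})" using finS Z(2) x \<open>Z \<subseteq> C\<close> by auto
    moreover have "Z \<subseteq> {x} \<union> (Z - {x})" by blast
    ultimately have "Z \<subseteq> {x} \<or> Z \<subseteq> Z - {x}" using Z(1) unfolding irreducible_in_def by blast
    then show ?thesis using x by blast
  qed
  have irrC: "irreducible_in ?S C" unfolding irreducible_in_def topS
  proof (intro conjI allI impI)
    fix A B assume AB: "closedin ?S A \<and> closedin ?S B \<and> C \<subseteq> A \<union> B"
    show "C \<subseteq> A \<or> C \<subseteq> B"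
    proof (rule ccontr)
      assume "\<not> ?thesis"
      then have "finite A" "finite B" using clS AB by blast+
      then show False using AB inf finite_subset by blast
    qed
  qed (use \<open>C \<noteq> {}\<close> in auto)
  have "krull_dim ?S = 1"
    unfolding krull_dim_def
  proof (rule antisym)
    show "Sup {enat n |n. \<exists>Z. (\<forall>i\<le>n. closedin ?S (Z i) \<and> irreducible_in ?S (Z i)) \<and>
        (\<forall>i<n. Z i \<subset> Z (Suc i))} \<le> 1"
    proof (rule Sup_least, clarify)
      fix n Z assume Z: "\<forall>i\<le>n. closedin ?S (Z i) \<and> irreducible_in ?S (Z i)" "\<forall>i<n. Z i \<subset> Z (Suc i)"
      have "n \<le> 1"
      proof (rule ccontr)
        assume "\<not> n \<le> 1"
        then have n: "0 \<le> n" "1 \<le> n" "Suc 1 \<le> n" "0 < n" "1 < n" by auto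
        have "Z 0 \<subset> Z 1" "Z 1 \<subset> Z (Suc 1)" using Z(2) n by auto
        moreover have "Z (Suc 1) \<subseteq> C" "Z 0 \<noteq> {}"
          using Z(1) n unfolding irreducible_in_def topS by blast+
        ultimately have "Z 1 \<noteq> C" by blast
        then have "finite (Z 1)" using clS Z(1) n by blast
        with Z(1)[rule_format, OF n(2)] obtain x where "Z 1 = {x}" using irrS[of "Z 1"] by auto
        then have "Z 0 \<subset> {x}" using \<open>Z 0 \<subset> Z 1\<close> by simp
        then show False using \<open>Z 0 \<noteq> {}\<close> by (simp add: psubset_eq subset_singleton_iff)
      qed
      then show "enat n \<le> 1" by (simp add: one_enat_def)
    qed
    obtain x where x: "x \<in> C" using \<open>C \<noteq> {}\<close> by blast
    define Z where "Z = (\<lambda>i::nat. if i = 0 then {x} else C)"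
    have "irreducible_in ?S {x}" unfolding irreducible_in_def topS using x by auto
    moreover have "closedin ?S {x}" using finS x by simp
    moreover have "closedin ?S C" using closedin_topspace[of ?S] unfolding topS .
    moreover have "{x} \<noteq> C" using inf by (metis finite.emptyI finite.insertI)
    then have "{x} \<subset> C" using x by blast
    ultimately have "(\<forall>i\<le>1. closedin ?S (Z i) \<and> irreducible_in ?S (Z i)) \<and> (\<forall>i<1. Z i \<subset> Z (Suc i))"
      unfolding Z_def using irrC by auto
    then show "1 \<le> Sup {enat n |n. \<exists>Z. (\<forall>i\<le>n. closedin ?S (Z i) \<and> irreducible_in ?S (Z i)) \<and>
        (\<forall>i<n. Z i \<subset> Z (Suc i))}"
      unfolding one_enat_def by (intro Sup_upper) blast
  qed
  then show ?thesis unfolding irreducible_curve_in_def using irr lc by blast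
qed

text \<open>An invariant restricted to a rationally parametrised curve is a polynomial in the parameter.\<close>

lemma irreducible_curve_if_parametrised:
  fixes R :: "complex set"
  assumes C: "C = {git_point (pt (poly pa r) (poly pb r) (poly pc r) (poly pd r)) | r. r \<in> R}"
    and ss: "\<And>r. r \<in> R \<Longrightarrow> poly pa r * poly pb r \<noteq> 0 \<or>
       poly pa r ^ 3 * poly pd r + poly pb r ^ 3 * poly pc r \<noteq> 0 \<or> poly pc r * poly pd r \<noteq> 0"
    and inf: "infinite R"
    and fib: "\<And>r0. r0 \<in> R \<Longrightarrow> \<exists>n>0. \<exists>P\<in>inv_forms n. \<exists>r.
       P (cubic_abcd (poly pa r0) (poly pb r0) (poly pc r0) (poly pd r0)) = 0 \<and>
       P (cubic_abcd (poly pa r) (poly pb r) (poly pc r) (poly pd r)) \<noteq> 0"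
    and lc: "openin compactified_moduli_topology U" "closedin compactified_moduli_topology D" "C = U \<inter> D"
  shows "irreducible_curve_in compactified_moduli_topology C"
proof (rule irreducible_curve_if_cofinite[OF _ _ lc])
  define \<phi> where "\<phi> = (\<lambda>r. git_point (pt (poly pa r) (poly pb r) (poly pc r) (poly pd r)))"
  have C': "C = \<phi> ` R" unfolding C \<phi>_def by blast
  have val: "nonzero_at P (\<phi> r) \<longleftrightarrow> P (cubic_abcd (poly pa r) (poly pb r) (poly pc r) (poly pd r)) \<noteq> 0"
    if "r \<in> R" "P \<in> inv_forms n" "n > 0" for r P n
    unfolding \<phi>_def by (rule nonzero_at_git_point[OF ss[OF that(1)] that(2,3)])
  show sub: "C \<subseteq> compactified_moduli_F21"
    unfolding C' \<phi>_def using git_point_pt(3)[OF ss] by blast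
  show "infinite C"
  proof
    assume "finite C"
    \<comment> \<open>A finite image would make some fibre infinite, and the invariant from
      \<open>fib\<close> would restrict to a polynomial with infinitely many roots. The parameter at
      which that invariant is nonzero may lie outside \<open>R\<close>: it only shows that the
      polynomial is not zero.\<close>
    then have "\<exists>r0\<in>R. infinite {r \<in> R. \<phi> r = \<phi> r0}"
      using pigeonhole_infinite[OF inf, of \<phi>] unfolding C' by blast
    then obtain r0 where r0: "r0 \<in> R" "infinite {r \<in> R. \<phi> r = \<phi> r0}" by blast
    obtain n P r1 where P: "n > 0" "P \<in> inv_forms n"
      "P (cubic_abcd (poly pa r0) (poly pb r0) (poly pc r0) (poly pd r0)) = 0"
      "P (cubic_abcd (poly pa r1) (poly pb r1) (poly pc r1) (poly pd r1)) \<noteq> 0"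
      using fib[OF r0(1)] by blast
    obtain q where q: "\<And>t. P (cubic_abcd (poly pa t) (poly pb t) (poly pc t) (poly pd t)) = poly q t"
      using poly_functions_along_curve[OF inv_forms_poly[OF P(2)]] by blast
    have "q \<noteq> 0" using P(4) q by auto
    have "{r \<in> R. \<phi> r = \<phi> r0} \<subseteq> {r. poly q r = 0}"
    proof clarify
      fix r assume "r \<in> R" "\<phi> r = \<phi> r0"
      then show "poly q r = 0" using val[OF _ P(2,1)] r0(1) P(3) q by metis
    qed
    then show False using r0(2) poly_roots_finite[OF \<open>q \<noteq> 0\<close>] finite_subset by blast
  qed
  show "C \<inter> basic_open P = {} \<or> finite (C - basic_open P)" if P: "n > 0" "P \<in> inv_forms n" for n P
  proof -
    obtain q where q: "\<And>t. P (cubic_abcd (poly pa t) (poly pb t) (poly pc t) (poly pd t)) = poly q t"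
      using poly_functions_along_curve[OF inv_forms_poly[OF P(2)]] by blast
    have valq: "nonzero_at P (\<phi> r) \<longleftrightarrow> poly q r \<noteq> 0" if "r \<in> R" for r
      using val[OF that P(2,1)] q by simp
    show ?thesis
    proof (cases "q = 0")
      case True
      then show ?thesis unfolding C' using valq by auto
    next
      case False
      have "C - basic_open P \<subseteq> \<phi> ` {r. poly q r = 0}"
      proof
        fix x assume "x \<in> C - basic_open P"
        then obtain r where r: "r \<in> R" "x = \<phi> r" "x \<notin> basic_open P" unfolding C' by blast
        then have "\<not> nonzero_at P x" using sub C' by blast
        then show "x \<in> \<phi> ` {r. poly q r = 0}" using valq r by blast
      qed
      then show ?thesis using poly_roots_finite[OF False] finite_subset by blast
    qed
  qed
qed

lemma closedin_zero_locus:
  assumes "P \<in> inv_forms n" "n > 0"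
  shows "closedin compactified_moduli_topology {x \<in> compactified_moduli_F21. \<not> nonzero_at P x}"
proof -
  have "compactified_moduli_F21 - {x \<in> compactified_moduli_F21. \<not> nonzero_at P x} = basic_open P" by blast
  then show ?thesis unfolding closedin_def topspace_compactified using openin_basic[OF assms] by simp
qed

lemma irreducible_curve_non_ADE: "irreducible_curve_in compactified_moduli_topology curve_non_ADE"
proof (rule irreducible_curve_if_parametrised[where R = UNIV and pa = 1 and pb = 0
      and pc = "[:0, 1:]" and pd = "[:-1:]"])
  show "curve_non_ADE = {git_point (pt (poly 1 r) (poly 0 r) (poly [:0, 1:] r) (poly [:-1:] r)) | r.
      r \<in> UNIV}"
    unfolding curve_non_ADE_eq by simp
  show "infinite (UNIV :: complex set)" by (rule infinite_UNIV_char_0)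
  show "openin compactified_moduli_topology (basic_open inv_s)" using openin_basic[OF inv_s] by simp
  show "closedin compactified_moduli_topology {x \<in> compactified_moduli_F21. \<not> nonzero_at inv_w2 x}"
    using closedin_zero_locus[OF inv_w2] by simp
  show "curve_non_ADE = basic_open inv_s \<inter> {x \<in> compactified_moduli_F21. \<not> nonzero_at inv_w2 x}"
    unfolding curve_non_ADE_def by blast
  fix t0 :: complex
  \<comment> \<open>At [1,0,t,-1] one has v^2 = t^2 and s = -1, so this combination becomes t^2 -
    t0^2.\<close>
  define P where "P = (\<lambda>f. 1 * inv_v2 f - (- (t0^2)) * inv_s f)"
  have P: "P \<in> inv_forms 4" unfolding P_def by (intro inv_forms_lincomb inv_v2 inv_s)
  have val: "P (cubic_abcd 1 0 t (-1)) = t^2 - t0^2" for t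
    by (simp add: P_def inv_v2_def inv_s_def)
  have "\<exists>t::complex. t^2 - t0^2 \<noteq> 0"
    by (cases "t0 = 0") (auto intro: exI[of _ 0] exI[of _ 1])
  then obtain t where t: "t^2 - t0^2 \<noteq> 0" by blast
  show "\<exists>n>0. \<exists>P\<in>inv_forms n. \<exists>r.
       P (cubic_abcd (poly 1 t0) (poly 0 t0) (poly [:0, 1:] t0) (poly [:-1:] t0)) = 0 \<and>
       P (cubic_abcd (poly 1 r) (poly 0 r) (poly [:0, 1:] r) (poly [:-1:] r)) \<noteq> 0"
    by (rule exI[of _ 4], intro conjI bexI[OF _ P] exI[of _ t]) (use t in \<open>simp_all add: val\<close>)
qed auto

lemma irreducible_curve_ADE: "irreducible_curve_in compactified_moduli_topology curve_ADE"
proof (rule irreducible_curve_if_parametrised[where R = "- {0}" and pa = 1 and pb = "[:0, 1:]"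
      and pc = "[:-2, -1:]" and pd = "[:-1, -2:]"])
  have eq: "poly [:-2, -1:] r = - (2 + r)" "poly [:-1, -2:] r = - (2 * r + 1)" for r :: complex
    by (simp_all add: algebra_simps)
  show "curve_ADE = {git_point (pt (poly 1 r) (poly [:0, 1:] r) (poly [:-2, -1:] r) (poly [:-1, -2:] r)) |
      r. r \<in> - {0}}"
    unfolding curve_ADE_eq eq by simp
  show "infinite (- {0 :: complex})" by (simp add: infinite_UNIV_char_0)
  show "openin compactified_moduli_topology (basic_open inv_w2)" using openin_basic[OF inv_w2] by simp
  show "closedin compactified_moduli_topology {x \<in> compactified_moduli_F21. \<not> nonzero_at inv_disc x}"
    using closedin_zero_locus[OF inv_disc] by simp
  show "curve_ADE = basic_open inv_w2 \<inter> {x \<in> compactified_moduli_F21. \<not> nonzero_at inv_disc x}"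
    unfolding curve_ADE_def by blast
  fix r0 :: complex assume r0: "r0 \<in> - {0}"
  \<comment> \<open>On the family v = (2 + r)(2 r + 1) and w = r^3. The invariant compares the ratio
    of v^6 to w^2, both of degree 12, with its value at r0.\<close>
  define k where "k = ((2 + r0) * (2 * r0 + 1))^6"
  define P where "P = (\<lambda>f. r0^6 * inv_v2 f ^ 3 - k * inv_w2 f)"
  have "(\<lambda>f. inv_v2 f ^ 3) \<in> inv_forms 12" using inv_forms_power[OF inv_v2, of 3] by simp
  then have P: "P \<in> inv_forms 12" unfolding P_def by (intro inv_forms_lincomb inv_w2)
  have val: "P (cubic_abcd 1 r (- (2 + r)) (- (2 * r + 1))) = r0^6 * ((2 + r) * (2 * r + 1))^6 - k * r^6"
    for r
    unfolding P_def inv_v2_def inv_w2_def coef_cubic_abcd minus_mult_minus power_mult[symmetric] by simp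
  \<comment> \<open>The parameter 0 is excluded from the curve but still serves as a witness that
    the restricted polynomial is nonzero.\<close>
  have "P (cubic_abcd 1 0 (- (2 + 0)) (- (2 * 0 + 1))) \<noteq> 0" using r0 unfolding val by simp
  moreover have "P (cubic_abcd 1 r0 (- (2 + r0)) (- (2 * r0 + 1))) = 0" unfolding val k_def by simp
  ultimately have "\<exists>r. P (cubic_abcd 1 r0 (- (2 + r0)) (- (2 * r0 + 1))) = 0 \<and>
      P (cubic_abcd 1 r (- (2 + r)) (- (2 * r + 1))) \<noteq> 0" by blast
  moreover have "poly 1 r = 1" "poly [:0, 1:] r = r" for r :: complex by simp_all
  ultimately show "\<exists>n>0. \<exists>P\<in>inv_forms n. \<exists>r.
       P (cubic_abcd (poly 1 r0) (poly [:0, 1:] r0) (poly [:-2, -1:] r0) (poly [:-1, -2:] r0)) = 0 \<and>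
       P (cubic_abcd (poly 1 r) (poly [:0, 1:] r) (poly [:-2, -1:] r) (poly [:-1, -2:] r)) \<noteq> 0"
    unfolding eq using P zero_less_numeral by metis
qed auto

section \<open>The boundary\<close>

text \<open>The members of a coset differ by scalars, which only rescale forms, so each maps the
  line to the same line. A member of determinant 1 can then be chosen, to which invariance
  applies.\<close>

lemma act_PGL_pt:
  assumes "C \<in> N_F21"
  obtains A a' b' c' d' where "A \<in> N_SL_F21" "act A (cubic_abcd a b c d) = cubic_abcd a' b' c' d'"
    "act_PGL C (pt a b c d) = pt a' b' c' d'"
proof -
  have "C \<in> carrier PGL6" using assms unfolding N_F21_def normalizer_def stabilizer_def by blast
  then obtain A0 where A0: "invertible A0" "C = to_PGL6 A0" using carrier_PGL6 by blast
  obtain k where k: "k \<noteq> 0" "mat k ** A0 \<in> N_SL_F21"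
    using scale_into_N_SL_F21[OF A0(1)] assms A0(2) by blast
  define A where "A = mat k ** A0"
  have A: "A \<in> N_SL_F21" "C = to_PGL6 A" unfolding A_def A0(2) using k to_PGL6_scale by blast+
  have invA: "invertible A" using A(1) det_matrix_inv(1) unfolding N_SL_F21_def SL6_simps by blast
  obtain a' b' c' d' where f': "act A (cubic_abcd a b c d) = cubic_abcd a' b' c' d'"
    using act_N_SL_in_V[OF A(1) cubic_abcd_in_V[of a b c d]] unfolding mem_V_F21_iff by blast
  have "act (mat j ** A) ` pt a b c d = pt a' b' c' d'" if j: "j \<noteq> 0" for j
  proof -
    have mat_inv: "matrix_inv (mat j) = (mat (inverse j) :: complex^6^6)"
      by (rule matrix_inv_unique) (simp_all add: mat_mult_mat j)
    have mj: "matrix_inv (mat j) *v x = inverse j *s x" for x :: "complex^6"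
      unfolding mat_inv by (simp add: vec_eq_iff mat_monomial monomial_matrix_vec)
    have "act (mat j ** A) (cubic_abcd (i * a) (i * b) (i * c) (i * d)) =
        cubic_abcd (i * (inverse j^3 * a')) (i * (inverse j^3 * b')) (i * (inverse j^3 * c'))
            (i * (inverse j^3 * d'))" for i
    proof -
      have "act A (cubic_abcd (i * a) (i * b) (i * c) (i * d)) x = i * act A (cubic_abcd a b c d) x" for x
        unfolding act_def by (simp add: cubic_abcd_mult)
      then have "act A (cubic_abcd (i * a) (i * b) (i * c) (i * d)) = cubic_abcd (i * a') (i * b')
          (i * c') (i * d')"
        unfolding f' fun_eq_iff by (simp add: cubic_abcd_mult)
      then show ?thesis unfolding act_mult[OF invertible_mat[OF j] invA]
        by (simp add: act_def mj cubic_abcd_scale fun_eq_iff cubic_abcd_mult mult_ac)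
    qed
    then have "act (mat j ** A) ` pt a b c d = pt (inverse j^3 * a') (inverse j^3 * b') (inverse j^3 * c')
        (inverse j^3 * d')"
      unfolding pt_eq_range image_image by simp
    then show ?thesis using pt_scale[of "inverse j^3"] j by simp
  qed
  moreover have "act_PGL C (pt a b c d) = (\<Union>j\<in>-{0}. act (mat j ** A) ` pt a b c d)"
    unfolding act_PGL_def A(2) to_PGL6_eq_image by blast
  moreover have "(- {0 :: complex}) \<noteq> {}" by (auto intro: exI[of _ 1])
  ultimately have "act_PGL C (pt a b c d) = pt a' b' c' d'" by simp
  then show ?thesis using that[OF A(1) f'] by blast
qed

text \<open>Invariants are constant along the orbit, so all its points lie in one class of the GIT
  relation. That a b is nonzero gives semistability and, through \<open>inv_w2\<close>, keeps the
  transformed coefficients from vanishing.\<close>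

lemma orbit_image_orbit:
  assumes ab: "a * b \<noteq> 0"
  shows "orbit_image ((\<lambda>C. act_PGL C (pt a b c d)) ` N_F21) = git_point (pt a b c d)"
proof -
  have ss: "pt a b c d \<in> semistable" using git_point_pt(1)[of a b d c] ab by blast
  have eq: "git_point (act_PGL C (pt a b c d)) = git_point (pt a b c d)" if C: "C \<in> N_F21" for C
  proof -
    obtain A a' b' c' d' where A: "A \<in> N_SL_F21" "act A (cubic_abcd a b c d) = cubic_abcd a' b' c' d'"
      "act_PGL C (pt a b c d) = pt a' b' c' d'" by (rule act_PGL_pt[OF C]) (rule that)
    have P: "P (cubic_abcd a' b' c' d') = P (cubic_abcd a b c d)" if "P \<in> inv_forms n" for P n
      using inv_forms_act[OF that A(1), of a b c d] unfolding A(2) .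
    have "a' \<noteq> 0" using P[OF inv_w2] ab by (auto simp: inv_w2_def)
    have "git_point (pt a b c d) = git_point (pt a' b' c' d')"
    proof (rule git_point_eqI[OF ss])
      show "pt a' b' c' d' \<in> proj V_F21" unfolding mem_proj_V_iff using \<open>a' \<noteq> 0\<close> by blast
      show "nonvanishing Q (pt a b c d) \<longleftrightarrow> nonvanishing Q (pt a' b' c' d')"
        if "n > 0" "Q \<in> inv_forms n" for n Q
        unfolding nonvanishing_pt[OF that(2,1)] P[OF that(2)] ..
    qed
    then show ?thesis using A(3) by simp
  qed
  \<comment> \<open>The identity shows that the normalizer is inhabited, so that the union over it
    is the common class rather than empty.\<close>
  have "conj_into_F21 (mat 1) g" if "g \<in> F21" for g
    unfolding conj_into_F21_def using that by (intro exI[of _ 1] exI[of _ g]) simp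
  moreover have "matrix_inv (mat 1) = (mat 1 :: complex^6^6)" by (rule matrix_inv_unique) simp_all
  ultimately have "to_PGL6 (mat 1) \<in> N_F21"
    by (intro mem_N_F21I) (simp_all add: invertible_mat F21_gen)
  then have "N_F21 \<noteq> {}" by blast
  have "orbit_image ((\<lambda>C. act_PGL C (pt a b c d)) ` N_F21) =
      (\<Union>C\<in>N_F21. git_point (act_PGL C (pt a b c d)))"
    unfolding git_point_def orbit_image_def by blast
  then show ?thesis using eq \<open>N_F21 \<noteq> {}\<close> by simp
qed

section \<open>The image of the moduli space and its complement\<close>

lemma smooth_locus_eq: "smooth_locus = {pt a b c d | a b c d. a * b \<noteq> 0 \<and> disc a b c d \<noteq> 0}"
proof (intro equalityI subsetI)
  fix l assume "l \<in> smooth_locus"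
  then obtain a b c d where l: "l = pt a b c d" "singular_points (pt a b c d) = {}"
    unfolding smooth_locus_def smooth_cubic_def mem_proj_V_iff by blast
  then have "a * b \<noteq> 0" using singular_if_ab_zero by blast
  moreover have "disc a b c d \<noteq> 0" using singular_if_disc_zero[of a b c d] l(2) calculation by auto
  ultimately show "l \<in> {pt a b c d | a b c d. a * b \<noteq> 0 \<and> disc a b c d \<noteq> 0}" using l(1) by blast
next
  fix l assume "l \<in> {pt a b c d | a b c d. a * b \<noteq> 0 \<and> disc a b c d \<noteq> 0}"
  then obtain a b c d where l: "l = pt a b c d" "a \<noteq> 0" "b \<noteq> 0" "disc a b c d \<noteq> 0" by auto
  then have "singular_points l = {}" using disc_zero_if_singular by blast
  moreover have "l \<in> proj V_F21" unfolding mem_proj_V_iff using l by blast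
  ultimately show "l \<in> smooth_locus" unfolding smooth_locus_def smooth_cubic_def by blast
qed

lemma image_moduli_F21: "orbit_image ` moduli_F21 =
    {x \<in> compactified_moduli_F21. nonzero_at inv_w2 x \<and> nonzero_at inv_disc x}"
proof (intro equalityI subsetI)
  fix x assume "x \<in> orbit_image ` moduli_F21"
  then obtain a b c d where "a * b \<noteq> 0" "disc a b c d \<noteq> 0"
    "x = orbit_image ((\<lambda>C. act_PGL C (pt a b c d)) ` N_F21)"
    unfolding moduli_F21_def smooth_locus_eq by blast
  then show "x \<in> {x \<in> compactified_moduli_F21. nonzero_at inv_w2 x \<and> nonzero_at inv_disc x}"
    using git_point_pt(3)[of a b d c] by (simp add: orbit_image_orbit inv_git_point)
next
  fix x assume x: "x \<in> {x \<in> compactified_moduli_F21. nonzero_at inv_w2 x \<and> nonzero_at inv_disc x}"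
  then have "x \<in> compactified_moduli_F21" by blast
  then obtain a b c d where ss: "x = git_point (pt a b c d)"
    "a * b \<noteq> 0 \<or> a^3 * d + b^3 * c \<noteq> 0 \<or> c * d \<noteq> 0" by (rule compactified_cases)
  have ab: "a * b \<noteq> 0" "disc a b c d \<noteq> 0"
    using x unfolding ss(1) by (simp_all add: inv_git_point[OF ss(2)])
  then have "(\<lambda>C. act_PGL C (pt a b c d)) ` N_F21 \<in> moduli_F21"
    unfolding moduli_F21_def smooth_locus_eq by blast
  then show "x \<in> orbit_image ` moduli_F21"
    unfolding ss(1) orbit_image_orbit[OF ab(1), symmetric] by (rule imageI)
qed

lemma boundary_F21_eq: "boundary_F21 = curve_ADE \<union> curve_non_ADE \<union> {git_point (pt 0 0 1 1)}"
  unfolding boundary_F21_def image_moduli_F21 curve_ADE_def curve_non_ADE_def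
  using special_point_iff by blast

theorem proposition5p4:
  shows "\<exists>C\<^sub>1 C\<^sub>2.
     irreducible_curve_in compactified_moduli_topology C\<^sub>1 \<and>
     C\<^sub>1 = {x \<in> compactified_moduli_F21. \<forall>l\<in>x. singular_of_ADE_type l} \<and>
     irreducible_curve_in compactified_moduli_topology C\<^sub>2 \<and>
     C\<^sub>2 = {git_point (pt 1 0 t (-1)) | t. True} \<and>
     boundary_F21 = C\<^sub>1 \<union> C\<^sub>2 \<union> {git_point (pt 0 0 1 1)} \<and>
     C\<^sub>1 \<inter> C\<^sub>2 = {} \<and> git_point (pt 0 0 1 1) \<notin> C\<^sub>1 \<union> C\<^sub>2"
proof (intro exI conjI)
  show "irreducible_curve_in compactified_moduli_topology curve_ADE" by (rule irreducible_curve_ADE)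
  show "curve_ADE = {x \<in> compactified_moduli_F21. \<forall>l\<in>x. singular_of_ADE_type l}"
    by (rule curve_ADE_eq_ADE)
  show "irreducible_curve_in compactified_moduli_topology curve_non_ADE"
    by (rule irreducible_curve_non_ADE)
  show "curve_non_ADE = {git_point (pt 1 0 t (-1)) | t. True}" by (rule curve_non_ADE_eq)
  show "boundary_F21 = curve_ADE \<union> curve_non_ADE \<union> {git_point (pt 0 0 1 1)}" by (rule boundary_F21_eq)
  show "curve_ADE \<inter> curve_non_ADE = {}" unfolding curve_ADE_def curve_non_ADE_def by blast
  show "git_point (pt 0 0 1 1) \<notin> curve_ADE \<union> curve_non_ADE"
    using special_point_iff[of "git_point (pt 0 0 1 1)"]
    unfolding curve_ADE_def curve_non_ADE_def by blast
qed

end
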